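(* Let $\mathbb{X}=\{P_1,\dots,P_s\}\subseteq\mathbb{P}^2$ be a set of $s$ distinct $K$-rational points, and let $\nu\ge1$. Then $\mathrm{HP}_{\Omega^2_{R_{\nu\mathbb{X}}/K}}(z)=\frac12(3\nu^2-\nu-2)s$.
   Context: $K$ is a field of characteristic zero, $S=K[X_0,X_1,X_2]$ with the standard grading is the homogeneous coordinate ring of $\mathbb{P}^2$ over $K$; coordinates are chosen so that no $P_j$ lies on $X_0=0$. With $\wp_j\subseteq S$ the homogeneous vanishing ideal of $P_j$, the fat point scheme $\nu\mathbb{X}$ has homogeneous vanishing ideal $I_{\nu\mathbb{X}}=\wp_1^\nu\cap\cdots\cap\wp_s^\nu$ and coordinate ring $R_{\nu\mathbb{X}}=S/I_{\nu\mathbb{X}}$. $\Omega^1_{R_{\nu\mathbb{X}}/K}$ is the module of Kähler differentials of $R_{\nu\mathbb{X}}/K$, graded with $\deg(dx_i)=1$ where $x_i$ is the image of $X_i$, and $\Omega^2_{R_{\nu\mathbb{X}}/K}=\bigwedge^2_{R_{\nu\mathbb{X}}}\Omega^1_{R_{\nu\mathbb{X}}/K}$. $\mathrm{HP}_M$ denotes the Hilbert polynomial of a finitely generated graded module $M$. *)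

theory Defs
  imports
    "Jordan_Normal_Form.VS_Connect"
    "HOL-Algebra.Ideal_Product"
    "HOL-Algebra.QuotRing"
    "HOL-Algebra.Generated_Groups"
    "HOL-Analysis.Finite_Cartesian_Product"
    "HOL-Library.Poly_Mapping"
begin

section \<open>Modules given by generators and relations\<close>

text \<open>The ring operations \<open>mult\<close> and \<open>one\<close> of a record of type \<open>module\<close> carry no meaning
  for a module and are left \<open>undefined\<close>.\<close>

definition free_module :: "('r, 'm) ring_scheme \<Rightarrow> 'x set \<Rightarrow> ('r, 'x \<Rightarrow> 'r) module" where
  "free_module R B =
     \<lparr>carrier = {f. f \<in> B \<rightarrow> carrier R \<and> (\<forall>x. x \<notin> B \<longrightarrow> f x = \<zero>\<^bsub>R\<^esub>) \<and> finite {x. f x \<noteq> \<zero>\<^bsub>R\<^esub>}},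
      monoid.mult = undefined, one = undefined,
      zero = (\<lambda>x. \<zero>\<^bsub>R\<^esub>), add = (\<lambda>f g x. f x \<oplus>\<^bsub>R\<^esub> g x),
      smult = (\<lambda>a f x. a \<otimes>\<^bsub>R\<^esub> f x)\<rparr>"

definition free_gen :: "('r, 'm) ring_scheme \<Rightarrow> 'x \<Rightarrow> 'x \<Rightarrow> 'r" where
  "free_gen R x = (\<lambda>y. if y = x then \<one>\<^bsub>R\<^esub> else \<zero>\<^bsub>R\<^esub>)"

definition quotient_module ::
  "('r, 'a, 'm) module_scheme \<Rightarrow> 'a set \<Rightarrow> ('r, 'a set) module" where
  "quotient_module M N =
     \<lparr>carrier = a_rcosets\<^bsub>M\<^esub> N, monoid.mult = undefined, one = undefined,
      zero = N, add = set_add M,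
      smult = (\<lambda>a A. \<Union>x\<in>A. N +>\<^bsub>M\<^esub> (a \<odot>\<^bsub>M\<^esub> x))\<rparr>"


section \<open>Kaehler differentials and the exterior square\<close>

text \<open>Throughout, \<open>\<phi>\<close> is the structure homomorphism \<open>K \<rightarrow> R\<close> of a \<open>K\<close>-algebra \<open>R\<close>.
  The module of Kaehler differentials is generated by symbols \<open>dr\<close> for all \<open>r\<close> in \<open>R\<close>, subject to
  additivity, the Leibniz rule and \<open>dc = 0\<close> for all scalars \<open>c\<close>.\<close>

definition kaehler_rels ::
  "('k, 'l) ring_scheme \<Rightarrow> ('r, 'm) ring_scheme \<Rightarrow> ('k \<Rightarrow> 'r) \<Rightarrow> ('r \<Rightarrow> 'r) set" where
  "kaehler_rels K R \<phi> =
     (let F = free_module R (carrier R); \<delta> = free_gen R in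
        {\<delta> (a \<oplus>\<^bsub>R\<^esub> b) \<ominus>\<^bsub>F\<^esub> (\<delta> a \<oplus>\<^bsub>F\<^esub> \<delta> b) | a b. a \<in> carrier R \<and> b \<in> carrier R}
      \<union> {\<delta> (a \<otimes>\<^bsub>R\<^esub> b) \<ominus>\<^bsub>F\<^esub> (a \<odot>\<^bsub>F\<^esub> \<delta> b \<oplus>\<^bsub>F\<^esub> b \<odot>\<^bsub>F\<^esub> \<delta> a) | a b. a \<in> carrier R \<and> b \<in> carrier R}
      \<union> {\<delta> (\<phi> c) | c. c \<in> carrier K})"

definition kaehler_null ::
  "('k, 'l) ring_scheme \<Rightarrow> ('r, 'm) ring_scheme \<Rightarrow> ('k \<Rightarrow> 'r) \<Rightarrow> ('r \<Rightarrow> 'r) set" where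
  "kaehler_null K R \<phi> =
     LinearCombinations.module.span R (free_module R (carrier R)) (kaehler_rels K R \<phi>)"

definition kaehler ::
  "('k, 'l) ring_scheme \<Rightarrow> ('r, 'm) ring_scheme \<Rightarrow> ('k \<Rightarrow> 'r) \<Rightarrow> ('r, ('r \<Rightarrow> 'r) set) module" where
  "kaehler K R \<phi> = quotient_module (free_module R (carrier R)) (kaehler_null K R \<phi>)"

definition kaehler_d ::
  "('k, 'l) ring_scheme \<Rightarrow> ('r, 'm) ring_scheme \<Rightarrow> ('k \<Rightarrow> 'r) \<Rightarrow> 'r \<Rightarrow> ('r \<Rightarrow> 'r) set" where
  "kaehler_d K R \<phi> r = kaehler_null K R \<phi> +>\<^bsub>free_module R (carrier R)\<^esub> free_gen R r"

text \<open>The exterior square of \<open>M\<close> is generated by symbols \<open>(m, n)\<close>, standing for the exterior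
  product of \<open>m\<close> and \<open>n\<close>, subject to bilinearity and the alternating rule.\<close>

definition ext_square_rels ::
  "('r, 'm) ring_scheme \<Rightarrow> ('r, 'a, 'n) module_scheme \<Rightarrow> ('a \<times> 'a \<Rightarrow> 'r) set" where
  "ext_square_rels R M =
     (let F = free_module R (carrier M \<times> carrier M); g = free_gen R in
        {g (x \<oplus>\<^bsub>M\<^esub> y, z) \<ominus>\<^bsub>F\<^esub> (g (x, z) \<oplus>\<^bsub>F\<^esub> g (y, z))
          | x y z. x \<in> carrier M \<and> y \<in> carrier M \<and> z \<in> carrier M}
      \<union> {g (x, y \<oplus>\<^bsub>M\<^esub> z) \<ominus>\<^bsub>F\<^esub> (g (x, y) \<oplus>\<^bsub>F\<^esub> g (x, z))
          | x y z. x \<in> carrier M \<and> y \<in> carrier M \<and> z \<in> carrier M}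
      \<union> {g (a \<odot>\<^bsub>M\<^esub> x, y) \<ominus>\<^bsub>F\<^esub> a \<odot>\<^bsub>F\<^esub> g (x, y)
          | a x y. a \<in> carrier R \<and> x \<in> carrier M \<and> y \<in> carrier M}
      \<union> {g (x, a \<odot>\<^bsub>M\<^esub> y) \<ominus>\<^bsub>F\<^esub> a \<odot>\<^bsub>F\<^esub> g (x, y)
          | a x y. a \<in> carrier R \<and> x \<in> carrier M \<and> y \<in> carrier M}
      \<union> {g (x, x) | x. x \<in> carrier M})"

definition ext_square_null ::
  "('r, 'm) ring_scheme \<Rightarrow> ('r, 'a, 'n) module_scheme \<Rightarrow> ('a \<times> 'a \<Rightarrow> 'r) set" where
  "ext_square_null R M =
     LinearCombinations.module.span R (free_module R (carrier M \<times> carrier M)) (ext_square_rels R M)"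

definition ext_square ::
  "('r, 'm) ring_scheme \<Rightarrow> ('r, 'a, 'n) module_scheme \<Rightarrow> ('r, ('a \<times> 'a \<Rightarrow> 'r) set) module" where
  "ext_square R M =
     quotient_module (free_module R (carrier M \<times> carrier M)) (ext_square_null R M)"

definition wedge ::
  "('r, 'm) ring_scheme \<Rightarrow> ('r, 'a, 'n) module_scheme \<Rightarrow> 'a \<Rightarrow> 'a \<Rightarrow> ('a \<times> 'a \<Rightarrow> 'r) set" where
  "wedge R M x y = ext_square_null R M +>\<^bsub>free_module R (carrier M \<times> carrier M)\<^esub> free_gen R (x, y)"


section \<open>Gradings and Hilbert polynomials\<close>

text \<open>A grading is given by its homogeneous components. The one on the Kaehler differentials
  makes the universal derivation homogeneous of degree 0: if \<open>R\<close> is generated as a \<open>K\<close>-algebra by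
  elements \<open>x\<^sub>i\<close> of degree 1, then \<open>dx\<^sub>i\<close> has degree 1, and the component of degree \<open>n\<close> is
  the sum of the \<open>R\<^sub>n\<^sub>-\<^sub>1 dx\<^sub>i\<close>.\<close>

definition kaehler_grading ::
  "('k, 'l) ring_scheme \<Rightarrow> ('r, 'm) ring_scheme \<Rightarrow> ('k \<Rightarrow> 'r) \<Rightarrow> (nat \<Rightarrow> 'r set)
     \<Rightarrow> nat \<Rightarrow> ('r \<Rightarrow> 'r) set set" where
  "kaehler_grading K R \<phi> G n =
     generate (add_monoid (kaehler K R \<phi>))
       {a \<odot>\<^bsub>kaehler K R \<phi>\<^esub> kaehler_d K R \<phi> b | a b i j. a \<in> G i \<and> b \<in> G j \<and> i + j = n}"

definition ext_square_grading ::
  "('r, 'm) ring_scheme \<Rightarrow> ('r, 'a, 'n) module_scheme \<Rightarrow> (nat \<Rightarrow> 'a set)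
     \<Rightarrow> nat \<Rightarrow> ('a \<times> 'a \<Rightarrow> 'r) set set" where
  "ext_square_grading R M G n =
     generate (add_monoid (ext_square R M))
       {wedge R M x y | x y i j. x \<in> G i \<and> y \<in> G j \<and> i + j = n}"

definition component_space ::
  "('k \<Rightarrow> 'r) \<Rightarrow> ('r, 'a, 'm) module_scheme \<Rightarrow> 'a set \<Rightarrow> ('k, 'a) module" where
  "component_space \<phi> M V =
     \<lparr>carrier = V, monoid.mult = undefined, one = undefined, zero = \<zero>\<^bsub>M\<^esub>, add = add M,
      smult = (\<lambda>c. smult M (\<phi> c))\<rparr>"

text \<open>The Hilbert polynomial of a graded module is the unique \<open>p\<close> with the following property.
  Finite dimensionality is required because \<open>vectorspace.dim\<close> is unspecified otherwise.\<close>

definition is_hilbert_polynomial ::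
  "('k, 'l) ring_scheme \<Rightarrow> ('k \<Rightarrow> 'r) \<Rightarrow> ('r, 'a, 'm) module_scheme \<Rightarrow> (nat \<Rightarrow> 'a set)
     \<Rightarrow> rat poly \<Rightarrow> bool" where
  "is_hilbert_polynomial K \<phi> M G p \<longleftrightarrow>
     (\<forall>\<^sub>F n in sequentially.
        vectorspace.fin_dim K (component_space \<phi> M (G n)) \<and>
        of_nat (vectorspace.dim K (component_space \<phi> M (G n))) = poly p (of_nat n))"


section \<open>Fat point schemes in the projective plane\<close>

text \<open>The field \<open>K\<close> is a type. A polynomial in \<open>X\<^sub>0, X\<^sub>1, X\<^sub>2\<close> maps exponent vectors, indexed by
  the three elements 0, 1, 2 of type \<open>3\<close>, to coefficients.\<close>

type_synonym 'k poly3 = "(3 \<Rightarrow>\<^sub>0 nat) \<Rightarrow>\<^sub>0 'k"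

abbreviation poly3_ring :: "'k::field poly3 ring" where
  "poly3_ring \<equiv> class_ring"

definition eval3 :: "'k::field ^ 3 \<Rightarrow> 'k poly3 \<Rightarrow> 'k" where
  "eval3 v f =
     (\<Sum>m\<in>Poly_Mapping.keys f.
        Poly_Mapping.lookup f m * (\<Prod>i\<in>UNIV. (v $ i) ^ Poly_Mapping.lookup m i))"

definition homogeneous :: "nat \<Rightarrow> 'k::field poly3 \<Rightarrow> bool" where
  "homogeneous n f \<longleftrightarrow>
     (\<forall>m\<in>Poly_Mapping.keys f. (\<Sum>i\<in>UNIV. Poly_Mapping.lookup m i) = n)"

text \<open>A projective point is the set of all its homogeneous coordinate vectors.\<close>

definition proj_plane :: "('k::field ^ 3) set set" where
  "proj_plane = {{c *s v | c. c \<noteq> 0} | v. v \<noteq> 0}"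

definition vanishing_ideal :: "('k::field ^ 3) set \<Rightarrow> 'k poly3 set" where
  "vanishing_ideal P =
     Idl\<^bsub>poly3_ring\<^esub> {f. (\<exists>n. homogeneous n f) \<and> (\<forall>v\<in>P. eval3 v f = 0)}"

text \<open>Powers of ideals are taken in the monoid of ideals under \<open>ideal_prod\<close>.\<close>

definition fat_ideal :: "('k::field ^ 3) set set \<Rightarrow> nat \<Rightarrow> 'k poly3 set" where
  "fat_ideal \<X> \<nu> = (\<Inter>P\<in>\<X>. vanishing_ideal P [^]\<^bsub>ideals_set poly3_ring\<^esub> \<nu>)"

definition fat_ring :: "('k::field ^ 3) set set \<Rightarrow> nat \<Rightarrow> 'k poly3 set ring" where
  "fat_ring \<X> \<nu> = poly3_ring Quot fat_ideal \<X> \<nu>"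

definition fat_scalar :: "('k::field ^ 3) set set \<Rightarrow> nat \<Rightarrow> 'k \<Rightarrow> 'k poly3 set" where
  "fat_scalar \<X> \<nu> c = fat_ideal \<X> \<nu> +>\<^bsub>poly3_ring\<^esub> Poly_Mapping.single 0 c"

definition fat_grading :: "('k::field ^ 3) set set \<Rightarrow> nat \<Rightarrow> nat \<Rightarrow> 'k poly3 set set" where
  "fat_grading \<X> \<nu> n = {fat_ideal \<X> \<nu> +>\<^bsub>poly3_ring\<^esub> f | f. homogeneous n f}"

definition fat_Omega1 where
  "fat_Omega1 \<X> \<nu> = kaehler class_ring (fat_ring \<X> \<nu>) (fat_scalar \<X> \<nu>)"

definition fat_Omega1_grading where
  "fat_Omega1_grading \<X> \<nu> =
     kaehler_grading class_ring (fat_ring \<X> \<nu>) (fat_scalar \<X> \<nu>) (fat_grading \<X> \<nu>)"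

definition fat_Omega2 where
  "fat_Omega2 \<X> \<nu> = ext_square (fat_ring \<X> \<nu>) (fat_Omega1 \<X> \<nu>)"

definition fat_Omega2_grading where
  "fat_Omega2_grading \<X> \<nu> =
     ext_square_grading (fat_ring \<X> \<nu>) (fat_Omega1 \<X> \<nu>) (fat_Omega1_grading \<X> \<nu>)"

end

theory Submission
  imports Defs "HOL-Analysis.Cartesian_Space"
begin

text \<open>Write \<open>J\<^sub>k\<close> for the ideal of polynomials vanishing to order \<open>k\<close> at all points, so that
  \<open>I = J\<^sub>\<nu>\<close> is the ideal of the fat point scheme. The module \<open>\<Omega>\<^sup>2\<close> of \<open>S / I\<close> is the module of 2-forms over
  \<open>S\<close> modulo \<open>I \<Omega>\<^sup>2\<^sub>S + dI \<and> \<Omega>\<^sup>1\<^sub>S\<close>. All \<open>\<eta>\<close> in this submodule satisfy that \<open>\<eta>\<close> and \<open>d\<eta>\<close> have coefficients in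
  \<open>J\<^bsub>\<nu>-1\<^esub>\<close>. In high degrees the converse holds: the lowest order terms of \<open>\<eta>\<close> at each point can be
  integrated by contraction with the local Euler field (here characteristic 0 enters), and the local
  primitives are glued by interpolation. So \<open>\<eta>\<close> is determined modulo the submodule by the jets of order
  less than \<open>\<nu> - 1\<close> of its three coefficients and the part of order \<open>\<nu> - 2\<close> of \<open>d\<eta>\<close> at the points, and by
  interpolation these take arbitrary values. There are \<open>3 \<nu>(\<nu> - 1) / 2 + (\<nu> - 1)\<close> of them per point.\<close>

subsection \<open>Polynomials in three variables\<close>

text \<open>The presentation has a symbol for every ring element, so nonzero classes are detected by
  a map from Omega^2 to S^3 / Z. Here Z consists of the eta such that eta and d eta have
  coefficients in J_k, with k = nu - 1. It contains I S^3 because derivatives of I = J_{k+1} lie in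
  J_k. The map needs in turn a similar submodule of 1-forms, whose products with arbitrary 1-forms
  fall into Z.

  For the converse, primitives are only wanted modulo I: one contraction raises the order of the
  error from k to k + 1, where I Omega^2_S absorbs it, so nothing is iterated. The primitives also
  vanish to order k + 1, hence lie in I, and their differentials are relations. On the lowest order
  terms of closed forms, contraction followed by d is multiplication by k + 1 or k + 2, and these
  integers have to be inverted.

  If eta vanishes to order k, then d eta vanishes to order k - 1 of its own accord. The condition on
  d eta therefore adds only its k coefficients of order k - 1 at each point; this is the summand nu
  - 1 of the count.\<close>

lemma all_3_0: "(\<forall>i::3. P i) \<longleftrightarrow> P 0 \<and> P 1 \<and> P 2"
proof -
  have "(3::3) = 0" by simp
  then show ?thesis unfolding forall_3 by (simp only: conj_ac)
qed

lemma three_distinct [simp]: "(0::3) \<noteq> 1" "(1::3) \<noteq> 0" "(0::3) \<noteq> 2" "(2::3) \<noteq> 0" "(1::3) \<noteq> 2" "(2::3) \<noteq> 1"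
  by simp_all

lemma UNIV_3_0: "(UNIV :: 3 set) = {0, 1, 2}"
proof -
  have "\<forall>x::3. x \<in> {0, 1, 2}" by (simp add: all_3_0)
  then show ?thesis by blast
qed

lemma sum_3_0: "sum f (UNIV :: 3 set) = f 0 + f 1 + f 2" for f :: "3 \<Rightarrow> 'a::comm_monoid_add"
  unfolding UNIV_3_0 by (simp add: add.assoc)

lemma prod_3_0: "prod f (UNIV :: 3 set) = f 0 * f 1 * f 2" for f :: "3 \<Rightarrow> 'a::comm_monoid_mult"
  unfolding UNIV_3_0 by (simp add: mult.assoc)

type_synonym mon3 = "3 \<Rightarrow>\<^sub>0 nat"

abbreviation coeff3 :: "'k::field poly3 \<Rightarrow> mon3 \<Rightarrow> 'k" where "coeff3 \<equiv> Poly_Mapping.lookup"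
abbreviation expo :: "mon3 \<Rightarrow> 3 \<Rightarrow> nat" where "expo \<equiv> Poly_Mapping.lookup"
abbreviation Const3 :: "'k::field \<Rightarrow> 'k poly3" where "Const3 \<equiv> Poly_Mapping.single 0"
abbreviation term3 :: "mon3 \<Rightarrow> 'k::field \<Rightarrow> 'k poly3" where "term3 \<equiv> Poly_Mapping.single"
abbreviation unit_exp :: "3 \<Rightarrow> mon3" where "unit_exp i \<equiv> Poly_Mapping.single i (Suc 0)"

definition Var3 :: "3 \<Rightarrow> 'k::field poly3" where "Var3 i = term3 (unit_exp i) 1"

lemma poly3_sum_terms: "f = (\<Sum>m\<in>Poly_Mapping.keys f. term3 m (coeff3 f m))"
  by (rule poly_mapping_eqI)
     (auto simp: lookup_sum lookup_single when_def in_keys_iff)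

text \<open>The case \<open>monom\<close> only concerns terms that occur in \<open>f\<close>, so
  that hypotheses on the support of \<open>f\<close>, such as homogeneity or order of vanishing,
  carry over to them.\<close>

lemma poly3_term_induct [case_names zero monom add]:
  assumes "P 0" "\<And>m. m \<in> Poly_Mapping.keys f \<Longrightarrow> P (term3 m (coeff3 f m))"
    "\<And>g h. P g \<Longrightarrow> P h \<Longrightarrow> P (g + h)"
  shows "P f"
proof -
  have "P (\<Sum>m\<in>A. term3 m (coeff3 f m))" if "A \<subseteq> Poly_Mapping.keys f" "finite A" for A
    using that(2,1) by (induction A) (auto intro: assms)
  from this[of "Poly_Mapping.keys f"] show ?thesis by (simp add: poly3_sum_terms[symmetric])
qed

lemma term3_mult: "term3 m c * term3 n d = term3 (m + n) (c * d)"
  by (simp add: mult_single)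

lemma Const3_mult: "Const3 (c * d) = Const3 c * Const3 d"
  by (simp add: term3_mult)

lemma Var3_power: "Var3 i ^ n = term3 (Poly_Mapping.single i n) 1"
  by (induction n) (simp_all add: Var3_def term3_mult single_add[symmetric])

lemma mon3_eq: "m = Poly_Mapping.single 0 (expo m 0) + Poly_Mapping.single 1 (expo m 1) + Poly_Mapping.single 2 (expo m 2)"
  (is "_ = ?n")
proof (rule poly_mapping_eqI)
  have "\<forall>k. expo m k = expo ?n k" by (simp add: all_3_0 lookup_add lookup_single)
  then show "expo m k = expo ?n k" for k by blast
qed

lemma term3_eq_vars: "term3 m c = Const3 c * (Var3 0 ^ expo m 0 * Var3 1 ^ expo m 1 * Var3 2 ^ expo m 2)"
  unfolding Var3_power term3_mult
  by (rule arg_cong2[where f = term3]) (simp_all add: mon3_eq[symmetric])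

lemma poly3_ring_induct [case_names Const Var add mult]:
  assumes C: "\<And>c. P (Const3 c)" and V: "\<And>i. P (Var3 i)"
    and A: "\<And>g h. P g \<Longrightarrow> P h \<Longrightarrow> P (g + h)" and M: "\<And>g h. P g \<Longrightarrow> P h \<Longrightarrow> P (g * h)"
  shows "P f"
proof (induction f rule: poly3_term_induct)
  case zero show ?case using C[of 0] by simp
next
  case (monom m)
  have V': "P (Var3 i ^ n)" for i n
  proof (induction n)
    case 0 then show ?case using C[of 1] by simp
  next
    case (Suc n) then show ?case by (simp add: M V)
  qed
  show ?case unfolding term3_eq_vars[of m] by (rule M M C V')+
next
  case (add g h) then show ?case by (rule A)
qed

text \<open>The K-linear extension of a map given on monomials; substitutions and partial
  derivatives are its two instances.\<close>

definition lin_ext :: "(mon3 \<Rightarrow> 'k::field poly3) \<Rightarrow> 'k poly3 \<Rightarrow> 'k poly3" where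
  "lin_ext g f = (\<Sum>m\<in>Poly_Mapping.keys f. Const3 (coeff3 f m) * g m)"

lemma lin_ext_superset:
  assumes "finite A" "Poly_Mapping.keys f \<subseteq> A"
  shows "lin_ext g f = (\<Sum>m\<in>A. Const3 (coeff3 f m) * g m)"
  unfolding lin_ext_def using assms by (intro sum.mono_neutral_left) (auto simp: in_keys_iff)

lemma lin_ext_add: "lin_ext g (f + h) = lin_ext g f + lin_ext g h"
proof -
  let ?A = "Poly_Mapping.keys f \<union> Poly_Mapping.keys h"
  have "lin_ext g (f + h) = (\<Sum>m\<in>?A. Const3 (coeff3 (f + h) m) * g m)"
    by (rule lin_ext_superset) (auto simp: keys_add)
  also have "\<dots> = (\<Sum>m\<in>?A. Const3 (coeff3 f m) * g m) + (\<Sum>m\<in>?A. Const3 (coeff3 h m) * g m)"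
    by (simp add: lookup_add single_add distrib_right sum.distrib)
  also have "\<dots> = lin_ext g f + lin_ext g h"
    by (intro arg_cong2[where f = "(+)"] lin_ext_superset[symmetric]) auto
  finally show ?thesis .
qed

lemma lin_ext_zero [simp]: "lin_ext g 0 = 0"
  by (simp add: lin_ext_def)

lemma lin_ext_term: "lin_ext g (term3 m c) = Const3 c * g m"
  by (simp add: lin_ext_def)

subsection \<open>Substitution\<close>

definition subst3 :: "(3 \<Rightarrow> 'k::field poly3) \<Rightarrow> 'k poly3 \<Rightarrow> 'k poly3" where
  "subst3 \<sigma> = lin_ext (\<lambda>m. \<Prod>i\<in>UNIV. \<sigma> i ^ expo m i)"

lemma subst3_add: "subst3 \<sigma> (f + g) = subst3 \<sigma> f + subst3 \<sigma> g"
  by (simp add: subst3_def lin_ext_add)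

lemma subst3_Const [simp]: "subst3 \<sigma> (Const3 c) = Const3 c"
  by (simp add: subst3_def lin_ext_term)

lemma subst3_zero [simp]: "subst3 \<sigma> 0 = 0"
  by (simp add: subst3_def)

lemma subst3_one [simp]: "subst3 \<sigma> 1 = 1"
  using subst3_Const[of \<sigma> 1] by simp

lemma subst3_uminus: "subst3 \<sigma> (- f) = - subst3 \<sigma> f"
  by (metis add.right_inverse minus_unique subst3_add subst3_zero)

lemma subst3_diff: "subst3 \<sigma> (f - g) = subst3 \<sigma> f - subst3 \<sigma> g"
  by (metis subst3_add subst3_uminus diff_conv_add_uminus)

lemma subst3_Var [simp]: "subst3 \<sigma> (Var3 i) = \<sigma> i"
proof -
  have "\<forall>i. subst3 \<sigma> (Var3 i) = \<sigma> i"
    by (simp add: all_3_0 subst3_def Var3_def lin_ext_term prod_3_0 lookup_single)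
  then show ?thesis by blast
qed

lemma subst3_mult: "subst3 \<sigma> (f * g) = subst3 \<sigma> f * subst3 \<sigma> g"
proof (induction f rule: poly3_term_induct)
  case (monom m)
  show ?case
  proof (induction g rule: poly3_term_induct)
    case (monom n)
    then show ?case
      unfolding subst3_def term3_mult lin_ext_term unfolding Const3_mult
      by (simp add: lookup_add power_add prod.distrib mult_ac)
  qed (simp_all add: distrib_left subst3_add)
qed (simp_all add: distrib_right subst3_add)

lemma subst3_power: "subst3 \<sigma> (f ^ n) = subst3 \<sigma> f ^ n"
  by (induction n) (simp_all add: subst3_mult)

lemma subst3_subst3: "subst3 \<sigma> (subst3 \<tau> f) = subst3 (\<lambda>i. subst3 \<sigma> (\<tau> i)) f"
  by (induction f rule: poly3_ring_induct) (simp_all add: subst3_add subst3_mult)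

lemma subst3_Var_id [simp]: "subst3 Var3 f = f"
  by (induction f rule: poly3_ring_induct) (simp_all add: subst3_add subst3_mult)

subsection \<open>Partial derivatives\<close>

text \<open>Exponents are subtracted with truncation. Where X_i does not occur, the factor
  \<open>of_nat (expo m i)\<close> is zero, and the meaningless exponent does no harm.\<close>

definition pderiv3 :: "3 \<Rightarrow> 'k::field poly3 \<Rightarrow> 'k poly3" where
  "pderiv3 i = lin_ext (\<lambda>m. term3 (m - unit_exp i) (of_nat (expo m i)))"

lemma pderiv3_add: "pderiv3 i (f + g) = pderiv3 i f + pderiv3 i g"
  by (simp add: pderiv3_def lin_ext_add)

lemma pderiv3_term: "pderiv3 i (term3 m c) = term3 (m - unit_exp i) (c * of_nat (expo m i))"
  by (simp add: pderiv3_def lin_ext_term term3_mult)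

lemma pderiv3_zero [simp]: "pderiv3 i 0 = 0"
  by (simp add: pderiv3_def)

lemma pderiv3_uminus: "pderiv3 i (- f) = - pderiv3 i f"
  by (metis add.right_inverse minus_unique pderiv3_add pderiv3_zero)

lemma pderiv3_diff: "pderiv3 i (f - g) = pderiv3 i f - pderiv3 i g"
  by (metis pderiv3_add pderiv3_uminus diff_conv_add_uminus)

lemma pderiv3_Const [simp]: "pderiv3 i (Const3 c) = 0"
  by (simp add: pderiv3_term)

lemma pderiv3_Var: "pderiv3 i (Var3 j) = (if i = j then 1 else 0)"
  by (simp add: pderiv3_term Var3_def lookup_single when_def)

lemma pderiv3_mult:
  fixes f g :: "'k::field poly3"
  shows "pderiv3 i (f * g) = f * pderiv3 i g + g * pderiv3 i f"
proof (induction f rule: poly3_term_induct)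
  case (monom m)
  show ?case
  proof (induction g rule: poly3_term_induct)
    case (monom n)
    let ?e = "unit_exp i"
    let ?t = "\<lambda>k. term3 (m + n - ?e) (coeff3 f m * coeff3 g n * of_nat k)"
    have shift: "m + (n - ?e) = m + n - ?e" if "0 < expo n i" for m n :: mon3
      using that by (intro poly_mapping_eqI) (auto simp: lookup_add lookup_minus lookup_single when_def)
    have leibniz: "term3 m c * pderiv3 i (term3 n d) = term3 (m + n - ?e) (c * d * of_nat (expo n i))"
      for m n :: mon3 and c d :: 'k
    proof (cases "expo n i = 0")
      case False
      then show ?thesis
        unfolding pderiv3_term term3_mult using shift[of n m] by (simp add: mult.assoc)
    qed (simp add: pderiv3_term)
    have 1: "term3 m (coeff3 f m) * pderiv3 i (term3 n (coeff3 g n)) = ?t (expo n i)"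
      by (rule leibniz)
    have 2: "term3 n (coeff3 g n) * pderiv3 i (term3 m (coeff3 f m)) = ?t (expo m i)"
      using leibniz[of n "coeff3 g n" m "coeff3 f m"] by (simp add: add.commute mult_ac)
    have "pderiv3 i (term3 m (coeff3 f m) * term3 n (coeff3 g n)) = ?t (expo n i + expo m i)"
      unfolding term3_mult pderiv3_term lookup_add by (simp only: add.commute)
    also have "\<dots> = ?t (expo n i) + ?t (expo m i)"
      by (simp only: of_nat_add distrib_left single_add)
    finally show ?case unfolding 1 2 .
  qed (simp_all add: algebra_simps pderiv3_add)
qed (simp_all add: algebra_simps pderiv3_add)

lemma pderiv3_one [simp]: "pderiv3 i 1 = 0"
  using pderiv3_Const[of i 1] by simp

lemma pderiv3_commute: "pderiv3 i (pderiv3 j f) = pderiv3 j (pderiv3 i f)"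
  by (induction f rule: poly3_ring_induct) (simp_all add: pderiv3_add pderiv3_mult pderiv3_Var algebra_simps)

lemma pderiv3_subst3:
  "pderiv3 j (subst3 \<sigma> f) = (\<Sum>i\<in>UNIV. subst3 \<sigma> (pderiv3 i f) * pderiv3 j (\<sigma> i))"
proof (induction f rule: poly3_ring_induct)
  case (Var i)
  have "(\<Sum>k\<in>UNIV. subst3 \<sigma> (pderiv3 k (Var3 i)) * pderiv3 j (\<sigma> k)) = (\<Sum>k\<in>UNIV. if k = i then pderiv3 j (\<sigma> k) else 0)"
    by (intro sum.cong) (auto simp: pderiv3_Var)
  then show ?case by simp
qed (simp_all add: sum_3_0 pderiv3_add subst3_add pderiv3_mult subst3_mult algebra_simps)

text \<open>The operators X_i d/dX_i are diagonal on monomials, with the exponents as eigenvalues.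
  This is the source of the local Euler identity.\<close>

lemma coeff3_Var_pderiv3: "coeff3 (Var3 i * pderiv3 i f) m = of_nat (expo m i) * coeff3 f m"
proof (induction f rule: poly3_term_induct)
  case (monom n)
  have "unit_exp i + (n - unit_exp i) = n" if "expo n i \<noteq> 0"
    using that by (intro poly_mapping_eqI) (auto simp: lookup_add lookup_minus lookup_single when_def)
  then show ?case
    by (cases "expo n i = 0") (auto simp: pderiv3_term Var3_def term3_mult lookup_single when_def)
qed (simp_all add: lookup_add algebra_simps pderiv3_add)

subsection \<open>Forms and their degrees\<close>

definition mdeg :: "mon3 \<Rightarrow> nat" where "mdeg m = (\<Sum>i\<in>UNIV. expo m i)"

lemma mdeg_add: "mdeg (m + n) = mdeg m + mdeg n"
  by (simp add: mdeg_def lookup_add sum.distrib)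

lemma mdeg_unit [simp]: "mdeg (unit_exp i) = Suc 0"
proof -
  have "mdeg (unit_exp i) = (\<Sum>j\<in>UNIV. if j = i then Suc 0 else 0)"
    unfolding mdeg_def by (intro sum.cong) (auto simp: lookup_single when_def)
  then show ?thesis by simp
qed

text \<open>A combination of generators of degree \<open>d\<close> is homogeneous of degree \<open>n\<close> if its coefficients
  satisfy \<open>form_shift d n\<close>; unlike \<open>homogeneous (n - d)\<close>, this forces them to vanish if \<open>n < d\<close>.\<close>

definition form_shift :: "nat \<Rightarrow> nat \<Rightarrow> 'k::field poly3 \<Rightarrow> bool" where
  "form_shift d n f \<longleftrightarrow> (\<forall>m\<in>Poly_Mapping.keys f. mdeg m + d = n)"

lemma homogeneous_form_shift: "homogeneous n f \<longleftrightarrow> form_shift 0 n f"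
  by (simp add: homogeneous_def form_shift_def mdeg_def)

lemma form_shift_homogeneous: "d \<le> n \<Longrightarrow> form_shift d n f \<longleftrightarrow> homogeneous (n - d) f"
  by (auto simp: form_shift_def homogeneous_form_shift)

lemma form_shift_zero [simp]: "form_shift d n 0"
  by (simp add: form_shift_def)

lemma form_shift_add: "form_shift d n f \<Longrightarrow> form_shift d n g \<Longrightarrow> form_shift d n (f + g)"
  using keys_add[of f g] by (auto simp: form_shift_def)

lemma form_shift_uminus: "form_shift d n f \<Longrightarrow> form_shift d n (- f)"
  by (simp add: form_shift_def)

lemma form_shift_diff: "form_shift d n f \<Longrightarrow> form_shift d n g \<Longrightarrow> form_shift d n (f - g)"
  using form_shift_add[of d n f "- g"] by (simp add: form_shift_uminus)

lemma form_shift_mult: "form_shift d n f \<Longrightarrow> form_shift e m g \<Longrightarrow> form_shift (d + e) (n + m) (f * g)"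
  using keys_mult[of f g] by (fastforce simp: form_shift_def mdeg_add)

lemma form_shift_sum: "(\<And>x. x \<in> A \<Longrightarrow> form_shift d n (f x)) \<Longrightarrow> form_shift d n (sum f A)"
  by (induction A rule: infinite_finite_induct) (auto intro: form_shift_add)

lemma form_shift_pderiv3: assumes "form_shift d n f" shows "form_shift (Suc d) n (pderiv3 i f)"
  unfolding pderiv3_def lin_ext_def
proof (rule form_shift_sum)
  fix m assume m: "m \<in> Poly_Mapping.keys f"
  show "form_shift (Suc d) n (Const3 (coeff3 f m) * term3 (m - unit_exp i) (of_nat (expo m i)))"
  proof (cases "expo m i = 0")
    case False
    then have "m = (m - unit_exp i) + unit_exp i"
      by (intro poly_mapping_eqI) (auto simp: lookup_add lookup_minus lookup_single when_def)
    then have "mdeg m = mdeg ((m - unit_exp i) + unit_exp i)" by (rule arg_cong)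
    then have "mdeg m = Suc (mdeg (m - unit_exp i))" by (simp add: mdeg_add)
    then show ?thesis using assms m by (auto simp: form_shift_def term3_mult)
  qed auto
qed

lemmas homogeneous_zero = form_shift_zero[of 0, folded homogeneous_form_shift]
lemmas homogeneous_add = form_shift_add[of 0, folded homogeneous_form_shift]
lemmas homogeneous_uminus = form_shift_uminus[of 0, folded homogeneous_form_shift]
lemmas homogeneous_diff = form_shift_diff[of 0, folded homogeneous_form_shift]
lemmas homogeneous_sum = form_shift_sum[of _ 0, folded homogeneous_form_shift]

lemma homogeneous_mult: "homogeneous n f \<Longrightarrow> homogeneous m g \<Longrightarrow> homogeneous (n + m) (f * g)"
  using form_shift_mult[of 0 n f 0 m g] by (simp add: homogeneous_form_shift)

lemma homogeneous_pderiv3: "homogeneous (Suc n) f \<Longrightarrow> homogeneous n (pderiv3 i f)"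
  using form_shift_pderiv3[of 0 "Suc n" f i] by (simp add: homogeneous_form_shift form_shift_def)

lemma homogeneous_Const [simp]: "homogeneous 0 (Const3 c)"
  by (simp add: homogeneous_form_shift form_shift_def mdeg_def)

lemma homogeneous_one [simp]: "homogeneous 0 1"
  using homogeneous_Const[of 1] by simp

lemma homogeneous_Var [simp]: "homogeneous 1 (Var3 i)" "homogeneous (Suc 0) (Var3 i)"
  by (simp_all add: homogeneous_form_shift form_shift_def Var3_def)

lemma homogeneous_term: "homogeneous (mdeg m) (term3 m c)"
  by (simp add: homogeneous_form_shift form_shift_def)

lemma homogeneous_power: "homogeneous n f \<Longrightarrow> homogeneous (k * n) (f ^ k)"
  by (induction k) (auto intro: homogeneous_mult)

lemma homogeneous_Const_mult: "homogeneous n f \<Longrightarrow> homogeneous n (Const3 c * f)"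
  using homogeneous_mult[OF homogeneous_Const, of n f c] by simp

lemma homogeneous_subst3:
  assumes f: "homogeneous n f" and s: "\<And>i. homogeneous 1 (\<sigma> i)"
  shows "homogeneous n (subst3 \<sigma> f)"
  unfolding subst3_def lin_ext_def
proof (intro homogeneous_sum homogeneous_Const_mult)
  fix m assume m: "m \<in> Poly_Mapping.keys f"
  have "homogeneous (expo m i) (\<sigma> i ^ expo m i)" for i
    using homogeneous_power[OF s[of i], of "expo m i"] by simp
  then have "homogeneous (expo m 0 + expo m 1 + expo m 2) (\<sigma> 0 ^ expo m 0 * \<sigma> 1 ^ expo m 1 * \<sigma> 2 ^ expo m 2)"
    by (intro homogeneous_mult)
  moreover have "expo m 0 + expo m 1 + expo m 2 = n" using f m by (simp add: homogeneous_def sum_3_0)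
  ultimately show "homogeneous n (\<Prod>i\<in>UNIV. \<sigma> i ^ expo m i)" by (simp add: prod_3_0)
qed

subsection \<open>Order of vanishing at a point\<close>

text \<open>At (1 : 0 : 0) the variable X_0 is a unit, so the degree in X_1 and X_2 alone is the
  order of vanishing of a monomial there.\<close>

definition hdeg :: "mon3 \<Rightarrow> nat" where "hdeg m = expo m 1 + expo m 2"

lemma hdeg_add: "hdeg (m + n) = hdeg m + hdeg n"
  by (simp add: hdeg_def lookup_add)

definition order_ge :: "nat \<Rightarrow> 'k::field poly3 set" where
  "order_ge k = {f. \<forall>m\<in>Poly_Mapping.keys f. k \<le> hdeg m}"

lemma order_ge_iff: "f \<in> order_ge k \<longleftrightarrow> (\<forall>m. hdeg m < k \<longrightarrow> coeff3 f m = 0)"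
  by (auto simp: order_ge_def in_keys_iff not_le[symmetric])

lemma order_ge_zero [simp]: "0 \<in> order_ge k"
  by (simp add: order_ge_def)

lemma order_ge_add: "f \<in> order_ge k \<Longrightarrow> g \<in> order_ge k \<Longrightarrow> f + g \<in> order_ge k"
  by (simp add: order_ge_iff lookup_add)

lemma order_ge_mult: "f \<in> order_ge k \<Longrightarrow> g \<in> order_ge l \<Longrightarrow> f * g \<in> order_ge (k + l)"
  using keys_mult[of f g] by (fastforce simp: order_ge_def hdeg_add)

lemma order_ge_term: "k \<le> hdeg m \<Longrightarrow> term3 m c \<in> order_ge k"
  by (simp add: order_ge_def)

text \<open>The linear substitution that moves the point \<open>v\<close>, normalised by \<open>v\<^sub>0 = 1\<close>, to
  \<open>(1 : 0 : 0)\<close>; the coefficients of \<open>taylor v f\<close> are the Taylor coefficients of \<open>f\<close> at \<open>v\<close>.\<close>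

definition taylor :: "'k::field ^ 3 \<Rightarrow> 'k poly3 \<Rightarrow> 'k poly3" where
  "taylor v = subst3 (\<lambda>i. if i = 0 then Var3 0 else Var3 i + Const3 (v $ i) * Var3 0)"

lemma taylor_add: "taylor v (f + g) = taylor v f + taylor v g"
  by (simp add: taylor_def subst3_add)

lemma taylor_diff: "taylor v (f - g) = taylor v f - taylor v g"
  by (simp add: taylor_def subst3_diff)

lemma taylor_mult: "taylor v (f * g) = taylor v f * taylor v g"
  by (simp add: taylor_def subst3_mult)

lemma taylor_power: "taylor v (f ^ n) = taylor v f ^ n"
  by (simp add: taylor_def subst3_power)

lemma taylor_zero [simp]: "taylor v 0 = 0"
  by (simp add: taylor_def)

lemma taylor_Const [simp]: "taylor v (Const3 c) = Const3 c"
  by (simp add: taylor_def)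

lemma taylor_Var: "taylor v (Var3 i) = (if i = 0 then Var3 0 else Var3 i + Const3 (v $ i) * Var3 0)"
  by (simp add: taylor_def)

text \<open>The substitution is a shear that fixes X_0 and adds multiples of X_0 to the other
  variables; the opposite multiples undo it.\<close>

lemma taylor_inverse: "taylor v (taylor (- v) f) = f"
proof -
  have "(\<lambda>i. taylor v (if i = 0 then Var3 0 else Var3 i + Const3 ((- v) $ i) * Var3 0)) = Var3"
    by (rule ext) (simp add: taylor_diff taylor_mult taylor_Var single_uminus)
  then show ?thesis by (simp add: taylor_def subst3_subst3)
qed

lemma taylor_inverse': "taylor (- v) (taylor v f) = f"
  using taylor_inverse[of "- v" f] by simp

lemma homogeneous_taylor: "homogeneous n f \<Longrightarrow> homogeneous n (taylor v f)"
  unfolding taylor_def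
  by (erule homogeneous_subst3) (auto intro!: homogeneous_add homogeneous_Const_mult simp del: One_nat_def)

definition vanish_order :: "'k::field ^ 3 \<Rightarrow> nat \<Rightarrow> 'k poly3 set" where
  "vanish_order v k = {f. taylor v f \<in> order_ge k}"

lemma vanish_order_zero [simp]: "0 \<in> vanish_order v k"
  by (simp add: vanish_order_def)

lemma vanish_order_0 [simp]: "vanish_order v 0 = UNIV"
  by (simp add: vanish_order_def order_ge_def)

lemma vanish_order_add: "f \<in> vanish_order v k \<Longrightarrow> g \<in> vanish_order v k \<Longrightarrow> f + g \<in> vanish_order v k"
  by (simp add: vanish_order_def taylor_add order_ge_add)

lemma vanish_order_mult:
  "f \<in> vanish_order v k \<Longrightarrow> g \<in> vanish_order v l \<Longrightarrow> f * g \<in> vanish_order v (k + l)"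
  by (simp add: vanish_order_def taylor_mult order_ge_mult)

lemma vanish_order_absorb: "f \<in> vanish_order v k \<Longrightarrow> g * f \<in> vanish_order v k"
  using vanish_order_mult[of g v 0 f k] by simp

lemma vanish_order_uminus: "f \<in> vanish_order v k \<Longrightarrow> - f \<in> vanish_order v k"
  using vanish_order_absorb[of f v k "- 1"] by simp

lemma vanish_order_diff: "f \<in> vanish_order v k \<Longrightarrow> g \<in> vanish_order v k \<Longrightarrow> f - g \<in> vanish_order v k"
  using vanish_order_add[of f v k "- g"] by (simp add: vanish_order_uminus)

lemma vanish_order_mono: "f \<in> vanish_order v k \<Longrightarrow> l \<le> k \<Longrightarrow> f \<in> vanish_order v l"
  by (auto simp: vanish_order_def order_ge_def)

lemma vanish_order_sum: "(\<And>x. x \<in> A \<Longrightarrow> f x \<in> vanish_order v k) \<Longrightarrow> sum f A \<in> vanish_order v k"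
  by (induction A rule: infinite_finite_induct) (auto intro: vanish_order_add)

lemma vanish_order_power: "f \<in> vanish_order v (Suc 0) \<Longrightarrow> f ^ k \<in> vanish_order v k"
proof (induction k)
  case (Suc k) then show ?case using vanish_order_mult[of f v "Suc 0" "f ^ k" k] by simp
qed simp

lemma taylor_vanish_order: "f \<in> order_ge k \<Longrightarrow> taylor (- v) f \<in> vanish_order v k"
  by (simp add: vanish_order_def taylor_inverse)

text \<open>For i = 1, 2 these are the linear forms ell_i of the local Euler field: local
  coordinates at \<open>v\<close>, pulled back from X_i at (1 : 0 : 0).\<close>

definition local_var :: "'k::field ^ 3 \<Rightarrow> 3 \<Rightarrow> 'k poly3" where
  "local_var v i = Var3 i - Const3 (v $ i) * Var3 0"

lemma taylor_local_var: "i \<noteq> 0 \<Longrightarrow> taylor v (local_var v i) = Var3 i"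
  by (simp add: local_var_def taylor_diff taylor_mult taylor_Var)

lemma taylor_uminus_Var: "i \<noteq> 0 \<Longrightarrow> taylor (- v) (Var3 i) = local_var v i"
  by (simp add: taylor_Var local_var_def single_uminus)

lemma Var3_order_ge: "i \<noteq> 0 \<Longrightarrow> Var3 i \<in> order_ge (Suc 0)"
proof -
  have "\<forall>i::3. i \<noteq> 0 \<longrightarrow> Suc 0 \<le> hdeg (unit_exp i)"
    by (simp add: all_3_0 hdeg_def lookup_single)
  then show "i \<noteq> 0 \<Longrightarrow> Var3 i \<in> order_ge (Suc 0)" by (simp add: Var3_def order_ge_term)
qed

lemma local_var_vanish: "i \<noteq> 0 \<Longrightarrow> local_var v i \<in> vanish_order v (Suc 0)"
  using Var3_order_ge[of i] by (simp add: vanish_order_def taylor_local_var)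

lemma homogeneous_local_var: "homogeneous 1 (local_var v i)"
  unfolding local_var_def by (intro homogeneous_diff homogeneous_Const_mult homogeneous_Var)

lemma order_ge_pderiv3:
  assumes "f \<in> order_ge (Suc k)" shows "pderiv3 i f \<in> order_ge k"
proof -
  have "pderiv3 i f \<in> order_ge k" if "\<forall>m\<in>Poly_Mapping.keys f. Suc k \<le> hdeg m"
    unfolding pderiv3_def lin_ext_def
  proof -
    have *: "hdeg m \<le> Suc (hdeg (m - unit_exp i))" for m
    proof -
      have "\<forall>i::3. expo m 1 + expo m 2 \<le> Suc (expo (m - unit_exp i) 1 + expo (m - unit_exp i) 2)"
        by (auto simp: all_3_0 lookup_minus lookup_single)
      then show ?thesis unfolding hdeg_def by blast
    qed
    have "(\<Sum>m\<in>A. Const3 (coeff3 f m) * term3 (m - unit_exp i) (of_nat (expo m i))) \<in> order_ge k"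
      if "finite A" "A \<subseteq> Poly_Mapping.keys f" for A
      using that
    proof (induction A)
      case (insert m A)
      have "k \<le> hdeg (m - unit_exp i)"
        using *[of m] \<open>\<forall>m\<in>_. _\<close> insert.prems by fastforce
      then have "Const3 (coeff3 f m) * term3 (m - unit_exp i) (of_nat (expo m i)) \<in> order_ge k"
        by (simp add: term3_mult order_ge_term)
      then show ?case using insert by (auto intro: order_ge_add)
    qed simp
    then show "(\<Sum>m\<in>Poly_Mapping.keys f. Const3 (coeff3 f m) * term3 (m - unit_exp i) (of_nat (expo m i))) \<in> order_ge k"
      by simp
  qed
  then show ?thesis using assms by (simp add: order_ge_def)
qed

text \<open>By the chain rule the shear commutes with d/dX_1 and d/dX_2, whereas d/dX_0 becomes the
  derivative along (1, v_1, v_2). The contractions with the local Euler field therefore use only the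
  first two.\<close>

lemma pderiv3_taylor:
  "pderiv3 0 (taylor v f) = taylor v (pderiv3 0 f + Const3 (v $ 1) * pderiv3 1 f + Const3 (v $ 2) * pderiv3 2 f)"
  "pderiv3 1 (taylor v f) = taylor v (pderiv3 1 f)"
  "pderiv3 2 (taylor v f) = taylor v (pderiv3 2 f)"
  by (simp_all add: taylor_def pderiv3_subst3 sum_3_0 pderiv3_Var pderiv3_add pderiv3_mult
      subst3_add subst3_mult mult.commute)

lemma vanish_order_pderiv3:
  assumes f: "f \<in> vanish_order v (Suc k)" shows "pderiv3 i f \<in> vanish_order v k"
proof -
  have D: "pderiv3 i (taylor v f) \<in> order_ge k" for i
    using f by (simp add: vanish_order_def order_ge_pderiv3)
  have 1: "pderiv3 1 f \<in> vanish_order v k" and 2: "pderiv3 2 f \<in> vanish_order v k"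
    using D[of 1] D[of 2] by (simp_all add: vanish_order_def pderiv3_taylor)
  \<comment> \<open>The chain rule only yields the derivative along the point; removing its other
    two summands leaves d/dX_0.\<close>
  let ?g = "pderiv3 0 f + Const3 (v $ 1) * pderiv3 1 f + Const3 (v $ 2) * pderiv3 2 f"
  have "?g \<in> vanish_order v k"
    using D[of 0] by (simp add: vanish_order_def pderiv3_taylor)
  then have "?g - Const3 (v $ 2) * pderiv3 2 f - Const3 (v $ 1) * pderiv3 1 f \<in> vanish_order v k"
    by (intro vanish_order_diff vanish_order_absorb 1 2)
  then have "pderiv3 0 f \<in> vanish_order v k" by simp
  with 1 2 have "\<forall>i. pderiv3 i f \<in> vanish_order v k" by (simp add: all_3_0)
  then show ?thesis by blast
qed

text \<open>The Euler operator multiplies the coefficient of a monomial \<open>m\<close> by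
  \<open>hdeg m\<close>. On terms of order exactly \<open>k\<close> this is the factor
  \<open>k\<close>, so the difference has no such terms left.\<close>

lemma order_ge_euler:
  assumes "f \<in> order_ge k"
  shows "Var3 1 * pderiv3 1 f + Var3 2 * pderiv3 2 f - of_nat k * f \<in> order_ge (Suc k)"
  unfolding order_ge_iff
proof (intro allI impI)
  fix m assume m: "hdeg m < Suc k"
  have "coeff3 (of_nat k * f) m = of_nat k * coeff3 f m"
    by (induction k) (simp_all add: lookup_add algebra_simps)
  then have "coeff3 (Var3 1 * pderiv3 1 f + Var3 2 * pderiv3 2 f - of_nat k * f) m
    = (of_nat (hdeg m) - of_nat k) * coeff3 f m"
    by (simp add: lookup_add lookup_minus coeff3_Var_pderiv3 hdeg_def algebra_simps)
  also have "\<dots> = 0"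
    using m assms by (cases "hdeg m = k") (auto simp: order_ge_iff)
  finally show "coeff3 (Var3 1 * pderiv3 1 f + Var3 2 * pderiv3 2 f - of_nat k * f) m = 0" .
qed

lemma vanish_order_euler:
  assumes "f \<in> vanish_order v k"
  shows "local_var v 1 * pderiv3 1 f + local_var v 2 * pderiv3 2 f - of_nat k * f \<in> vanish_order v (Suc k)"
proof -
  have "taylor v (of_nat k) = of_nat k"
    by (metis single_of_nat taylor_Const)
  then show ?thesis
    using order_ge_euler[of "taylor v f" k] assms
    by (simp add: vanish_order_def taylor_add taylor_diff taylor_mult taylor_local_var pderiv3_taylor)
qed

text \<open>A monomial of degree n and order below k at (1 : 0 : 0) has X_0-exponent greater than n
  - k, hence at least d; terms of order at least k are discarded. The division compensates for a
  factor X_0^d that gluing introduces.\<close>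

lemma Var3_0_divide:
  assumes "homogeneous n f" "d + k \<le> n"
  shows "\<exists>g. homogeneous (n - d) g \<and> f - Var3 0 ^ d * g \<in> vanish_order v k"
proof -
  have "\<exists>g'. homogeneous (n - d) g' \<and> g - Var3 0 ^ d * g' \<in> order_ge k" if hom: "homogeneous n g" for g :: "'a poly3"
  proof (induction g rule: poly3_term_induct)
    case zero
    show ?case by (intro exI[of _ 0]) (simp add: homogeneous_zero)
  next
    case (monom m)
    let ?c = "coeff3 g m"
    have m: "mdeg m = n"
      using hom monom by (simp add: homogeneous_form_shift form_shift_def)
    show ?case
    proof (cases "k \<le> hdeg m")
      case True
      then show ?thesis by (intro exI[of _ 0]) (simp add: homogeneous_zero order_ge_term)
    next
      case False
      then have "d \<le> expo m 0" using m assms(2) by (simp add: mdeg_def sum_3_0 hdeg_def)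
      then have *: "Poly_Mapping.single 0 d + (m - Poly_Mapping.single 0 d) = m"
        by (intro poly_mapping_eqI) (auto simp: lookup_add lookup_minus lookup_single when_def)
      have "mdeg (Poly_Mapping.single 0 d) = d"
        by (simp add: mdeg_def sum_3_0 lookup_single)
      then have "mdeg (m - Poly_Mapping.single 0 d) = n - d"
        using m mdeg_add[of "Poly_Mapping.single 0 d" "m - Poly_Mapping.single 0 d"] unfolding * by simp
      then have "homogeneous (n - d) (term3 (m - Poly_Mapping.single 0 d) ?c)"
        using homogeneous_term[of "m - Poly_Mapping.single 0 d" ?c] by simp
      moreover have "Var3 0 ^ d * term3 (m - Poly_Mapping.single 0 d) ?c = term3 m ?c"
        unfolding Var3_power term3_mult * by simp
      ultimately show ?thesis by (intro exI[of _ "term3 (m - Poly_Mapping.single 0 d) ?c"]) simp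
    qed
  next
    case (add g h)
    then obtain g' h' where gh: "homogeneous (n - d) g'" "g - Var3 0 ^ d * g' \<in> order_ge k"
      "homogeneous (n - d) h'" "h - Var3 0 ^ d * h' \<in> order_ge k" by blast
    have "g + h - Var3 0 ^ d * (g' + h') = (g - Var3 0 ^ d * g') + (h - Var3 0 ^ d * h')"
      by (simp add: algebra_simps)
    also have "\<dots> \<in> order_ge k"
      by (intro order_ge_add gh)
    finally show ?case
      using homogeneous_add[OF gh(1,3)] by blast
  qed
  from this[OF homogeneous_taylor[OF assms(1), of v]]
  obtain g where g: "homogeneous (n - d) g" "taylor v f - Var3 0 ^ d * g \<in> order_ge k" by blast
  have "taylor v (f - Var3 0 ^ d * taylor (- v) g) = taylor v f - Var3 0 ^ d * g"
    by (simp add: taylor_diff taylor_mult taylor_power taylor_Var taylor_inverse)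
  then show ?thesis
    using g by (intro exI[of _ "taylor (- v) g"]) (auto simp: vanish_order_def homogeneous_taylor)
qed

subsection \<open>Powers of the ideal of a point\<close>

lemma class_ring_ideal_iff:
  fixes I :: "'a::comm_ring_1 set"
  shows "ideal I class_ring \<longleftrightarrow> 0 \<in> I \<and> (\<forall>x\<in>I. \<forall>y\<in>I. x + y \<in> I) \<and> (\<forall>x\<in>I. \<forall>a. a * x \<in> I)"
    (is "_ \<longleftrightarrow> ?P")
proof
  assume "ideal I class_ring"
  then interpret ideal I "class_ring :: 'a ring" .
  show ?P using additive_subgroup.zero_closed[OF is_additive_subgroup] additive_subgroup.a_closed[OF is_additive_subgroup] I_l_closed
    by simp
next
  assume P: ?P
  have neg: "- x \<in> I" if "x \<in> I" for x
    using P that by (metis mult_minus1)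
  have inv: "inv\<^bsub>add_monoid (class_ring :: 'a ring)\<^esub> x = - x" for x :: 'a
    unfolding a_inv_def[symmetric] by (simp add: class_ring_simps)
  have "subgroup I (add_monoid (class_ring :: 'a ring))"
  proof (rule subgroup.intro)
    show "inv\<^bsub>add_monoid class_ring\<^esub> x \<in> I" if "x \<in> I" for x
      using neg[OF that] by (simp only: inv)
  qed (use P in auto)
  then show "ideal I class_ring"
    using P by (intro idealI) (auto simp: class_ring.ring_axioms mult.commute)
qed

lemma vanish_order_ideal: "ideal (vanish_order v k) class_ring"
  by (simp add: class_ring_ideal_iff vanish_order_add vanish_order_absorb)

text \<open>With evaluation seen as a substitution by constants, moving a point is the composition
  of two substitutions.\<close>

lemma eval3_subst3: "Const3 (eval3 v f) = subst3 (\<lambda>i. Const3 (v $ i)) f"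
proof -
  have pow: "Const3 (c ^ n) = Const3 c ^ n" for c :: 'a and n
    by (induction n) (simp_all add: Const3_mult)
  have sum: "Const3 (sum g A) = (\<Sum>m\<in>A. Const3 (g m))" for g :: "mon3 \<Rightarrow> 'a" and A
    by (induction A rule: infinite_finite_induct) (simp_all add: single_add)
  show ?thesis
    by (simp add: eval3_def subst3_def lin_ext_def sum Const3_mult prod_3_0 pow)
qed

lemma eval3_taylor:
  fixes v :: "'k::field ^ 3"
  assumes "v $ 0 = 1"
  shows "eval3 (axis 0 1) (taylor v f) = eval3 v f"
proof -
  have "(\<lambda>i. subst3 (\<lambda>i. Const3 (axis 0 1 $ i)) (if i = 0 then Var3 0 else Var3 i + Const3 (v $ i) * Var3 0)) = (\<lambda>i. Const3 (v $ i))"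
    using assms by (auto simp: subst3_add subst3_mult axis_def)
  then have "Const3 (eval3 (axis 0 1) (taylor v f)) = Const3 (eval3 v f)"
    by (simp add: eval3_subst3 taylor_def subst3_subst3)
  then show ?thesis by (metis lookup_single_eq)
qed

text \<open>In a form of degree n the only monomial without X_1 and X_2 is X_0^n, and after the
  shear its coefficient is the value at \<open>v\<close>.\<close>

lemma vanish_order_1:
  fixes v :: "'k::field ^ 3"
  assumes "homogeneous n f" "eval3 v f = 0" "v $ 0 = 1"
  shows "f \<in> vanish_order v (Suc 0)"
proof -
  let ?g = "taylor v f" and ?m = "Poly_Mapping.single (0::3) n"
  have hd: "hdeg m = 0 \<longleftrightarrow> m = ?m" if "m \<in> Poly_Mapping.keys ?g" for m
  proof -
    have n: "n = expo m 0 + hdeg m"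
      using bspec[OF homogeneous_taylor[OF assms(1), of v, unfolded homogeneous_def] that]
      by (simp add: sum_3_0 hdeg_def)
    have "m = ?m" if "hdeg m = 0"
      by (subst mon3_eq) (use that n in \<open>simp add: hdeg_def\<close>)
    then show ?thesis by (auto simp: hdeg_def lookup_single)
  qed
  have "eval3 (axis 0 1) ?g = (\<Sum>m\<in>Poly_Mapping.keys ?g. if m = ?m then coeff3 ?g ?m else 0)"
    unfolding eval3_def
  proof (rule sum.cong)
    fix m assume "m \<in> Poly_Mapping.keys ?g"
    from hd[OF this] show "coeff3 ?g m * (\<Prod>i\<in>UNIV. axis 0 1 $ i ^ expo m i) = (if m = ?m then coeff3 ?g ?m else 0)"
      by (auto simp: prod_3_0 axis_def hdeg_def lookup_single power_0_left)
  qed simp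
  also have "\<dots> = coeff3 ?g ?m" by (simp add: in_keys_iff)
  finally have "coeff3 ?g ?m = 0" using assms by (simp add: eval3_taylor)
  then have "0 < hdeg m" if "m \<in> Poly_Mapping.keys ?g" for m
    using hd[OF that] that by (auto simp: in_keys_iff)
  then show ?thesis by (auto simp: vanish_order_def order_ge_def Suc_le_eq)
qed

definition line_of :: "'k::field ^ 3 \<Rightarrow> ('k ^ 3) set" where "line_of v = {c *s v | c. c \<noteq> 0}"

text \<open>Two bounds suffice to determine all powers: the ideal has order at least 1, and it
  contains both local coordinates, from which everything of order 1 can be generated.\<close>

lemma vanishing_ideal_line:
  fixes v :: "'k::field ^ 3"
  assumes v: "v $ 0 = 1"
  shows "ideal (vanishing_ideal (line_of v)) class_ring"
    "vanishing_ideal (line_of v) \<subseteq> vanish_order v (Suc 0)"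
    "i \<noteq> 0 \<Longrightarrow> local_var v i \<in> vanishing_ideal (line_of v)"
proof -
  let ?S = "{f. (\<exists>n. homogeneous n f) \<and> (\<forall>w\<in>line_of v. eval3 w f = 0)}"
  show "ideal (vanishing_ideal (line_of v)) class_ring"
    unfolding vanishing_ideal_def by (rule ring.genideal_ideal[OF class_ring.ring_axioms]) simp
  have "v \<in> line_of v" by (auto simp: line_of_def intro!: exI[of _ 1])
  then have "?S \<subseteq> vanish_order v (Suc 0)" using vanish_order_1[OF _ _ v] by blast
  then show "vanishing_ideal (line_of v) \<subseteq> vanish_order v (Suc 0)"
    unfolding vanishing_ideal_def by (rule ring.genideal_minimal[OF class_ring.ring_axioms vanish_order_ideal])
  assume "i \<noteq> 0"
  have "eval3 w (local_var v i) = 0" if w: "w \<in> line_of v" for w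
  proof -
    obtain c where c: "w = c *s v" using w by (auto simp: line_of_def)
    have "Const3 (eval3 w (local_var v i)) = 0"
      unfolding eval3_subst3 local_var_def subst3_diff subst3_mult
      by (simp add: c v term3_mult mult.commute)
    then show ?thesis by (metis lookup_single_eq lookup_zero)
  qed
  then have "local_var v i \<in> ?S" using homogeneous_local_var by blast
  then show "local_var v i \<in> vanishing_ideal (line_of v)"
    unfolding vanishing_ideal_def using ring.genideal_self[OF class_ring.ring_axioms, of ?S] by auto
qed

text \<open>In local coordinates every monomial of order at least k + 1 is a monomial of order at
  least k times X_1 or X_2, and orders add up in products.\<close>

lemma vanishing_ideal_power:
  fixes v :: "'k::field ^ 3"
  assumes v: "v $ 0 = 1"
  shows "vanishing_ideal (line_of v) [^]\<^bsub>ideals_set poly3_ring\<^esub> (k::nat) = vanish_order v k"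
proof (induction k)
  case 0
  \<comment> \<open>The unit of the monoid of ideals is the whole ring, and so is
    \<open>vanish_order v 0\<close>.\<close>
  show ?case by (simp add: nat_pow_def ideals_set_def)
next
  case (Suc k)
  let ?R = "poly3_ring :: 'k poly3 ring"
  let ?W = "vanishing_ideal (line_of v)"
  have "?W [^]\<^bsub>ideals_set ?R\<^esub> Suc k = ideal_prod ?R (vanish_order v k) ?W"
    using Suc by (simp add: nat_pow_def ideals_set_def)
  also have "\<dots> = vanish_order v (Suc k)"
  proof
    show "ideal_prod ?R (vanish_order v k) ?W \<subseteq> vanish_order v (Suc k)"
    proof
      fix f assume "f \<in> ideal_prod ?R (vanish_order v k) ?W"
      then show "f \<in> vanish_order v (Suc k)"
      proof induction
        case (prod i j)
        then show ?case using vanish_order_mult[of i v k j "Suc 0"] vanishing_ideal_line(2)[OF v] by auto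
      qed (simp add: vanish_order_add)
    qed
    show "vanish_order v (Suc k) \<subseteq> ideal_prod ?R (vanish_order v k) ?W"
    proof
      fix f assume f: "f \<in> vanish_order v (Suc k)"
      have "taylor (- v) g \<in> ideal_prod ?R (vanish_order v k) ?W" if g: "g \<in> order_ge (Suc k)" for g
      proof (induction g rule: poly3_term_induct)
        case zero
        have "0 * local_var v 1 \<in> ideal_prod ?R (vanish_order v k) ?W"
          using ideal_prod.prod[of 0 "vanish_order v k" "local_var v 1" ?W ?R] vanishing_ideal_line(3)[OF v] by simp
        then show ?case by simp
      next
        case (monom m)
        let ?c = "coeff3 g m"
        have "Suc k \<le> hdeg m" using monom g by (simp add: order_ge_def)
        then have "\<exists>i::3. i \<noteq> 0 \<and> 0 < expo m i \<and> k \<le> hdeg (m - unit_exp i)"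
        proof (cases "expo m 1 = 0")
          case True
          with \<open>Suc k \<le> hdeg m\<close> show ?thesis
            by (intro exI[of _ 2]) (auto simp: hdeg_def lookup_minus lookup_single)
        next
          case False
          with \<open>Suc k \<le> hdeg m\<close> show ?thesis
            by (intro exI[of _ 1]) (auto simp: hdeg_def lookup_minus lookup_single)
        qed
        then obtain i :: 3 where i: "i \<noteq> 0" "0 < expo m i" "k \<le> hdeg (m - unit_exp i)" by blast
        have "(m - unit_exp i) + unit_exp i = m"
          using i(2) by (intro poly_mapping_eqI) (auto simp: lookup_add lookup_minus lookup_single when_def)
        then have "term3 m ?c = term3 (m - unit_exp i) ?c * Var3 i"
          by (simp add: Var3_def term3_mult)
        then have "taylor (- v) (term3 m ?c) = taylor (- v) (term3 (m - unit_exp i) ?c) * local_var v i"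
          by (simp add: taylor_mult taylor_uminus_Var i(1))
        moreover have "taylor (- v) (term3 (m - unit_exp i) ?c) \<in> vanish_order v k"
          by (intro taylor_vanish_order order_ge_term i(3))
        ultimately show ?case
          using ideal_prod.prod[of _ "vanish_order v k" "local_var v i" ?W ?R] vanishing_ideal_line(3)[OF v i(1)] by simp
      next
        case (add g h)
        then show ?case using ideal_prod.sum[of _ ?R] by (fastforce simp: taylor_add)
      qed
      from this[of "taylor v f"] f show "f \<in> ideal_prod ?R (vanish_order v k) ?W"
        by (simp add: taylor_inverse' vanish_order_def)
    qed
  qed
  finally show ?case .
qed

subsection \<open>Interpolation\<close>

text \<open>Take a linear form l that vanishes at w and agrees with X_0 at v, and let y = X_0^k -
  l^k, which vanishes at v. The form g = X_0^(k^2) - y^k differs from X_0^(k^2) by y^k, of order k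
  at v; and l^k = X_0^k - y divides g, which gives order k at w.\<close>

lemma separating_form:
  fixes v w :: "'k::field ^ 3"
  assumes "v $ 0 = 1" "w $ 0 = 1" "v \<noteq> w"
  shows "\<exists>g. homogeneous (k * k) g \<and> g \<in> vanish_order w k \<and> g - Var3 0 ^ (k * k) \<in> vanish_order v k"
proof -
  obtain i where i: "v $ i \<noteq> w $ i" using assms(3) by (auto simp: vec_eq_iff)
  then have i0: "i \<noteq> 0" using assms by auto
  let ?c = "inverse (v $ i - w $ i)"
  let ?X = "Var3 0 :: 'k poly3"
  define l where "l = Const3 ?c * local_var w i"
  have l: "homogeneous 1 l" "l \<in> vanish_order w (Suc 0)"
    unfolding l_def using i0
    by (auto intro: homogeneous_Const_mult homogeneous_local_var vanish_order_absorb local_var_vanish simp del: One_nat_def)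
  have "Const3 ?c * Const3 (v $ i - w $ i) = 1"
    using i by (simp add: term3_mult)
  then have "?X = Const3 ?c * (Const3 (v $ i - w $ i) * ?X)"
    by (simp add: mult.assoc[symmetric])
  then have "?X - l = Const3 ?c * (Const3 (v $ i - w $ i) * ?X) - l"
    by (rule arg_cong[where f = "\<lambda>x. x - l"])
  also have "\<dots> = Const3 (- ?c) * local_var v i"
    unfolding l_def local_var_def single_diff single_uminus by (simp add: algebra_simps)
  finally have "?X - l = Const3 (- ?c) * local_var v i" .
  then have Xl: "?X - l \<in> vanish_order v (Suc 0)"
    using i0 by (auto intro: vanish_order_absorb local_var_vanish)
  define y where "y = ?X ^ k - l ^ k"
  have X: "homogeneous n (?X ^ n)" for n
    using homogeneous_power[OF homogeneous_Var(1)[of 0], of n] by simp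
  have y: "homogeneous k y"
    unfolding y_def using homogeneous_power[OF l(1), of k] X[of k] by (auto intro: homogeneous_diff)
  have dvd: "\<exists>q. a ^ n - b ^ n = q * (a - b)" for a b :: "'k poly3" and n
    by (rule exI) (subst mult.commute, rule power_diff_sumr2)
  have yv: "y \<in> vanish_order v (Suc 0)"
    using dvd[of ?X k l] Xl unfolding y_def by (auto intro: vanish_order_absorb)
  let ?g = "?X ^ (k * k) - y ^ k"
  have "homogeneous (k * k) ?g"
    using X[of "k * k"] homogeneous_power[OF y, of k] by (auto intro: homogeneous_diff)
  moreover have "?g \<in> vanish_order w k"
  proof -
    obtain q where "(?X ^ k) ^ k - y ^ k = q * (?X ^ k - y)" using dvd by blast
    then have "?g = q * l ^ k" by (simp add: power_mult y_def)
    then show ?thesis using l(2) by (auto intro: vanish_order_absorb vanish_order_power)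
  qed
  moreover have "?g - ?X ^ (k * k) \<in> vanish_order v k"
    using yv by (simp add: vanish_order_uminus vanish_order_power)
  ultimately show ?thesis by blast
qed

text \<open>The product of the separating forms of v against each point of \<open>W\<close>; being
  congruent to a power of X_0 at v is preserved by products.\<close>

lemma isolating_form:
  fixes v :: "'k::field ^ 3" and W :: "('k ^ 3) set"
  assumes "finite W" "\<forall>w\<in>W. w $ 0 = 1" "v $ 0 = 1" "v \<notin> W"
  shows "\<exists>g. homogeneous (card W * (k * k)) g \<and> (\<forall>w\<in>W. g \<in> vanish_order w k) \<and>
    g - Var3 0 ^ (card W * (k * k)) \<in> vanish_order v k"
  using assms
proof (induction W)
  case empty
  show ?case by (intro exI[of _ 1]) simp
next
  case (insert w W)
  let ?a = "k * k" and ?b = "card W * (k * k)"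
  obtain g where g: "homogeneous ?b g" "\<forall>w\<in>W. g \<in> vanish_order w k" "g - Var3 0 ^ ?b \<in> vanish_order v k"
    using insert by auto
  obtain h where h: "homogeneous ?a h" "h \<in> vanish_order w k" "h - Var3 0 ^ ?a \<in> vanish_order v k"
    using separating_form[of v w k] insert.prems by auto
  have n: "card (insert w W) * (k * k) = ?a + ?b" using insert by simp
  have "homogeneous (?a + ?b) (h * g)" by (intro homogeneous_mult g h)
  moreover have "\<forall>x\<in>insert w W. h * g \<in> vanish_order x k"
    using g(2) vanish_order_absorb[OF h(2), of g] by (auto intro: vanish_order_absorb simp: mult.commute[of g])
  moreover have "h * g - Var3 0 ^ (?a + ?b) \<in> vanish_order v k"
  proof -
    have "h * g - Var3 0 ^ (?a + ?b) = g * (h - Var3 0 ^ ?a) + Var3 0 ^ ?a * (g - Var3 0 ^ ?b)"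
      by (simp add: algebra_simps power_add)
    also have "\<dots> \<in> vanish_order v k"
      by (rule vanish_order_add[OF vanish_order_absorb[OF h(3)] vanish_order_absorb[OF g(3)]])
    finally show ?thesis .
  qed
  ultimately show ?case unfolding n by blast
qed

definition divg :: "'k::field poly3 ^ 3 \<Rightarrow> 'k poly3" where
  "divg u = pderiv3 0 (u $ 0) + pderiv3 1 (u $ 1) + pderiv3 2 (u $ 2)"

locale plane_points =
  fixes pts :: "('k::field_char_0 ^ 3) set"
  assumes finite_pts: "finite pts" and normalized: "v \<in> pts \<Longrightarrow> v $ 0 = 1"
begin

text \<open>The first summand is the degree of a form that isolates one point from the others; the
  further k is the room that \<open>Var3_0_divide\<close> asks for.\<close>

definition interp_degree :: "nat \<Rightarrow> nat" where
  "interp_degree k = (card pts - 1) * (k * k) + k"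

text \<open>The solution is a sum of products e_v q_v with isolating forms e_v. Since e_v is
  congruent to X_0^d at v rather than to 1, the local datum is first divided by X_0^d, up to order
  k.\<close>

lemma interpolation:
  assumes h: "\<And>v. v \<in> pts \<Longrightarrow> homogeneous n (h v)" and n: "interp_degree k \<le> n"
  shows "\<exists>f. homogeneous n f \<and> (\<forall>v\<in>pts. f - h v \<in> vanish_order v k)"
proof -
  let ?d = "(card pts - 1) * (k * k)"
  have "\<exists>g. homogeneous ?d g \<and> (\<forall>w\<in>pts - {v}. g \<in> vanish_order w k) \<and> g - Var3 0 ^ ?d \<in> vanish_order v k"
    if "v \<in> pts" for v
    using isolating_form[of "pts - {v}" v k] that finite_pts normalized by auto
  then obtain e where e: "\<And>v. v \<in> pts \<Longrightarrow> homogeneous ?d (e v)"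
    "\<And>v w. v \<in> pts \<Longrightarrow> w \<in> pts \<Longrightarrow> w \<noteq> v \<Longrightarrow> e v \<in> vanish_order w k"
    "\<And>v. v \<in> pts \<Longrightarrow> e v - Var3 0 ^ ?d \<in> vanish_order v k"
    by (metis Diff_iff singletonD)
  have "\<exists>g. homogeneous (n - ?d) g \<and> h v - Var3 0 ^ ?d * g \<in> vanish_order v k" if "v \<in> pts" for v
    using Var3_0_divide[OF h[OF that], of ?d k v] n by (simp add: interp_degree_def)
  then obtain q where q: "\<And>v. v \<in> pts \<Longrightarrow> homogeneous (n - ?d) (q v)"
    "\<And>v. v \<in> pts \<Longrightarrow> h v - Var3 0 ^ ?d * q v \<in> vanish_order v k" by metis
  let ?f = "\<Sum>v\<in>pts. e v * q v"
  have "homogeneous n (e v * q v)" if "v \<in> pts" for v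
    using homogeneous_mult[OF e(1)[OF that] q(1)[OF that]] n by (simp add: interp_degree_def)
  then have "homogeneous n ?f" by (rule homogeneous_sum)
  moreover have "?f - h v \<in> vanish_order v k" if v: "v \<in> pts" for v
  proof -
    have "?f - h v = q v * (e v - Var3 0 ^ ?d) + (\<Sum>w\<in>pts - {v}. q w * e w) - (h v - Var3 0 ^ ?d * q v)"
      using sum.remove[OF finite_pts v, of "\<lambda>v. e v * q v"] by (simp add: algebra_simps)
    also have "\<dots> \<in> vanish_order v k"
      by (rule vanish_order_diff[OF vanish_order_add[OF vanish_order_absorb[OF e(3)[OF v]] vanish_order_sum] q(2)[OF v]],
          rule vanish_order_absorb[OF e(2)]) (use v in auto)
    finally show ?thesis .
  qed
  ultimately show ?thesis by blast
qed

text \<open>Interpolation to one order more than the order of vanishing also matches first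
  derivatives up to order k. Identities between derivatives of the local data thereby pass to the
  glued form.\<close>

lemma interpolation_vanishing:
  assumes h: "\<And>v. v \<in> pts \<Longrightarrow> homogeneous n (h v)" "\<And>v. v \<in> pts \<Longrightarrow> h v \<in> vanish_order v k"
    and n: "interp_degree (Suc k) \<le> n"
  obtains f where "homogeneous n f" "\<And>v. v \<in> pts \<Longrightarrow> f \<in> vanish_order v k"
    "\<And>v i. v \<in> pts \<Longrightarrow> pderiv3 i f - pderiv3 i (h v) \<in> vanish_order v k"
proof -
  obtain f where f: "homogeneous n f" "\<And>v. v \<in> pts \<Longrightarrow> f - h v \<in> vanish_order v (Suc k)"
    using interpolation[of n h "Suc k"] h(1) n by blast
  have "f \<in> vanish_order v k" if "v \<in> pts" for v
    using vanish_order_add[OF vanish_order_mono[OF f(2)[OF that]] h(2)[OF that]] by simp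
  moreover have "pderiv3 i f - pderiv3 i (h v) \<in> vanish_order v k" if "v \<in> pts" for v i
    using vanish_order_pderiv3[OF f(2)[OF that], of i] by (simp add: pderiv3_diff)
  ultimately show thesis using that f(1) by blast
qed

subsection \<open>Local exactness\<close>

lemma pderiv3_local_var:
  "pderiv3 1 (local_var v 1) = 1" "pderiv3 2 (local_var v 1) = 0"
  "pderiv3 1 (local_var v 2) = 0" "pderiv3 2 (local_var v 2) = 1"
  by (simp_all add: local_var_def pderiv3_diff pderiv3_mult pderiv3_Var)

lemma Const3_inverse:
  assumes "a = of_nat (Suc k)"
  shows "Const3 (inverse (of_nat (Suc k)) :: 'k) * a = 1"
proof -
  have "inverse (of_nat (Suc k)) * of_nat (Suc k) = (1 :: 'k)"
    by (rule left_inverse) (rule of_nat_neq_0)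
  then show ?thesis
    unfolding assms single_of_nat[symmetric] term3_mult by (simp del: of_nat_Suc)
qed

text \<open>Contraction with the local Euler field \<open>\<ell>\<^sub>1 \<partial>\<^sub>1 + \<ell>\<^sub>2 \<partial>\<^sub>2\<close> inverts the divergence and, in
  \<open>stream_function\<close>, the gradient, up to terms of higher order.\<close>

lemma primitive:
  assumes h: "\<And>v. v \<in> pts \<Longrightarrow> homogeneous n (h v)" "\<And>v. v \<in> pts \<Longrightarrow> h v \<in> vanish_order v k"
    and n: "interp_degree (Suc (Suc k)) \<le> Suc n"
  shows "\<exists>f g. homogeneous (Suc n) f \<and> homogeneous (Suc n) g \<and>
    (\<forall>v\<in>pts. f \<in> vanish_order v (Suc k) \<and> g \<in> vanish_order v (Suc k) \<and>
      pderiv3 1 f + pderiv3 2 g - h v \<in> vanish_order v (Suc k))"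
proof -
  \<comment> \<open>In the divergence of (ell_1 h, ell_2 h) the product rule contributes 2 h and, to
    lowest order, the Euler field contributes k h; hence the divisor k + 2.\<close>
  define c where "c = Const3 (inverse (of_nat (Suc (Suc k))) :: 'k)"
  have c: "c * (of_nat k + 2) = 1" unfolding c_def by (rule Const3_inverse[of _ "Suc k"]) simp
  have D: "pderiv3 i (c * r) = c * pderiv3 i r" for i r
    unfolding c_def pderiv3_mult by simp
  let ?h = "\<lambda>i v. c * (local_var v i * h v)"
  have hom: "homogeneous (Suc n) (?h i v)" if "v \<in> pts" for v i
    using homogeneous_Const_mult[OF homogeneous_mult[OF homogeneous_local_var h(1)[OF that]]]
    unfolding c_def by simp
  have van: "?h i v \<in> vanish_order v (Suc k)" if "v \<in> pts" "i \<noteq> 0" for v i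
    using vanish_order_mult[OF local_var_vanish[OF that(2)] h(2)[OF that(1)]] by (auto intro: vanish_order_absorb)
  obtain f where f: "homogeneous (Suc n) f" "\<And>v. v \<in> pts \<Longrightarrow> f \<in> vanish_order v (Suc k)"
      "\<And>v i. v \<in> pts \<Longrightarrow> pderiv3 i f - pderiv3 i (?h 1 v) \<in> vanish_order v (Suc k)"
    by (rule interpolation_vanishing[of "Suc n" "?h 1" "Suc k"]) (use hom van n in auto)
  obtain g where g: "homogeneous (Suc n) g" "\<And>v. v \<in> pts \<Longrightarrow> g \<in> vanish_order v (Suc k)"
      "\<And>v i. v \<in> pts \<Longrightarrow> pderiv3 i g - pderiv3 i (?h 2 v) \<in> vanish_order v (Suc k)"
    by (rule interpolation_vanishing[of "Suc n" "?h 2" "Suc k"]) (use hom van n in auto)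
  have "pderiv3 1 f + pderiv3 2 g - h v \<in> vanish_order v (Suc k)" if v: "v \<in> pts" for v
  proof -
    have "pderiv3 1 (?h 1 v) + pderiv3 2 (?h 2 v)
        = c * (2 * h v + local_var v 1 * pderiv3 1 (h v) + local_var v 2 * pderiv3 2 (h v))"
      unfolding D by (simp add: pderiv3_mult pderiv3_local_var algebra_simps)
    also have "\<dots> = c * (local_var v 1 * pderiv3 1 (h v) + local_var v 2 * pderiv3 2 (h v) - of_nat k * h v) + (c * (of_nat k + 2)) * h v"
      by (simp add: algebra_simps)
    finally have "pderiv3 1 (?h 1 v) + pderiv3 2 (?h 2 v) - h v
        = c * (local_var v 1 * pderiv3 1 (h v) + local_var v 2 * pderiv3 2 (h v) - of_nat k * h v)"
      unfolding c by simp
    then have "pderiv3 1 (?h 1 v) + pderiv3 2 (?h 2 v) - h v \<in> vanish_order v (Suc k)"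
      by (simp only: vanish_order_absorb vanish_order_euler h(2)[OF v])
    then have "(pderiv3 1 f - pderiv3 1 (?h 1 v)) + (pderiv3 2 g - pderiv3 2 (?h 2 v))
        + (pderiv3 1 (?h 1 v) + pderiv3 2 (?h 2 v) - h v) \<in> vanish_order v (Suc k)"
      by (rule vanish_order_add[OF vanish_order_add[OF f(3)[OF v] g(3)[OF v]]])
    then show ?thesis by (simp add: algebra_simps)
  qed
  then show ?thesis using f g by blast
qed

text \<open>For h = ell_2 a - ell_1 b, the derivative d/dX_2 gives a + ell_2 da/dX_2 - ell_1
  db/dX_2. The divergence condition turns the last term into + ell_1 da/dX_1, which completes the
  Euler operator on a; d/dX_1 treats b in the same way.\<close>

lemma stream_function:
  assumes a: "homogeneous n a" "\<And>v. v \<in> pts \<Longrightarrow> a \<in> vanish_order v k"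
    and b: "homogeneous n b" "\<And>v. v \<in> pts \<Longrightarrow> b \<in> vanish_order v k"
    and ab: "\<And>v. v \<in> pts \<Longrightarrow> pderiv3 1 a + pderiv3 2 b \<in> vanish_order v k"
    and n: "interp_degree (Suc (Suc k)) \<le> Suc n"
  shows "\<exists>f. homogeneous (Suc n) f \<and> (\<forall>v\<in>pts. f \<in> vanish_order v (Suc k) \<and>
      a - pderiv3 2 f \<in> vanish_order v (Suc k) \<and> b + pderiv3 1 f \<in> vanish_order v (Suc k))"
proof -
  \<comment> \<open>The product rule contributes a and the Euler identity k a, hence the divisor k +
    1.\<close>
  define c where "c = Const3 (inverse (of_nat (Suc k)) :: 'k)"
  have c: "c * (of_nat k + 1) = 1" unfolding c_def by (rule Const3_inverse[of _ k]) simp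
  let ?h = "\<lambda>v. c * (local_var v 2 * a - local_var v 1 * b)"
  have hom: "homogeneous (Suc n) (?h v)" for v
    using homogeneous_Const_mult[OF homogeneous_diff[OF homogeneous_mult[OF homogeneous_local_var a(1)] homogeneous_mult[OF homogeneous_local_var b(1)]]]
    unfolding c_def by simp
  have lv: "local_var v i * f \<in> vanish_order v (Suc k)" if "i \<noteq> 0" "f \<in> vanish_order v k" for f v i
    using vanish_order_mult[OF local_var_vanish[OF that(1)] that(2)] by simp
  have van: "?h v \<in> vanish_order v (Suc k)" if "v \<in> pts" for v
    by (rule vanish_order_absorb[OF vanish_order_diff[OF lv[OF three_distinct(4) a(2)[OF that]] lv[OF three_distinct(2) b(2)[OF that]]]])
  obtain f where f: "homogeneous (Suc n) f" "\<And>v. v \<in> pts \<Longrightarrow> f \<in> vanish_order v (Suc k)"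
      "\<And>v i. v \<in> pts \<Longrightarrow> pderiv3 i f - pderiv3 i (?h v) \<in> vanish_order v (Suc k)"
    by (rule interpolation_vanishing[of "Suc n" ?h "Suc k"]) (use hom van n in auto)
  have D: "pderiv3 i (c * r) = c * pderiv3 i r" for i r
    unfolding c_def pderiv3_mult by simp
  have "a - pderiv3 2 f \<in> vanish_order v (Suc k) \<and> b + pderiv3 1 f \<in> vanish_order v (Suc k)" if v: "v \<in> pts" for v
  proof
    let ?l = "local_var v" and ?d = "pderiv3 1 a + pderiv3 2 b"
    note E = vanish_order_euler[OF a(2)[OF v]] vanish_order_euler[OF b(2)[OF v]]
    note L = lv[OF three_distinct(2) ab[OF v]] lv[OF three_distinct(4) ab[OF v]]
    have "a - pderiv3 2 (?h v) = c * (?l 1 * ?d - (?l 1 * pderiv3 1 a + ?l 2 * pderiv3 2 a - of_nat k * a))"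
    proof -
      have "(c * (of_nat k + 1)) * a - c * pderiv3 2 (?l 2 * a - ?l 1 * b)
          = c * (?l 1 * ?d - (?l 1 * pderiv3 1 a + ?l 2 * pderiv3 2 a - of_nat k * a))"
        by (simp add: pderiv3_mult pderiv3_diff pderiv3_local_var algebra_simps)
      then show ?thesis unfolding D c by simp
    qed
    also have "\<dots> \<in> vanish_order v (Suc k)"
      by (rule vanish_order_absorb[OF vanish_order_diff[OF L(1) E(1)]])
    finally have "(a - pderiv3 2 (?h v)) - (pderiv3 2 f - pderiv3 2 (?h v)) \<in> vanish_order v (Suc k)"
      by (rule vanish_order_diff[OF _ f(3)[OF v]])
    then show "a - pderiv3 2 f \<in> vanish_order v (Suc k)" by simp
    have "b + pderiv3 1 (?h v) = c * (?l 2 * ?d - (?l 1 * pderiv3 1 b + ?l 2 * pderiv3 2 b - of_nat k * b))"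
    proof -
      have "(c * (of_nat k + 1)) * b + c * pderiv3 1 (?l 2 * a - ?l 1 * b)
          = c * (?l 2 * ?d - (?l 1 * pderiv3 1 b + ?l 2 * pderiv3 2 b - of_nat k * b))"
        by (simp add: pderiv3_mult pderiv3_diff pderiv3_local_var algebra_simps)
      then show ?thesis unfolding D c by simp
    qed
    also have "\<dots> \<in> vanish_order v (Suc k)"
      by (rule vanish_order_absorb[OF vanish_order_diff[OF L(2) E(2)]])
    finally have "(b + pderiv3 1 (?h v)) + (pderiv3 1 f - pderiv3 1 (?h v)) \<in> vanish_order v (Suc k)"
      by (rule vanish_order_add[OF _ f(3)[OF v]])
    then show "b + pderiv3 1 f \<in> vanish_order v (Suc k)" by simp
  qed
  then show ?thesis using f by blast
qed

definition vanish_all :: "nat \<Rightarrow> 'k poly3 set" where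
  "vanish_all k = (\<Inter>v\<in>pts. vanish_order v k)"

text \<open>As forms, u agrees with df dX_2 - dg dX_1 + dh dX_0 (exterior products) up to order k +
  1. First \<open>primitive\<close> finds f and g for the component at index 0. The other two
  components, corrected by the X_0-derivatives of f and g, are a planar field with divergence of
  order k, and h is its stream function.\<close>

lemma divergence_exact:
  fixes u :: "'k poly3 ^ 3"
  assumes u: "\<And>i. homogeneous n (u $ i)" "\<And>i. u $ i \<in> vanish_all k" "divg u \<in> vanish_all k"
    and n: "interp_degree (Suc (Suc k)) \<le> Suc n"
  shows "\<exists>f g h. f \<in> vanish_all (Suc k) \<and> g \<in> vanish_all (Suc k) \<and> h \<in> vanish_all (Suc k) \<and>
    u $ 0 - pderiv3 1 f - pderiv3 2 g \<in> vanish_all (Suc k) \<and>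
    u $ 1 + pderiv3 0 f - pderiv3 2 h \<in> vanish_all (Suc k) \<and>
    u $ 2 + pderiv3 0 g + pderiv3 1 h \<in> vanish_all (Suc k)"
proof -
  have uv: "u $ i \<in> vanish_order v k" if "v \<in> pts" for v i using u(2) that by (auto simp: vanish_all_def)
  obtain f g where fg: "homogeneous (Suc n) f" "homogeneous (Suc n) g"
    "\<And>v. v \<in> pts \<Longrightarrow> f \<in> vanish_order v (Suc k)" "\<And>v. v \<in> pts \<Longrightarrow> g \<in> vanish_order v (Suc k)"
    "\<And>v. v \<in> pts \<Longrightarrow> pderiv3 1 f + pderiv3 2 g - u $ 0 \<in> vanish_order v (Suc k)"
    using primitive[of n "\<lambda>_. u $ 0" k] u(1) uv n by blast
  let ?a = "u $ 1 + pderiv3 0 f" and ?b = "u $ 2 + pderiv3 0 g"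
  have h0: "u $ 0 - pderiv3 1 f - pderiv3 2 g \<in> vanish_order v (Suc k)" if "v \<in> pts" for v
    using vanish_order_uminus[OF fg(5)[OF that]] by (simp add: algebra_simps)
  have "pderiv3 1 ?a + pderiv3 2 ?b \<in> vanish_order v k" if "v \<in> pts" for v
  proof -
    \<comment> \<open>The planar divergence is \<open>divg u\<close> up to the X_0-derivative of the
      error in the component at index 0; that error has order k + 1, so its derivative has order
      k.\<close>
    have "pderiv3 1 ?a + pderiv3 2 ?b = divg u - pderiv3 0 (u $ 0 - pderiv3 1 f - pderiv3 2 g)"
      by (simp add: divg_def pderiv3_add pderiv3_diff pderiv3_commute[of 0 1] pderiv3_commute[of 0 2] algebra_simps)
    also have "\<dots> \<in> vanish_order v k"
      using u(3) that by (intro vanish_order_diff[OF _ vanish_order_pderiv3[OF h0[OF that]]]) (simp add: vanish_all_def)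
    finally show ?thesis .
  qed
  then have "\<exists>h. homogeneous (Suc n) h \<and> (\<forall>v\<in>pts. h \<in> vanish_order v (Suc k) \<and>
      ?a - pderiv3 2 h \<in> vanish_order v (Suc k) \<and> ?b + pderiv3 1 h \<in> vanish_order v (Suc k))"
    by (intro stream_function n homogeneous_add[OF u(1)] homogeneous_pderiv3 fg(1,2)
        vanish_order_add[OF uv] vanish_order_pderiv3 fg(3,4)) auto
  then obtain h where h: "homogeneous (Suc n) h" "\<And>v. v \<in> pts \<Longrightarrow> h \<in> vanish_order v (Suc k)"
      "\<And>v. v \<in> pts \<Longrightarrow> ?a - pderiv3 2 h \<in> vanish_order v (Suc k)" "\<And>v. v \<in> pts \<Longrightarrow> ?b + pderiv3 1 h \<in> vanish_order v (Suc k)"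
    by blast
  show ?thesis
    by (intro exI[of _ f] exI[of _ g] exI[of _ h] conjI) (use fg h h0 in \<open>auto simp: vanish_all_def\<close>)
qed

end

subsection \<open>Free modules and quotient modules\<close>

lemma free_module_simps [simp]:
  "f \<in> carrier (free_module R B) \<longleftrightarrow>
     f \<in> B \<rightarrow> carrier R \<and> (\<forall>x. x \<notin> B \<longrightarrow> f x = \<zero>\<^bsub>R\<^esub>) \<and> finite {x. f x \<noteq> \<zero>\<^bsub>R\<^esub>}"
  "\<zero>\<^bsub>free_module R B\<^esub> = (\<lambda>x. \<zero>\<^bsub>R\<^esub>)"
  "f \<oplus>\<^bsub>free_module R B\<^esub> g = (\<lambda>x. f x \<oplus>\<^bsub>R\<^esub> g x)"
  "a \<odot>\<^bsub>free_module R B\<^esub> f = (\<lambda>x. a \<otimes>\<^bsub>R\<^esub> f x)"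
  by (simp_all add: free_module_def)

lemma free_module_mem:
  "f \<in> carrier (free_module R B) \<Longrightarrow> \<zero>\<^bsub>R\<^esub> \<in> carrier R \<Longrightarrow> f x \<in> carrier R"
  by (cases "x \<in> B") auto

lemma free_module_module:
  assumes "cring R" shows "Module.module R (free_module R B)"
proof -
  interpret R: cring R by fact
  note mem = free_module_mem[OF _ R.zero_closed]
  show ?thesis
  proof (rule module_criteria[OF assms], safe)
    fix f g assume f: "f \<in> carrier (free_module R B)" and g: "g \<in> carrier (free_module R B)"
    have "finite {x. f x \<oplus>\<^bsub>R\<^esub> g x \<noteq> \<zero>\<^bsub>R\<^esub>}"
      by (rule finite_subset[of _ "{x. f x \<noteq> \<zero>\<^bsub>R\<^esub>} \<union> {x. g x \<noteq> \<zero>\<^bsub>R\<^esub>}"]) (use f g in auto)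
    then show "f \<oplus>\<^bsub>free_module R B\<^esub> g \<in> carrier (free_module R B)" using f g by auto
    show "f \<oplus>\<^bsub>free_module R B\<^esub> g = g \<oplus>\<^bsub>free_module R B\<^esub> f"
      using mem[OF f] mem[OF g] by (simp add: R.a_comm del: free_module_simps(1))
    fix h assume h: "h \<in> carrier (free_module R B)"
    show "f \<oplus>\<^bsub>free_module R B\<^esub> g \<oplus>\<^bsub>free_module R B\<^esub> h = f \<oplus>\<^bsub>free_module R B\<^esub> (g \<oplus>\<^bsub>free_module R B\<^esub> h)"
      using mem[OF f] mem[OF g] mem[OF h] by (simp add: R.a_assoc del: free_module_simps(1))
  next
    fix f assume f: "f \<in> carrier (free_module R B)"
    let ?g = "\<lambda>x. \<ominus>\<^bsub>R\<^esub> f x"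
    have "finite {x. ?g x \<noteq> \<zero>\<^bsub>R\<^esub>}"
      by (rule finite_subset[of _ "{x. f x \<noteq> \<zero>\<^bsub>R\<^esub>}"]) (use f in auto)
    then have "?g \<in> carrier (free_module R B)" using f by auto
    moreover have "f \<oplus>\<^bsub>free_module R B\<^esub> ?g = \<zero>\<^bsub>free_module R B\<^esub>"
      using mem[OF f] by (simp add: R.r_neg del: free_module_simps(1))
    ultimately show "\<exists>g\<in>carrier (free_module R B). f \<oplus>\<^bsub>free_module R B\<^esub> g = \<zero>\<^bsub>free_module R B\<^esub>" by blast
    show "f \<oplus>\<^bsub>free_module R B\<^esub> \<zero>\<^bsub>free_module R B\<^esub> = f" "\<one>\<^bsub>R\<^esub> \<odot>\<^bsub>free_module R B\<^esub> f = f"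
      using mem[OF f] by (simp_all del: free_module_simps(1))
    fix c assume c: "c \<in> carrier R"
    have "finite {x. c \<otimes>\<^bsub>R\<^esub> f x \<noteq> \<zero>\<^bsub>R\<^esub>}"
      by (rule finite_subset[of _ "{x. f x \<noteq> \<zero>\<^bsub>R\<^esub>}"]) (use f c in auto)
    then show "c \<odot>\<^bsub>free_module R B\<^esub> f \<in> carrier (free_module R B)" using f c by auto
    fix d assume d: "d \<in> carrier R"
    show "c \<otimes>\<^bsub>R\<^esub> d \<odot>\<^bsub>free_module R B\<^esub> f = c \<odot>\<^bsub>free_module R B\<^esub> (d \<odot>\<^bsub>free_module R B\<^esub> f)"
      "(c \<oplus>\<^bsub>R\<^esub> d) \<odot>\<^bsub>free_module R B\<^esub> f = c \<odot>\<^bsub>free_module R B\<^esub> f \<oplus>\<^bsub>free_module R B\<^esub> d \<odot>\<^bsub>free_module R B\<^esub> f"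
      using c d mem[OF f] by (simp_all add: R.m_assoc R.l_distr del: free_module_simps(1))
  next
    fix c f g assume c: "c \<in> carrier R" and f: "f \<in> carrier (free_module R B)" and g: "g \<in> carrier (free_module R B)"
    show "c \<odot>\<^bsub>free_module R B\<^esub> (f \<oplus>\<^bsub>free_module R B\<^esub> g) = c \<odot>\<^bsub>free_module R B\<^esub> f \<oplus>\<^bsub>free_module R B\<^esub> c \<odot>\<^bsub>free_module R B\<^esub> g"
      using c mem[OF f] mem[OF g] by (simp add: R.r_distr del: free_module_simps(1))
  qed auto
qed

lemma free_gen_closed: "cring R \<Longrightarrow> b \<in> B \<Longrightarrow> free_gen R b \<in> carrier (free_module R B)"
proof -
  assume "cring R" and b: "b \<in> B"
  then interpret R: cring R by simp
  have "finite {x. free_gen R b x \<noteq> \<zero>\<^bsub>R\<^esub>}"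
    by (rule finite_subset[of _ "{b}"]) (auto simp: free_gen_def)
  then show ?thesis using b by (auto simp: free_gen_def)
qed

locale module_quotient = Module.module R M for R (structure) and M (structure) +
  fixes N
  assumes sub: "LinearCombinations.submodule R N M"
begin

abbreviation Q where "Q \<equiv> quotient_module M N"
abbreviation coset where "coset x \<equiv> N +>\<^bsub>M\<^esub> x"

lemma sub_carrier: "x \<in> N \<Longrightarrow> x \<in> carrier M"
  using sub by (auto simp: LinearCombinations.submodule_def)

lemma sub_minus:
  assumes "x \<in> N" shows "\<ominus>\<^bsub>M\<^esub> x \<in> N"
proof -
  have "(\<ominus> \<one>) \<odot>\<^bsub>M\<^esub> x \<in> N"
    by (rule LinearCombinations.submodule.smult_closed[OF sub _ assms]) simp
  then show ?thesis unfolding smult_minus_1[OF sub_carrier[OF assms]] .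
qed

sublocale N: abelian_subgroup N M
proof (rule abelian_subgroupI3)
  have "subgroup N (add_monoid M)"
  proof (rule M.add.subgroupI)
    show "N \<subseteq> carrier M" using sub_carrier by blast
    show "N \<noteq> {}" using LinearCombinations.submodule.zero_closed[OF sub] by blast
    show "\<ominus>\<^bsub>M\<^esub> x \<in> N" if "x \<in> N" for x by (rule sub_minus[OF that])
    show "x \<oplus>\<^bsub>M\<^esub> y \<in> N" if "x \<in> N" "y \<in> N" for x y
      by (rule LinearCombinations.submodule.m_closed[OF sub that])
  qed
  then show "additive_subgroup N M" by (rule additive_subgroup.intro)
qed (rule M.abelian_group_axioms)

lemma coset_eq_iff:
  assumes x: "x \<in> carrier M" and y: "y \<in> carrier M"
  shows "coset x = coset y \<longleftrightarrow> x \<ominus>\<^bsub>M\<^esub> y \<in> N"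
proof -
  have "coset x = coset y \<longleftrightarrow> x \<in> coset y"
    using N.a_repr_independence'[of x y] N.a_rcos_self[OF x] y by blast
  also have "\<dots> \<longleftrightarrow> x \<ominus>\<^bsub>M\<^esub> y \<in> N"
    using N.a_rcos_module[OF y x] by (simp add: M.minus_eq)
  finally show ?thesis .
qed

lemma coset_eqI: "x \<ominus>\<^bsub>M\<^esub> y \<in> N \<Longrightarrow> x \<in> carrier M \<Longrightarrow> y \<in> carrier M \<Longrightarrow> coset x = coset y"
  by (simp only: coset_eq_iff)

lemma quotient_simps:
  "\<zero>\<^bsub>Q\<^esub> = coset \<zero>\<^bsub>M\<^esub>"
  "x \<in> carrier M \<Longrightarrow> y \<in> carrier M \<Longrightarrow> coset x \<oplus>\<^bsub>Q\<^esub> coset y = coset (x \<oplus>\<^bsub>M\<^esub> y)"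
  "carrier Q = coset ` carrier M"
  using N.a_rcos_const[OF N.zero_closed] N.a_rcos_sum[of x y]
  by (auto simp: quotient_module_def A_RCOSETS_def' )

text \<open>The union that defines scalar multiplication runs over representatives; since
  \<open>N\<close> is closed under scalars, all of its members are the same coset.\<close>

lemma quotient_smult:
  assumes a: "a \<in> carrier R" and x: "x \<in> carrier M"
  shows "a \<odot>\<^bsub>Q\<^esub> coset x = coset (a \<odot>\<^bsub>M\<^esub> x)"
proof -
  have "coset (a \<odot>\<^bsub>M\<^esub> y) = coset (a \<odot>\<^bsub>M\<^esub> x)" if y: "y \<in> coset x" for y
  proof -
    have yM: "y \<in> carrier M" using N.a_elemrcos_carrier[OF x y] .
    have "y \<ominus>\<^bsub>M\<^esub> x \<in> N" using N.a_rcos_module[OF x yM] y by (simp add: M.minus_eq)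
    then have "a \<odot>\<^bsub>M\<^esub> (y \<ominus>\<^bsub>M\<^esub> x) \<in> N" using LinearCombinations.submodule.smult_closed[OF sub a] by blast
    also have "a \<odot>\<^bsub>M\<^esub> (y \<ominus>\<^bsub>M\<^esub> x) = a \<odot>\<^bsub>M\<^esub> y \<ominus>\<^bsub>M\<^esub> a \<odot>\<^bsub>M\<^esub> x"
      using a x yM by (simp add: M.minus_eq smult_r_distr smult_r_minus)
    finally show ?thesis using a x yM by (simp add: coset_eq_iff)
  qed
  moreover have "x \<in> coset x" using N.a_rcos_self x by blast
  ultimately have "(\<Union>y\<in>coset x. coset (a \<odot>\<^bsub>M\<^esub> y)) = coset (a \<odot>\<^bsub>M\<^esub> x)" by blast
  then show ?thesis by (simp add: quotient_module_def)
qed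

lemma quotient_module: "Module.module R Q"
proof (rule module_criteria)
  have Q: "\<exists>x\<in>carrier M. v = coset x" if "v \<in> carrier Q" for v
    using that unfolding quotient_simps(3) by blast
  note simps = quotient_simps(1,2) quotient_smult
  show "cring R" by (rule is_cring)
  show "\<zero>\<^bsub>Q\<^esub> \<in> carrier Q" unfolding quotient_simps(1,3) by blast
  show "\<forall>v w. v \<in> carrier Q \<and> w \<in> carrier Q \<longrightarrow> v \<oplus>\<^bsub>Q\<^esub> w \<in> carrier Q"
    by (auto simp: quotient_simps(3) simps(2))
  show "\<forall>v\<in>carrier Q. \<exists>w\<in>carrier Q. v \<oplus>\<^bsub>Q\<^esub> w = \<zero>\<^bsub>Q\<^esub>"
  proof
    fix v assume "v \<in> carrier Q"
    then obtain x where x: "x \<in> carrier M" "v = coset x" using Q by blast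
    have "coset (\<ominus>\<^bsub>M\<^esub> x) \<in> carrier Q" using x by (simp add: quotient_simps(3))
    then show "\<exists>w\<in>carrier Q. v \<oplus>\<^bsub>Q\<^esub> w = \<zero>\<^bsub>Q\<^esub>"
      using x by (intro bexI[of _ "coset (\<ominus>\<^bsub>M\<^esub> x)"]) (simp_all add: simps M.r_neg)
  qed
  show "\<forall>c v. c \<in> carrier R \<and> v \<in> carrier Q \<longrightarrow> c \<odot>\<^bsub>Q\<^esub> v \<in> carrier Q"
    by (auto simp: quotient_simps(3) quotient_smult)
  show "\<forall>v w. v \<in> carrier Q \<and> w \<in> carrier Q \<longrightarrow> v \<oplus>\<^bsub>Q\<^esub> w = w \<oplus>\<^bsub>Q\<^esub> v"
    by (auto dest!: Q simp: simps M.a_comm)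
  show "\<forall>v w x. v \<in> carrier Q \<and> w \<in> carrier Q \<and> x \<in> carrier Q \<longrightarrow> v \<oplus>\<^bsub>Q\<^esub> w \<oplus>\<^bsub>Q\<^esub> x = v \<oplus>\<^bsub>Q\<^esub> (w \<oplus>\<^bsub>Q\<^esub> x)"
    by (auto dest!: Q simp: simps M.a_assoc)
  show "\<forall>v\<in>carrier Q. v \<oplus>\<^bsub>Q\<^esub> \<zero>\<^bsub>Q\<^esub> = v"
    by (auto dest!: Q simp: simps)
  show "\<forall>a b v. a \<in> carrier R \<and> b \<in> carrier R \<and> v \<in> carrier Q \<longrightarrow> a \<otimes> b \<odot>\<^bsub>Q\<^esub> v = a \<odot>\<^bsub>Q\<^esub> (b \<odot>\<^bsub>Q\<^esub> v)"
    by (auto dest!: Q simp: simps smult_assoc1)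
  show "\<forall>v\<in>carrier Q. \<one> \<odot>\<^bsub>Q\<^esub> v = v"
    by (auto dest!: Q simp: simps)
  show "\<forall>a b v. a \<in> carrier R \<and> b \<in> carrier R \<and> v \<in> carrier Q \<longrightarrow> (a \<oplus> b) \<odot>\<^bsub>Q\<^esub> v = a \<odot>\<^bsub>Q\<^esub> v \<oplus>\<^bsub>Q\<^esub> b \<odot>\<^bsub>Q\<^esub> v"
    by (auto dest!: Q simp: simps smult_l_distr)
  show "\<forall>a v w. a \<in> carrier R \<and> v \<in> carrier Q \<and> w \<in> carrier Q \<longrightarrow> a \<odot>\<^bsub>Q\<^esub> (v \<oplus>\<^bsub>Q\<^esub> w) = a \<odot>\<^bsub>Q\<^esub> v \<oplus>\<^bsub>Q\<^esub> a \<odot>\<^bsub>Q\<^esub> w"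
    by (auto dest!: Q simp: simps smult_r_distr)
qed

end

subsection \<open>Maps out of modules over a factor ring\<close>

text \<open>For \<open>R = S / I\<close> and an \<open>S\<close>-submodule \<open>Z\<close> of \<open>S\<^sup>3\<close> with \<open>I S\<^sup>3 \<subseteq> Z\<close>, the \<open>R\<close>-linear maps into
  \<open>S\<^sup>3 / Z\<close> are represented by their lifts to \<open>S\<^sup>3\<close>, which are linear modulo \<open>Z\<close>.\<close>

locale factor_ring =
  fixes I :: "'a::comm_ring_1 set"
  assumes ideal_I: "ideal I class_ring"
begin

abbreviation R where "R \<equiv> class_ring Quot I"
abbreviation proj where "proj s \<equiv> I +>\<^bsub>class_ring\<^esub> s"

lemma cring_R: "cring R"
  by (rule ideal.quotient_is_cring[OF ideal_I]) (rule class_cring.cring_axioms)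

sublocale R: cring R by (rule cring_R)

lemma proj_eq_iff: "proj s = proj t \<longleftrightarrow> s - t \<in> I"
  using ring.quotient_eq_iff_same_a_r_cos[OF class_ring.ring_axioms ideal_I, of s t]
  by (simp add: class_ring_simps eq_commute)

lemma proj_hom:
  "carrier R = range proj" "\<zero>\<^bsub>R\<^esub> = proj 0" "\<one>\<^bsub>R\<^esub> = proj 1"
  "proj s \<oplus>\<^bsub>R\<^esub> proj t = proj (s + t)" "proj s \<otimes>\<^bsub>R\<^esub> proj t = proj (s * t)"
  "proj s \<in> carrier R" "\<ominus>\<^bsub>R\<^esub> proj s = proj (- s)"
proof -
  interpret h: ring_hom_cring class_ring R proj
    by (rule ideal.rcos_ring_hom_cring[OF ideal_I class_cring.cring_axioms])
  show "carrier R = range proj"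
    by (auto simp: FactRing_def A_RCOSETS_def')
  show "\<zero>\<^bsub>R\<^esub> = proj 0" "\<one>\<^bsub>R\<^esub> = proj 1"
    using h.hom_zero h.hom_one by simp_all
  show "proj s \<oplus>\<^bsub>R\<^esub> proj t = proj (s + t)" "proj s \<otimes>\<^bsub>R\<^esub> proj t = proj (s * t)" "proj s \<in> carrier R"
    using h.hom_add[of s t] h.hom_mult[of s t] h.hom_closed[of s] by simp_all
  show "\<ominus>\<^bsub>R\<^esub> proj s = proj (- s)"
    using h.hom_a_inv[of s] by (simp add: class_ring_simps)
qed

text \<open>A choice of preimages, compatible with the ring operations only modulo \<open>I\<close>.
  This is why maps built from it are linear only modulo \<open>Z\<close>.\<close>

definition rep :: "'a set \<Rightarrow> 'a" where "rep r = (SOME s. proj s = r)"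

lemma proj_rep: "r \<in> carrier R \<Longrightarrow> proj (rep r) = r"
  unfolding rep_def by (rule someI_ex) (auto simp: proj_hom(1))

lemma rep_proj: "rep (proj s) - s \<in> I"
  using proj_rep[OF proj_hom(6)] proj_eq_iff by blast

text \<open>The map S^3 -> M that sends the unit vectors to \<open>x 0\<close>, \<open>x 1\<close>,
  \<open>x 2\<close>, with coefficients kept in S and reduced modulo \<open>I\<close> on use. Both
  \<open>omega\<close> and \<open>psi\<close> have this form.\<close>

definition comb :: "('a set, 'm, 'n) module_scheme \<Rightarrow> (3 \<Rightarrow> 'm) \<Rightarrow> 'a ^ 3 \<Rightarrow> 'm" where
  "comb M x u = proj (u $ 0) \<odot>\<^bsub>M\<^esub> x 0 \<oplus>\<^bsub>M\<^esub> proj (u $ 1) \<odot>\<^bsub>M\<^esub> x 1 \<oplus>\<^bsub>M\<^esub> proj (u $ 2) \<odot>\<^bsub>M\<^esub> x 2"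

context
  fixes M :: "('a set, 'm, 'n) module_scheme" and x :: "3 \<Rightarrow> 'm"
  assumes M: "Module.module R M" and x: "\<And>i. x i \<in> carrier M"
begin

interpretation M: Module.module R M by (rule M)

lemma comb_summand: "proj s \<odot>\<^bsub>M\<^esub> x i \<in> carrier M"
  by (rule M.smult_closed[OF proj_hom(6) x])

lemma comb_closed: "comb M x u \<in> carrier M"
  unfolding comb_def by (intro M.M.a_closed comb_summand)

lemma comb_add: "comb M x (u + v) = comb M x u \<oplus>\<^bsub>M\<^esub> comb M x v"
proof -
  have interchange: "(a \<oplus>\<^bsub>M\<^esub> b) \<oplus>\<^bsub>M\<^esub> (c \<oplus>\<^bsub>M\<^esub> d) \<oplus>\<^bsub>M\<^esub> (e \<oplus>\<^bsub>M\<^esub> f) = (a \<oplus>\<^bsub>M\<^esub> c \<oplus>\<^bsub>M\<^esub> e) \<oplus>\<^bsub>M\<^esub> (b \<oplus>\<^bsub>M\<^esub> d \<oplus>\<^bsub>M\<^esub> f)"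
    if "a \<in> carrier M" "b \<in> carrier M" "c \<in> carrier M" "d \<in> carrier M" "e \<in> carrier M" "f \<in> carrier M" for a b c d e f
    using that by (simp only: M.M.a_ac M.M.a_closed)
  show ?thesis
    unfolding comb_def vector_add_component proj_hom(4)[symmetric] M.smult_l_distr[OF proj_hom(6) proj_hom(6) x]
    by (rule interchange; rule comb_summand)
qed

lemma comb_smult: "comb M x (s *s u) = proj s \<odot>\<^bsub>M\<^esub> comb M x u"
  unfolding comb_def vector_smult_component proj_hom(5)[symmetric] M.smult_assoc1[OF proj_hom(6) proj_hom(6) x]
    M.smult_r_distr[OF proj_hom(6) M.M.a_closed[OF comb_summand comb_summand] comb_summand]
    M.smult_r_distr[OF proj_hom(6) comb_summand comb_summand] ..

lemma comb_I:
  fixes u :: "'a ^ 3"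
  assumes "\<And>i. u $ i \<in> I"
  shows "comb M x u = \<zero>\<^bsub>M\<^esub>"
proof -
  have "proj (u $ i) = \<zero>\<^bsub>R\<^esub>" for i
    unfolding proj_hom(2) proj_eq_iff using assms[of i] by simp
  then show ?thesis
    unfolding comb_def by (simp only: M.smult_l_null[OF x] M.M.l_zero[OF M.M.zero_closed])
qed

lemma comb_zero: "comb M x 0 = \<zero>\<^bsub>M\<^esub>"
  using ideal_I by (intro comb_I) (simp add: additive_subgroup.zero_closed[OF ideal.axioms(1), of I class_ring, simplified])

lemma comb_axis: "comb M x (axis i 1) = x i"
proof -
  have 0: "proj 0 \<odot>\<^bsub>M\<^esub> x j = \<zero>\<^bsub>M\<^esub>" and 1: "proj 1 \<odot>\<^bsub>M\<^esub> x j = x j" for j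
    unfolding proj_hom(2,3)[symmetric] by (rule M.smult_l_null[OF x], rule M.smult_one[OF x])
  have "i = 0 \<or> i = 1 \<or> i = 2" using UNIV_3_0 by auto
  then show ?thesis
    by (elim disjE) (simp_all only: comb_def axis_def vec_lambda_beta three_distinct if_True if_False simp_thms 0 1 M.M.l_zero[OF x]
        M.M.r_zero[OF x] M.M.l_zero[OF M.M.zero_closed])
qed

lemma comb_uminus: "inv\<^bsub>add_monoid M\<^esub> comb M x u = comb M x (- u)"
proof -
  have "proj (- 1) = \<ominus>\<^bsub>R\<^esub> \<one>\<^bsub>R\<^esub>" unfolding proj_hom(3,7) ..
  then have "comb M x (- u) = \<ominus>\<^bsub>M\<^esub> comb M x u"
    unfolding vector_sneg_minus1[of u] comb_smult using M.smult_minus_1[OF comb_closed] by simp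
  then show ?thesis unfolding a_inv_def ..
qed

end

end

locale lifted_maps = factor_ring I for I :: "'a::comm_ring_1 set" +
  fixes Z :: "('a ^ 3) set"
  assumes Z_zero [simp]: "0 \<in> Z" and Z_add: "x \<in> Z \<Longrightarrow> y \<in> Z \<Longrightarrow> x + y \<in> Z"
    and Z_smult: "x \<in> Z \<Longrightarrow> s *s x \<in> Z" and I_smult: "s \<in> I \<Longrightarrow> s *s w \<in> Z"
begin

lemma Z_uminus: "x \<in> Z \<Longrightarrow> - x \<in> Z"
  using Z_smult[of x "- 1"] by (simp add: vector_sneg_minus1[symmetric])

lemma Z_diff: "x \<in> Z \<Longrightarrow> y \<in> Z \<Longrightarrow> x - y \<in> Z"
  using Z_add[of x "- y"] Z_uminus by simp

lemma Z_trans: "x - y \<in> Z \<Longrightarrow> y - z \<in> Z \<Longrightarrow> x - z \<in> Z"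
  using Z_add[of "x - y" "y - z"] by simp

lemma Z_sum: "(\<And>i. i \<in> A \<Longrightarrow> f i \<in> Z) \<Longrightarrow> sum f A \<in> Z"
  by (induction A rule: infinite_finite_induct) (auto intro: Z_add)

lemma smult_sum: "s *s sum f A = (\<Sum>i\<in>A. s *s (f i :: 'a ^ 3))"
  by (induction A rule: infinite_finite_induct) (auto simp: vector_add_ldistrib)

text \<open>\<open>L\<close> itself need not be additive: it selects representatives of an R-linear
  map into S^3 / Z. Scalars may come from S because \<open>Z\<close> contains all multiples by
  elements of \<open>I\<close>.\<close>

definition lin_mod :: "('a set, 'm, 'n) module_scheme \<Rightarrow> ('m \<Rightarrow> 'a ^ 3) \<Rightarrow> bool" where
  "lin_mod M L \<longleftrightarrow>
     (\<forall>x\<in>carrier M. \<forall>y\<in>carrier M. L (x \<oplus>\<^bsub>M\<^esub> y) - (L x + L y) \<in> Z) \<and>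
     (\<forall>s. \<forall>x\<in>carrier M. L (proj s \<odot>\<^bsub>M\<^esub> x) - s *s L x \<in> Z)"

lemma lin_mod_add: "lin_mod M L \<Longrightarrow> x \<in> carrier M \<Longrightarrow> y \<in> carrier M \<Longrightarrow> L (x \<oplus>\<^bsub>M\<^esub> y) - (L x + L y) \<in> Z"
  by (simp add: lin_mod_def)

lemma lin_mod_smult: "lin_mod M L \<Longrightarrow> x \<in> carrier M \<Longrightarrow> L (proj s \<odot>\<^bsub>M\<^esub> x) - s *s L x \<in> Z"
  by (simp add: lin_mod_def)

lemma lin_mod_minus:
  assumes M: "Module.module R M" and L: "lin_mod M L" and x: "x \<in> carrier M" and y: "y \<in> carrier M"
  shows "L (x \<ominus>\<^bsub>M\<^esub> y) - (L x - L y) \<in> Z"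
proof -
  interpret M: Module.module R M by fact
  have "\<ominus>\<^bsub>M\<^esub> y = proj (- 1) \<odot>\<^bsub>M\<^esub> y"
    using M.smult_minus_1[OF y] by (simp add: proj_hom)
  then have 1: "L (\<ominus>\<^bsub>M\<^esub> y) - (- 1) *s L y \<in> Z" using lin_mod_smult[OF L y] by simp
  have "L (x \<ominus>\<^bsub>M\<^esub> y) - (L x + L (\<ominus>\<^bsub>M\<^esub> y)) \<in> Z"
    unfolding M.M.minus_eq using x y by (intro lin_mod_add L) auto
  moreover have "L (x \<ominus>\<^bsub>M\<^esub> y) - (L x - L y)
      = (L (x \<ominus>\<^bsub>M\<^esub> y) - (L x + L (\<ominus>\<^bsub>M\<^esub> y))) + (L (\<ominus>\<^bsub>M\<^esub> y) - (- 1) *s L y)"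
    by (simp add: vector_sneg_minus1[symmetric])
  ultimately show ?thesis using 1 by (simp only: Z_add)
qed

lemma lin_mod_zero: "Module.module R M \<Longrightarrow> lin_mod M L \<Longrightarrow> L \<zero>\<^bsub>M\<^esub> \<in> Z"
proof -
  assume M: "Module.module R M" and L: "lin_mod M L"
  interpret M: Module.module R M by fact
  have "L (\<zero>\<^bsub>M\<^esub> \<ominus>\<^bsub>M\<^esub> \<zero>\<^bsub>M\<^esub>) - (L \<zero>\<^bsub>M\<^esub> - L \<zero>\<^bsub>M\<^esub>) \<in> Z" by (intro lin_mod_minus M L) auto
  then show ?thesis unfolding M.M.minus_eq M.M.r_neg[OF M.M.zero_closed] by simp
qed

text \<open>The elements that \<open>L\<close> sends into \<open>Z\<close> form a submodule, so
  testing generators is enough.\<close>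

lemma lin_mod_span:
  assumes M: "Module.module R M" and L: "lin_mod M L" and S: "S \<subseteq> carrier M" "\<And>r. r \<in> S \<Longrightarrow> L r \<in> Z"
    and x: "x \<in> LinearCombinations.module.span R M S"
  shows "L x \<in> Z"
proof -
  interpret M: Module.module R M by fact
  have "LinearCombinations.submodule R {x \<in> carrier M. L x \<in> Z} M"
  proof (rule LinearCombinations.submodule.intro)
    fix v w assume v: "v \<in> {x \<in> carrier M. L x \<in> Z}"
    {
      assume w: "w \<in> {x \<in> carrier M. L x \<in> Z}"
      then show "v \<oplus>\<^bsub>M\<^esub> w \<in> {x \<in> carrier M. L x \<in> Z}"
        using v Z_add[OF lin_mod_add[OF L, of v w] Z_add[of "L v" "L w"]] by auto
    }
    fix c assume "c \<in> carrier R"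
    then obtain s where "c = proj s" by (auto simp: proj_hom(1))
    then show "c \<odot>\<^bsub>M\<^esub> v \<in> {x \<in> carrier M. L x \<in> Z}"
      using v Z_add[OF lin_mod_smult[OF L, of v s] Z_smult[of "L v" s]] by (auto simp: proj_hom)
  qed (use M L lin_mod_zero in auto)
  from M.span_is_subset[OF _ this, of S] S x show ?thesis by auto
qed

lemma lin_mod_comb:
  assumes M: "Module.module R M" and L: "lin_mod M L" and x: "\<And>i. x i \<in> carrier M"
  shows "L (comb M x u) - (u $ 0 *s L (x 0) + u $ 1 *s L (x 1) + u $ 2 *s L (x 2)) \<in> Z"
proof -
  interpret M: Module.module R M by fact
  let ?y = "\<lambda>i. proj (u $ i) \<odot>\<^bsub>M\<^esub> x i"
  note c = comb_summand[OF M x]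
  have s: "L (?y i) - u $ i *s L (x i) \<in> Z" for i by (rule lin_mod_smult[OF L x])
  have a: "L (?y 0 \<oplus>\<^bsub>M\<^esub> ?y 1 \<oplus>\<^bsub>M\<^esub> ?y 2) - (L (?y 0 \<oplus>\<^bsub>M\<^esub> ?y 1) + L (?y 2)) \<in> Z"
    "L (?y 0 \<oplus>\<^bsub>M\<^esub> ?y 1) - (L (?y 0) + L (?y 1)) \<in> Z"
    by (rule lin_mod_add[OF L M.M.a_closed[OF c c] c], rule lin_mod_add[OF L c c])
  have split: "A - (a' + b' + c') \<in> Z"
    if "A - (B + c) \<in> Z" "B - (a + b) \<in> Z" "a - a' \<in> Z" "b - b' \<in> Z" "c - c' \<in> Z"
    for A B a b c a' b' c' :: "'a ^ 3"
  proof -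
    have "A - (a' + b' + c') = (A - (B + c)) + (B - (a + b)) + ((a - a') + (b - b') + (c - c'))" by simp
    then show ?thesis using Z_add[OF Z_add[OF that(1,2)] Z_add[OF Z_add[OF that(3,4)] that(5)]] by (simp only:)
  qed
  show ?thesis unfolding comb_def by (rule split[OF a s s s])
qed

text \<open>The universal property of the free module, in terms of lifts: the coefficients are
  replaced by representatives in S.\<close>

lemma free_module_lift:
  fixes g :: "'b \<Rightarrow> 'a ^ 3"
  obtains L where "lin_mod (free_module R B) L" "\<And>b. b \<in> B \<Longrightarrow> L (free_gen R b) - g b \<in> Z"
proof -
  let ?F = "free_module R B"
  define L where "L F = (\<Sum>b\<in>{b. F b \<noteq> \<zero>\<^bsub>R\<^esub>}. rep (F b) *s g b)" for F
  have rep0: "rep \<zero>\<^bsub>R\<^esub> \<in> I" using rep_proj[of 0] by (simp add: proj_hom)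
  \<comment> \<open>The representative of zero lies in \<open>I\<close> but may be nonzero. A larger
    range of summation changes the sum by an element of \<open>Z\<close> only, so two arguments can
    share one range.\<close>
  have L: "L F - (\<Sum>b\<in>T. rep (F b) *s g b) \<in> Z" if T: "finite T" "{b. F b \<noteq> \<zero>\<^bsub>R\<^esub>} \<subseteq> T" for F T
  proof -
    let ?S = "{b. F b \<noteq> \<zero>\<^bsub>R\<^esub>}"
    have "(\<Sum>b\<in>T. rep (F b) *s g b) = L F + (\<Sum>b\<in>T - ?S. rep (F b) *s g b)"
      unfolding L_def by (subst sum.subset_diff[OF T(2,1)]) (rule add.commute)
    then have "L F - (\<Sum>b\<in>T. rep (F b) *s g b) = - (\<Sum>b\<in>T - ?S. rep (F b) *s g b)" by simp
    also have "\<dots> \<in> Z" using rep0 by (intro Z_uminus Z_sum I_smult) auto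
    finally show ?thesis .
  qed
  have mem: "F b \<in> carrier R" if "F \<in> carrier ?F" for F b
    using free_module_mem[OF that R.zero_closed] .
  have "lin_mod ?F L"
    unfolding lin_mod_def
  proof (intro conjI ballI allI)
    fix F G assume F: "F \<in> carrier ?F" and G: "G \<in> carrier ?F"
    let ?T = "{b. F b \<noteq> \<zero>\<^bsub>R\<^esub>} \<union> {b. G b \<noteq> \<zero>\<^bsub>R\<^esub>}"
    let ?s = "\<lambda>F. \<Sum>b\<in>?T. rep (F b) *s g b"
    have fin: "finite ?T" using F G by simp
    have "?s (\<lambda>b. F b \<oplus>\<^bsub>R\<^esub> G b) - (?s F + ?s G)
        = (\<Sum>b\<in>?T. (rep (F b \<oplus>\<^bsub>R\<^esub> G b) - (rep (F b) + rep (G b))) *s g b)"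
      by (simp add: sum.distrib sum_subtractf vector_sub_rdistrib vector_sadd_rdistrib)
    also have "\<dots> \<in> Z"
    proof (intro Z_sum I_smult)
      fix b
      have "proj (rep (F b \<oplus>\<^bsub>R\<^esub> G b)) = proj (rep (F b) + rep (G b))"
        using mem[OF F, of b] mem[OF G, of b] by (simp add: proj_rep proj_hom(4)[symmetric] del: free_module_simps)
      then show "rep (F b \<oplus>\<^bsub>R\<^esub> G b) - (rep (F b) + rep (G b)) \<in> I" by (simp add: proj_eq_iff)
    qed
    finally have a: "?s (\<lambda>b. F b \<oplus>\<^bsub>R\<^esub> G b) - (?s F + ?s G) \<in> Z" .
    have "F b \<oplus>\<^bsub>R\<^esub> G b = \<zero>\<^bsub>R\<^esub>" if "F b = \<zero>\<^bsub>R\<^esub>" "G b = \<zero>\<^bsub>R\<^esub>" for b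
      unfolding that by (rule R.r_zero[OF R.zero_closed])
    then have b: "L (\<lambda>b. F b \<oplus>\<^bsub>R\<^esub> G b) - ?s (\<lambda>b. F b \<oplus>\<^bsub>R\<^esub> G b) \<in> Z"
      by (intro L[OF fin]) blast
    have c: "?s F - L F \<in> Z" "?s G - L G \<in> Z"
      using Z_uminus[OF L[OF fin Un_upper1]] Z_uminus[OF L[OF fin Un_upper2]] unfolding minus_diff_eq .
    have "L (\<lambda>b. F b \<oplus>\<^bsub>R\<^esub> G b) - (L F + L G)
      = (L (\<lambda>b. F b \<oplus>\<^bsub>R\<^esub> G b) - ?s (\<lambda>b. F b \<oplus>\<^bsub>R\<^esub> G b)) + (?s (\<lambda>b. F b \<oplus>\<^bsub>R\<^esub> G b) - (?s F + ?s G)) + ((?s F - L F) + (?s G - L G))"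
      by simp
    also have "\<dots> \<in> Z" by (intro Z_add a b c)
    finally show "L (F \<oplus>\<^bsub>?F\<^esub> G) - (L F + L G) \<in> Z" by simp
  next
    fix s F assume F: "F \<in> carrier ?F"
    let ?T = "{b. F b \<noteq> \<zero>\<^bsub>R\<^esub>}"
    let ?s = "\<lambda>F. \<Sum>b\<in>?T. rep (F b) *s g b"
    have fin: "finite ?T" using F by simp
    have "?s (\<lambda>b. proj s \<otimes>\<^bsub>R\<^esub> F b) - s *s L F = (\<Sum>b\<in>?T. (rep (proj s \<otimes>\<^bsub>R\<^esub> F b) - s * rep (F b)) *s g b)"
      unfolding L_def vector_sub_rdistrib sum_subtractf smult_sum vector_smult_assoc ..
    also have "\<dots> \<in> Z"
    proof (intro Z_sum I_smult)
      fix b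
      have "proj (rep (proj s \<otimes>\<^bsub>R\<^esub> F b)) = proj s \<otimes>\<^bsub>R\<^esub> F b"
        by (rule proj_rep[OF R.m_closed[OF proj_hom(6) mem[OF F]]])
      also have "\<dots> = proj s \<otimes>\<^bsub>R\<^esub> proj (rep (F b))" by (simp only: proj_rep[OF mem[OF F]])
      finally have "proj (rep (proj s \<otimes>\<^bsub>R\<^esub> F b)) = proj (s * rep (F b))" by (simp only: proj_hom(5))
      then show "rep (proj s \<otimes>\<^bsub>R\<^esub> F b) - s * rep (F b) \<in> I" by (simp add: proj_eq_iff)
    qed
    finally have 1: "?s (\<lambda>b. proj s \<otimes>\<^bsub>R\<^esub> F b) - s *s L F \<in> Z" .
    have "proj s \<otimes>\<^bsub>R\<^esub> F b = \<zero>\<^bsub>R\<^esub>" if "F b = \<zero>\<^bsub>R\<^esub>" for b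
      unfolding that by (rule R.r_null[OF proj_hom(6)])
    then have "L (\<lambda>b. proj s \<otimes>\<^bsub>R\<^esub> F b) - ?s (\<lambda>b. proj s \<otimes>\<^bsub>R\<^esub> F b) \<in> Z"
      by (intro L[OF fin]) blast
    from Z_trans[OF this 1] show "L (proj s \<odot>\<^bsub>?F\<^esub> F) - s *s L F \<in> Z" by simp
  qed
  moreover have "L (free_gen R b) - g b \<in> Z" if "b \<in> B" for b
  proof -
    have 1: "L (free_gen R b) - (\<Sum>c\<in>{b}. rep (free_gen R b c) *s g c) \<in> Z"
      by (rule L) (auto simp: free_gen_def)
    have "(\<Sum>c\<in>{b}. rep (free_gen R b c) *s g c) - g b = (rep \<one>\<^bsub>R\<^esub> - 1) *s g b"
      unfolding vector_sub_rdistrib by (simp add: free_gen_def)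
    also have "\<dots> \<in> Z" using rep_proj[of 1] unfolding proj_hom(3) by (rule I_smult)
    finally show ?thesis by (rule Z_trans[OF 1])
  qed
  ultimately show thesis by (rule that)
qed

text \<open>The universal property of the quotient, in terms of lifts: two representatives of a
  coset differ by an element of the span, which \<open>L\<close> sends into
  \<open>Z\<close>.\<close>

lemma quotient_lift:
  assumes M: "Module.module R M" and L: "lin_mod M L" and S: "S \<subseteq> carrier M" "\<And>r. r \<in> S \<Longrightarrow> L r \<in> Z"
  defines "N \<equiv> LinearCombinations.module.span R M S"
  obtains L' where "lin_mod (quotient_module M N) L'" "\<And>x. x \<in> carrier M \<Longrightarrow> L' (N +>\<^bsub>M\<^esub> x) - L x \<in> Z"
proof -
  interpret M: Module.module R M by fact
  interpret module_quotient R M N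
    unfolding N_def
    by (rule module_quotient.intro[OF M module_quotient_axioms.intro[OF M.span_is_submodule[OF S(1)]]])
  define L' where "L' A = L (SOME x. x \<in> carrier M \<and> A = coset x)" for A
  have L': "L' (coset x) - L x \<in> Z" if x: "x \<in> carrier M" for x
  proof -
    define y where "y = (SOME y. y \<in> carrier M \<and> coset x = coset y)"
    have y: "y \<in> carrier M" "coset x = coset y"
      using someI_ex[of "\<lambda>y. y \<in> carrier M \<and> coset x = coset y"] x unfolding y_def by blast+
    then have "y \<ominus>\<^bsub>M\<^esub> x \<in> N" using coset_eq_iff x by metis
    then have "L (y \<ominus>\<^bsub>M\<^esub> x) \<in> Z" unfolding N_def using lin_mod_span[OF M L S] by blast
    from Z_diff[OF this lin_mod_minus[OF M L y(1) x]] have "L y - L x \<in> Z" by simp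
    then show ?thesis unfolding L'_def y_def .
  qed
  have split: "a - b = (a - c) + (c - d) - (b - d)" for a b c d :: "'a ^ 3" by simp
  have "lin_mod Q L'"
    unfolding lin_mod_def
  proof (intro conjI ballI allI)
    fix A B assume "A \<in> carrier Q" "B \<in> carrier Q"
    then obtain x y where x: "x \<in> carrier M" "A = coset x" and y: "y \<in> carrier M" "B = coset y"
      by (auto simp: quotient_simps(3))
    have "L' (A \<oplus>\<^bsub>Q\<^esub> B) - (L' A + L' B) = (L' (coset (x \<oplus>\<^bsub>M\<^esub> y)) - L (x \<oplus>\<^bsub>M\<^esub> y)) + (L (x \<oplus>\<^bsub>M\<^esub> y) - (L x + L y)) - ((L' (coset x) - L x) + (L' (coset y) - L y))"
      using x y by (simp add: quotient_simps(2))
    also have "\<dots> \<in> Z"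
      by (rule Z_diff[OF Z_add[OF L' lin_mod_add[OF L x(1) y(1)]] Z_add[OF L'[OF x(1)] L'[OF y(1)]]])
         (use x y in simp)
    finally show "L' (A \<oplus>\<^bsub>Q\<^esub> B) - (L' A + L' B) \<in> Z" .
  next
    fix s A assume "A \<in> carrier Q"
    then obtain x where x: "x \<in> carrier M" "A = coset x" by (auto simp: quotient_simps(3))
    have 1: "L' (coset (proj s \<odot>\<^bsub>M\<^esub> x)) - L (proj s \<odot>\<^bsub>M\<^esub> x) \<in> Z"
      by (rule L'[OF M.smult_closed[OF proj_hom(6) x(1)]])
    have 2: "L (proj s \<odot>\<^bsub>M\<^esub> x) - s *s L x \<in> Z"
      by (rule lin_mod_smult[OF L x(1)])
    have 3: "s *s L' (coset x) - s *s L x \<in> Z"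
      using Z_smult[OF L'[OF x(1)]] unfolding vector_ssub_ldistrib .
    show "L' (proj s \<odot>\<^bsub>Q\<^esub> A) - s *s L' A \<in> Z"
      unfolding x(2) quotient_smult[OF proj_hom(6) x(1)]
      by (subst split) (rule Z_diff[OF Z_add[OF 1 2] 3])
  qed
  then show thesis using that L' by blast
qed

end

subsection \<open>Vector calculus\<close>

text \<open>A 1-form \<open>\<Sum> u\<^sub>i dX\<^sub>i\<close> and a 2-form \<open>u\<^sub>0 dX\<^sub>1 \<and> dX\<^sub>2 + u\<^sub>1 dX\<^sub>2 \<and> dX\<^sub>0 + u\<^sub>2 dX\<^sub>0 \<and> dX\<^sub>1\<close> are both
  given by the vector \<open>u\<close>; the exterior product becomes the cross product, the differential of a
  1-form the curl, that of a 2-form the divergence.\<close>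

definition vec3 :: "'a \<Rightarrow> 'a \<Rightarrow> 'a \<Rightarrow> 'a ^ 3" where
  "vec3 a b c = (\<chi> i. if i = 0 then a else if i = 1 then b else c)"

lemma vec3_nth [simp]: "vec3 a b c $ 0 = a" "vec3 a b c $ 1 = b" "vec3 a b c $ 2 = c"
  by (simp_all add: vec3_def)

lemma vec3_eq_iff: "u = v \<longleftrightarrow> u $ 0 = v $ 0 \<and> u $ 1 = v $ 1 \<and> u $ 2 = v $ 2" for u v :: "'a ^ 3"
  by (simp add: vec_eq_iff all_3_0)

definition cross :: "'a::comm_ring_1 ^ 3 \<Rightarrow> 'a ^ 3 \<Rightarrow> 'a ^ 3" where
  "cross u v = vec3 (u $ 1 * v $ 2 - u $ 2 * v $ 1) (u $ 2 * v $ 0 - u $ 0 * v $ 2) (u $ 0 * v $ 1 - u $ 1 * v $ 0)"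

lemma cross_linear:
  "cross (u + v) w = cross u w + cross v w" "cross u (v + w) = cross u v + cross u w"
  "cross (s *s u) v = s *s cross u v" "cross u (s *s v) = s *s cross u v"
  "cross (u - v) w = cross u w - cross v w" "cross u (v - w) = cross u v - cross u w"
  "cross u u = 0"
  by (simp_all add: vec3_eq_iff cross_def algebra_simps)

definition grad :: "'k::field poly3 \<Rightarrow> 'k poly3 ^ 3" where
  "grad f = vec3 (pderiv3 0 f) (pderiv3 1 f) (pderiv3 2 f)"

definition curl :: "'k::field poly3 ^ 3 \<Rightarrow> 'k poly3 ^ 3" where
  "curl u = vec3 (pderiv3 1 (u $ 2) - pderiv3 2 (u $ 1)) (pderiv3 2 (u $ 0) - pderiv3 0 (u $ 2))
     (pderiv3 0 (u $ 1) - pderiv3 1 (u $ 0))"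

lemma grad_simps:
  "grad (f + g) = grad f + grad g" "grad (f - g) = grad f - grad g"
  "grad (f * g) = f *s grad g + g *s grad f" "grad (Const3 c) = 0"
  by (simp_all add: grad_def vec3_eq_iff pderiv3_add pderiv3_diff pderiv3_mult)

lemma grad_Var: "grad (Var3 i) = axis i 1"
proof -
  have "\<forall>i. grad (Var3 i :: 'a poly3) = axis i 1"
    by (simp add: all_3_0 grad_def vec3_eq_iff pderiv3_Var axis_def)
  then show ?thesis by blast
qed

lemma curl_simps:
  "curl (u + v) = curl u + curl v" "curl (s *s u) = cross (grad s) u + s *s curl u" "curl (grad f) = 0"
  by (simp_all add: curl_def grad_def cross_def vec3_eq_iff pderiv3_add pderiv3_mult algebra_simps
      pderiv3_commute[of 0 1] pderiv3_commute[of 0 2] pderiv3_commute[of 1 2])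

text \<open>Leibniz rules for d on 2-forms; the last one is d(alpha wedge beta) = d alpha wedge beta
  - alpha wedge d beta for 1-forms.\<close>

lemma divg_simps:
  "divg (u + v) = divg u + divg v"
  "divg (s *s u) = grad s $ 0 * u $ 0 + grad s $ 1 * u $ 1 + grad s $ 2 * u $ 2 + s * divg u"
  "divg (cross u v) = (curl u $ 0 * v $ 0 + curl u $ 1 * v $ 1 + curl u $ 2 * v $ 2)
     - (u $ 0 * curl v $ 0 + u $ 1 * curl v $ 1 + u $ 2 * curl v $ 2)"
  by (simp_all add: divg_def curl_def grad_def cross_def pderiv3_add pderiv3_diff pderiv3_mult algebra_simps)

lemma vec3_expand: "u = u $ 0 *s axis 0 1 + u $ 1 *s axis 1 1 + u $ 2 *s axis 2 1" for u :: "'a::comm_ring_1 ^ 3"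
  by (simp add: vec3_eq_iff axis_def)

lemma vec3_induct [case_names axis add smult]:
  fixes u :: "'a::comm_ring_1 ^ 3"
  assumes "\<And>i. P (axis i 1)" "\<And>u v. P u \<Longrightarrow> P v \<Longrightarrow> P (u + v)" "\<And>s u. P u \<Longrightarrow> P (s *s u)"
  shows "P u"
proof -
  have "P (u $ 0 *s axis 0 1 + u $ 1 *s axis 1 1 + u $ 2 *s axis 2 1)"
    by (rule assms(2)[OF assms(2)[OF assms(3)[OF assms(1)] assms(3)[OF assms(1)]] assms(3)[OF assms(1)]])
  then show ?thesis unfolding vec3_expand[symmetric] .
qed

subsection \<open>Kaehler differentials of a factor ring of \<open>K[X\<^sub>0, X\<^sub>1, X\<^sub>2]\<close>\<close>

text \<open>The intended pair is I = J_{k+1} and J = J_k. The computation with generators and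
  relations sees points and orders only through these assumptions.\<close>

locale differential_ideals = factor_ring I for I :: "'k::field poly3 set" +
  fixes J :: "'k poly3 set"
  assumes ideal_J: "ideal J class_ring" and I_J: "I \<subseteq> J" and deriv_I: "f \<in> I \<Longrightarrow> pderiv3 i f \<in> J"
begin

lemma J_zero: "0 \<in> J" and J_add: "f \<in> J \<Longrightarrow> g \<in> J \<Longrightarrow> f + g \<in> J" and J_mult: "f \<in> J \<Longrightarrow> h * f \<in> J"
  using ideal_J unfolding class_ring_ideal_iff by blast+

lemma J_mult': "f \<in> J \<Longrightarrow> f * h \<in> J"
  using J_mult[of f h] by (simp add: mult.commute)

lemma J_diff: "f \<in> J \<Longrightarrow> g \<in> J \<Longrightarrow> f - g \<in> J"
  using J_add[of f "- 1 * g"] J_mult[of g "- 1"] by simp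

text \<open>The curl is included because the differential of alpha wedge beta involves d alpha: with
  it, the product of an element of \<open>Z1\<close> and any 1-form lies in
  \<open>Z2\<close>.\<close>

definition Z1 :: "('k poly3 ^ 3) set" where
  "Z1 = {u. (\<forall>i. u $ i \<in> J) \<and> (\<forall>i. curl u $ i \<in> J)}"

definition Z2 :: "('k poly3 ^ 3) set" where
  "Z2 = {u. (\<forall>i. u $ i \<in> J) \<and> divg u \<in> J}"

lemma cross_J: "(\<And>i. u $ i \<in> J) \<Longrightarrow> cross u v $ i \<in> J" "(\<And>i. v $ i \<in> J) \<Longrightarrow> cross u v $ i \<in> J"
proof -
  have "\<forall>i. cross u v $ i \<in> J" if "\<And>i. u $ i \<in> J"
    using that by (simp add: all_3_0 cross_def J_diff J_mult J_mult')
  then show "(\<And>i. u $ i \<in> J) \<Longrightarrow> cross u v $ i \<in> J" by blast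
  have "\<forall>i. cross u v $ i \<in> J" if "\<And>i. v $ i \<in> J"
    using that by (simp add: all_3_0 cross_def J_diff J_mult J_mult')
  then show "(\<And>i. v $ i \<in> J) \<Longrightarrow> cross u v $ i \<in> J" by blast
qed

sublocale L1: lifted_maps I Z1
proof
  show "0 \<in> Z1" by (simp add: Z1_def curl_def all_3_0 J_zero)
  show "x + y \<in> Z1" if "x \<in> Z1" "y \<in> Z1" for x y
    using that by (simp add: Z1_def curl_simps J_add)
  show "s *s x \<in> Z1" if "x \<in> Z1" for s x
    using that by (simp add: Z1_def curl_simps J_add J_mult cross_J)
  show "s *s w \<in> Z1" if "s \<in> I" for s w
  proof -
    have "\<forall>i. grad s $ i \<in> J" using deriv_I[OF that] by (simp add: grad_def all_3_0)
    then show ?thesis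
      using that I_J by (simp add: Z1_def curl_simps J_add J_mult' cross_J subset_iff)
  qed
qed

sublocale L2: lifted_maps I Z2
proof
  show "0 \<in> Z2" by (simp add: Z2_def divg_def J_zero)
  show "x + y \<in> Z2" if "x \<in> Z2" "y \<in> Z2" for x y
    using that by (simp add: Z2_def divg_simps J_add)
  show "s *s x \<in> Z2" if "x \<in> Z2" for s x
    using that by (simp add: Z2_def divg_simps J_add J_mult)
  show "s *s w \<in> Z2" if "s \<in> I" for s w
  proof -
    have "grad s $ 0 \<in> J" "grad s $ 1 \<in> J" "grad s $ 2 \<in> J" using deriv_I[OF that] by (simp_all add: grad_def)
    then show ?thesis
      using that I_J by (simp add: Z2_def divg_simps J_add J_mult' subset_iff)
  qed
qed

lemma grad_I: "f \<in> I \<Longrightarrow> grad f \<in> Z1"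
proof -
  assume f: "f \<in> I"
  have "\<forall>i. grad f $ i \<in> J" using deriv_I[OF f] by (simp add: grad_def all_3_0)
  then show ?thesis by (simp add: Z1_def curl_simps J_zero)
qed

lemma cross_Z1: "u \<in> Z1 \<Longrightarrow> cross u v \<in> Z2" "v \<in> Z1 \<Longrightarrow> cross u v \<in> Z2"
  by (simp_all add: Z1_def Z2_def cross_J divg_simps J_add J_diff J_mult J_mult')

abbreviation scalar :: "'k \<Rightarrow> 'k poly3 set" where "scalar c \<equiv> proj (Const3 c)"
abbreviation KK :: "'k ring" where "KK \<equiv> class_ring"
abbreviation F1 where "F1 \<equiv> free_module R (carrier R)"
abbreviation N1 where "N1 \<equiv> kaehler_null KK R scalar"
abbreviation Om1 where "Om1 \<equiv> kaehler KK R scalar"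

lemma F1_module: "Module.module R F1"
  by (rule free_module_module[OF cring_R])

sublocale F1: Module.module R F1 by (rule F1_module)

lemma gen_closed: "r \<in> carrier R \<Longrightarrow> free_gen R r \<in> carrier F1"
  by (rule free_gen_closed[OF cring_R])

lemma kaehler_rels_closed: "kaehler_rels KK R scalar \<subseteq> carrier F1"
  unfolding kaehler_rels_def Let_def
  by (intro Un_least subsetI; elim CollectE exE conjE; hypsubst;
      intro F1.M.minus_closed F1.M.a_closed F1.smult_closed gen_closed proj_hom(6) R.a_closed R.m_closed; assumption)

sublocale Q1: module_quotient R F1 N1
  unfolding kaehler_null_def
  by (rule module_quotient.intro[OF F1_module module_quotient_axioms.intro[OF F1.span_is_submodule[OF kaehler_rels_closed]]])

lemma Om1_module: "Module.module R Om1"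
  unfolding kaehler_def by (rule Q1.quotient_module)

sublocale Om1: Module.module R Om1 by (rule Om1_module)

definition D :: "'k poly3 \<Rightarrow> ('k poly3 set \<Rightarrow> 'k poly3 set) set" where
  "D s = kaehler_d KK R scalar (proj s)"

lemma D_coset: "D s = Q1.coset (free_gen R (proj s))"
  by (simp add: D_def kaehler_d_def)

lemma D_closed: "D s \<in> carrier Om1"
  unfolding D_coset kaehler_def Q1.quotient_simps(3) by (rule imageI[OF gen_closed[OF proj_hom(6)]])

lemma rel_N1: "x \<in> kaehler_rels KK R scalar \<Longrightarrow> x \<in> N1"
  unfolding kaehler_null_def by (rule subsetD[OF F1.in_own_span[OF kaehler_rels_closed]])

lemma D_add: "D (s + t) = D s \<oplus>\<^bsub>Om1\<^esub> D t"
proof -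
  note g = gen_closed[OF proj_hom(6)]
  have "free_gen R (proj s \<oplus>\<^bsub>R\<^esub> proj t) \<ominus>\<^bsub>F1\<^esub> (free_gen R (proj s) \<oplus>\<^bsub>F1\<^esub> free_gen R (proj t)) \<in> N1"
    by (rule rel_N1, unfold kaehler_rels_def Let_def, rule UnI1, rule UnI1, intro CollectI exI conjI, rule refl, rule proj_hom(6), rule proj_hom(6))
  from Q1.coset_eqI[OF this gen_closed[OF R.a_closed[OF proj_hom(6) proj_hom(6)]] F1.M.a_closed[OF g g]]
  show ?thesis unfolding D_coset kaehler_def Q1.quotient_simps(2)[OF g g] proj_hom(4) .
qed

lemma D_mult: "D (s * t) = proj s \<odot>\<^bsub>Om1\<^esub> D t \<oplus>\<^bsub>Om1\<^esub> proj t \<odot>\<^bsub>Om1\<^esub> D s"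
proof -
  note g = gen_closed[OF proj_hom(6)]
  note sg = F1.smult_closed[OF proj_hom(6) g]
  have "free_gen R (proj s \<otimes>\<^bsub>R\<^esub> proj t) \<ominus>\<^bsub>F1\<^esub> (proj s \<odot>\<^bsub>F1\<^esub> free_gen R (proj t) \<oplus>\<^bsub>F1\<^esub> proj t \<odot>\<^bsub>F1\<^esub> free_gen R (proj s)) \<in> N1"
    by (rule rel_N1, unfold kaehler_rels_def Let_def, rule UnI1, rule UnI2, intro CollectI exI conjI, rule refl, rule proj_hom(6), rule proj_hom(6))
  from Q1.coset_eqI[OF this gen_closed[OF R.m_closed[OF proj_hom(6) proj_hom(6)]] F1.M.a_closed[OF sg sg]]
  show ?thesis unfolding D_coset kaehler_def Q1.quotient_smult[OF proj_hom(6) g] Q1.quotient_simps(2)[OF sg sg] proj_hom(5) .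
qed

lemma D_Const: "D (Const3 c) = \<zero>\<^bsub>Om1\<^esub>"
proof -
  have "free_gen R (scalar c) \<in> N1"
    by (rule rel_N1, unfold kaehler_rels_def Let_def, rule UnI2, intro CollectI exI conjI, rule refl, simp only: partial_object.simps UNIV_I)
  then show ?thesis
    unfolding D_coset by (simp add: Q1.N.a_rcos_const kaehler_def quotient_module_def)
qed

definition dX :: "3 \<Rightarrow> ('k poly3 set \<Rightarrow> 'k poly3 set) set" where "dX i = D (Var3 i)"

lemma dX_closed: "dX i \<in> carrier Om1"
  unfolding dX_def by (rule D_closed)

definition omega :: "'k poly3 ^ 3 \<Rightarrow> ('k poly3 set \<Rightarrow> 'k poly3 set) set" where
  "omega = comb Om1 dX"

lemma omega_closed: "omega u \<in> carrier Om1"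
  unfolding omega_def by (rule comb_closed[OF Om1_module dX_closed])

lemma omega_add: "omega (u + v) = omega u \<oplus>\<^bsub>Om1\<^esub> omega v"
  unfolding omega_def by (rule comb_add[OF Om1_module dX_closed])

lemma omega_smult: "omega (s *s u) = proj s \<odot>\<^bsub>Om1\<^esub> omega u"
  unfolding omega_def by (rule comb_smult[OF Om1_module dX_closed])

lemma omega_zero: "omega 0 = \<zero>\<^bsub>Om1\<^esub>"
  unfolding omega_def by (rule comb_zero[OF Om1_module dX_closed])

lemma omega_uminus: "inv\<^bsub>add_monoid Om1\<^esub> omega u = omega (- u)"
  unfolding omega_def by (rule comb_uminus[OF Om1_module dX_closed])

lemma omega_axis: "omega (axis i 1) = dX i"
  unfolding omega_def by (rule comb_axis[OF Om1_module dX_closed])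

text \<open>\<open>D\<close> and the composition of \<open>omega\<close> with \<open>grad\<close>
  are both derivations that kill constants, and they agree on the variables. Hence every
  \<open>D f\<close> is a combination of the three \<open>dX i\<close>.\<close>

lemma D_chain_rule: "D f = omega (grad f)"
proof (induction f rule: poly3_ring_induct)
  case (Const c) show ?case unfolding D_Const grad_simps(4) omega_zero ..
next
  case (Var i) show ?case unfolding grad_Var omega_axis dX_def ..
next
  case (add g h) then show ?case by (simp only: D_add grad_simps(1) omega_add)
next
  case (mult g h) then show ?case by (simp only: D_mult grad_simps(3) omega_add omega_smult)
qed

lemma D_I: "f \<in> I \<Longrightarrow> D f = \<zero>\<^bsub>Om1\<^esub>"
proof -
  assume "f \<in> I"
  then have "proj f = scalar 0" unfolding proj_eq_iff by simp
  then have "D f = D (Const3 0)" unfolding D_def by simp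
  then show ?thesis unfolding D_Const .
qed

text \<open>The gradient satisfies the defining relations of the differentials, and gradients of
  elements of \<open>I\<close> lie in \<open>Z1\<close>, so it induces a map into S^3 / Z1. That map
  inverts \<open>omega\<close> modulo \<open>Z1\<close>.\<close>

lemma Om1_lift:
  obtains \<tau> where "L1.lin_mod Om1 \<tau>" "\<And>s. \<tau> (D s) - grad s \<in> Z1"
proof -
  obtain L where L: "L1.lin_mod F1 L" and L_gen: "\<And>r. r \<in> carrier R \<Longrightarrow> L (free_gen R r) - grad (rep r) \<in> Z1"
    using L1.free_module_lift[of "carrier R" "\<lambda>r. grad (rep r)"] by metis
  note g = gen_closed[OF proj_hom(6)]
  note sg = F1.smult_closed[OF proj_hom(6) g]
  let ?\<delta> = "\<lambda>s. free_gen R (proj s)"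
  have Ls: "L (?\<delta> s) - grad s \<in> Z1" for s
  proof -
    \<comment> \<open>Two preimages of a residue class differ by an element of \<open>I\<close>,
      whose gradient lies in \<open>Z1\<close>.\<close>
    have "grad (rep (proj s)) - grad s \<in> Z1"
      using grad_I[OF rep_proj[of s]] unfolding grad_simps(2) .
    from L1.Z_trans[OF L_gen[OF proj_hom(6)] this] show ?thesis .
  qed
  have split: "x - c = (x - (y + z)) + ((y - y') + (z - z'))" if "c = y' + z'" for x y z y' z' c :: "'k poly3 ^ 3"
    using that by simp
  have minus: "L x \<in> Z1" if "x = y \<ominus>\<^bsub>F1\<^esub> z" "y \<in> carrier F1" "z \<in> carrier F1" "L y - c \<in> Z1" "L z - c \<in> Z1" for x y z c
  proof -
    have "L x = (L x - (L y - L z)) + ((L y - c) - (L z - c))" by simp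
    also have "\<dots> \<in> Z1"
      unfolding that(1) by (rule L1.Z_add[OF L1.lin_mod_minus[OF F1_module L that(2,3)] L1.Z_diff[OF that(4,5)]])
    finally show ?thesis .
  qed
  have rels: "L r \<in> Z1" if r: "r \<in> kaehler_rels KK R scalar" for r
  proof -
    from r consider a b where "a \<in> carrier R" "b \<in> carrier R" "r = free_gen R (a \<oplus>\<^bsub>R\<^esub> b) \<ominus>\<^bsub>F1\<^esub> (free_gen R a \<oplus>\<^bsub>F1\<^esub> free_gen R b)"
      | a b where "a \<in> carrier R" "b \<in> carrier R" "r = free_gen R (a \<otimes>\<^bsub>R\<^esub> b) \<ominus>\<^bsub>F1\<^esub> (a \<odot>\<^bsub>F1\<^esub> free_gen R b \<oplus>\<^bsub>F1\<^esub> b \<odot>\<^bsub>F1\<^esub> free_gen R a)"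
      | c where "r = ?\<delta> (Const3 c)"
      unfolding kaehler_rels_def Let_def by (elim UnE CollectE exE conjE) blast+
    then show ?thesis
    proof cases
      case (1 a b)
      then obtain s t where st: "a = proj s" "b = proj t" unfolding proj_hom(1) by blast
      have "L (?\<delta> s \<oplus>\<^bsub>F1\<^esub> ?\<delta> t) - grad (s + t) \<in> Z1"
        unfolding split[OF grad_simps(1)[of s t], of _ "L (?\<delta> s)" "L (?\<delta> t)"]
        by (rule L1.Z_add[OF L1.lin_mod_add[OF L g g] L1.Z_add[OF Ls Ls]])
      from minus[OF 1(3)[unfolded st proj_hom(4)] g F1.M.a_closed[OF g g] Ls this] show ?thesis .
    next
      case (2 a b)
      then obtain s t where st: "a = proj s" "b = proj t" unfolding proj_hom(1) by blast
      have sL: "L (proj a \<odot>\<^bsub>F1\<^esub> ?\<delta> b) - a *s grad b \<in> Z1" for a b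
        by (rule L1.Z_trans[OF L1.lin_mod_smult[OF L g]]) (use L1.Z_smult[OF Ls[of b], of a] in \<open>simp only: vector_ssub_ldistrib\<close>)
      have "L (proj s \<odot>\<^bsub>F1\<^esub> ?\<delta> t \<oplus>\<^bsub>F1\<^esub> proj t \<odot>\<^bsub>F1\<^esub> ?\<delta> s) - grad (s * t) \<in> Z1"
        unfolding split[OF grad_simps(3)[of s t], of _ "L (proj s \<odot>\<^bsub>F1\<^esub> ?\<delta> t)" "L (proj t \<odot>\<^bsub>F1\<^esub> ?\<delta> s)"]
        by (rule L1.Z_add[OF L1.lin_mod_add[OF L sg sg] L1.Z_add[OF sL sL]])
      from minus[OF 2(3)[unfolded st proj_hom(5)] g F1.M.a_closed[OF sg sg] Ls this] show ?thesis .
    next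
      case (3 c)
      show ?thesis using Ls[of "Const3 c"] unfolding 3 grad_simps(4) diff_zero .
    qed
  qed
  obtain \<tau> where \<tau>: "L1.lin_mod Om1 \<tau>" "\<And>x. x \<in> carrier F1 \<Longrightarrow> \<tau> (Q1.coset x) - L x \<in> Z1"
    using L1.quotient_lift[OF F1_module L kaehler_rels_closed rels] unfolding kaehler_def kaehler_null_def by metis
  have "\<tau> (D s) - grad s \<in> Z1" for s
    unfolding D_coset by (rule L1.Z_trans[OF \<tau>(2)[OF g] Ls])
  with \<tau>(1) show thesis by (rule that)
qed

lemma omega_lift:
  assumes "L1.lin_mod Om1 \<tau>" "\<And>s. \<tau> (D s) - grad s \<in> Z1"
  shows "\<tau> (dX i) - axis i 1 \<in> Z1"
  using assms(2)[of "Var3 i"] unfolding dX_def grad_Var .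

subsection \<open>The exterior square\<close>

abbreviation C2 where "C2 \<equiv> carrier Om1 \<times> carrier Om1"
abbreviation F2 where "F2 \<equiv> free_module R C2"
abbreviation N2 where "N2 \<equiv> ext_square_null R Om1"
abbreviation Om2 where "Om2 \<equiv> ext_square R Om1"
abbreviation W where "W \<equiv> wedge R Om1"

lemma F2_module: "Module.module R F2"
  by (rule free_module_module[OF cring_R])

sublocale F2: Module.module R F2 by (rule F2_module)

lemma gen2_closed: "x \<in> carrier Om1 \<Longrightarrow> y \<in> carrier Om1 \<Longrightarrow> free_gen R (x, y) \<in> carrier F2"
  by (rule free_gen_closed[OF cring_R]) (rule SigmaI)

lemma ext_square_rels_closed: "ext_square_rels R Om1 \<subseteq> carrier F2"
  unfolding ext_square_rels_def Let_def
  by (intro Un_least subsetI; elim CollectE exE conjE; hypsubst;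
      intro F2.M.minus_closed F2.M.a_closed F2.smult_closed gen2_closed Om1.M.a_closed Om1.smult_closed; assumption)

sublocale Q2: module_quotient R F2 N2
  unfolding ext_square_null_def
  by (rule module_quotient.intro[OF F2_module module_quotient_axioms.intro[OF F2.span_is_submodule[OF ext_square_rels_closed]]])

lemma Om2_module: "Module.module R Om2"
  unfolding ext_square_def by (rule Q2.quotient_module)

sublocale Om2: Module.module R Om2 by (rule Om2_module)

lemma W_coset: "W x y = Q2.coset (free_gen R (x, y))"
  by (simp only: wedge_def)

lemma W_closed: "x \<in> carrier Om1 \<Longrightarrow> y \<in> carrier Om1 \<Longrightarrow> W x y \<in> carrier Om2"
  unfolding W_coset ext_square_def Q2.quotient_simps(3) by (rule imageI[OF gen2_closed])

lemma rel_N2: "x \<in> ext_square_rels R Om1 \<Longrightarrow> x \<in> N2"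
  unfolding ext_square_null_def by (rule subsetD[OF F2.in_own_span[OF ext_square_rels_closed]])

lemma W_add_left:
  assumes "x \<in> carrier Om1" "y \<in> carrier Om1" "z \<in> carrier Om1"
  shows "W (x \<oplus>\<^bsub>Om1\<^esub> y) z = W x z \<oplus>\<^bsub>Om2\<^esub> W y z"
proof -
  note g = gen2_closed[OF assms(1,3)] gen2_closed[OF assms(2,3)]
  have "free_gen R (x \<oplus>\<^bsub>Om1\<^esub> y, z) \<ominus>\<^bsub>F2\<^esub> (free_gen R (x, z) \<oplus>\<^bsub>F2\<^esub> free_gen R (y, z)) \<in> N2"
    by (rule rel_N2, unfold ext_square_rels_def Let_def, rule UnI1, rule UnI1, rule UnI1, rule UnI1,
        intro CollectI exI conjI, rule refl, (rule assms)+)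
  from Q2.coset_eqI[OF this gen2_closed[OF Om1.M.a_closed[OF assms(1,2)] assms(3)] F2.M.a_closed[OF g]]
  show ?thesis unfolding W_coset ext_square_def Q2.quotient_simps(2)[OF g] .
qed

lemma W_add_right:
  assumes "x \<in> carrier Om1" "y \<in> carrier Om1" "z \<in> carrier Om1"
  shows "W x (y \<oplus>\<^bsub>Om1\<^esub> z) = W x y \<oplus>\<^bsub>Om2\<^esub> W x z"
proof -
  note g = gen2_closed[OF assms(1,2)] gen2_closed[OF assms(1,3)]
  have "free_gen R (x, y \<oplus>\<^bsub>Om1\<^esub> z) \<ominus>\<^bsub>F2\<^esub> (free_gen R (x, y) \<oplus>\<^bsub>F2\<^esub> free_gen R (x, z)) \<in> N2"
    by (rule rel_N2, unfold ext_square_rels_def Let_def, rule UnI1, rule UnI1, rule UnI1, rule UnI2,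
        intro CollectI exI conjI, rule refl, (rule assms)+)
  from Q2.coset_eqI[OF this gen2_closed[OF assms(1) Om1.M.a_closed[OF assms(2,3)]] F2.M.a_closed[OF g]]
  show ?thesis unfolding W_coset ext_square_def Q2.quotient_simps(2)[OF g] .
qed

lemma W_smult_left:
  assumes "x \<in> carrier Om1" "y \<in> carrier Om1"
  shows "W (proj s \<odot>\<^bsub>Om1\<^esub> x) y = proj s \<odot>\<^bsub>Om2\<^esub> W x y"
proof -
  note g = gen2_closed[OF assms]
  have "free_gen R (proj s \<odot>\<^bsub>Om1\<^esub> x, y) \<ominus>\<^bsub>F2\<^esub> proj s \<odot>\<^bsub>F2\<^esub> free_gen R (x, y) \<in> N2"
    by (rule rel_N2, unfold ext_square_rels_def Let_def, rule UnI1, rule UnI1, rule UnI2,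
        intro CollectI exI conjI, rule refl, rule proj_hom(6), (rule assms)+)
  from Q2.coset_eqI[OF this gen2_closed[OF Om1.smult_closed[OF proj_hom(6) assms(1)] assms(2)] F2.smult_closed[OF proj_hom(6) g]]
  show ?thesis unfolding W_coset ext_square_def Q2.quotient_smult[OF proj_hom(6) g] .
qed

lemma W_smult_right:
  assumes "x \<in> carrier Om1" "y \<in> carrier Om1"
  shows "W x (proj s \<odot>\<^bsub>Om1\<^esub> y) = proj s \<odot>\<^bsub>Om2\<^esub> W x y"
proof -
  note g = gen2_closed[OF assms]
  have "free_gen R (x, proj s \<odot>\<^bsub>Om1\<^esub> y) \<ominus>\<^bsub>F2\<^esub> proj s \<odot>\<^bsub>F2\<^esub> free_gen R (x, y) \<in> N2"
    by (rule rel_N2, unfold ext_square_rels_def Let_def, rule UnI1, rule UnI2,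
        intro CollectI exI conjI, rule refl, rule proj_hom(6), (rule assms)+)
  from Q2.coset_eqI[OF this gen2_closed[OF assms(1) Om1.smult_closed[OF proj_hom(6) assms(2)]] F2.smult_closed[OF proj_hom(6) g]]
  show ?thesis unfolding W_coset ext_square_def Q2.quotient_smult[OF proj_hom(6) g] .
qed

lemma W_self:
  assumes "x \<in> carrier Om1"
  shows "W x x = \<zero>\<^bsub>Om2\<^esub>"
proof -
  have "free_gen R (x, x) \<in> N2"
    by (rule rel_N2, unfold ext_square_rels_def Let_def, rule UnI2, intro CollectI exI conjI, rule refl, rule assms)
  then show ?thesis
    unfolding W_coset by (simp add: Q2.N.a_rcos_const ext_square_def quotient_module_def)
qed

lemma W_zero_left:
  assumes "y \<in> carrier Om1"
  shows "W \<zero>\<^bsub>Om1\<^esub> y = \<zero>\<^bsub>Om2\<^esub>"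
proof -
  have "W (proj 0 \<odot>\<^bsub>Om1\<^esub> \<zero>\<^bsub>Om1\<^esub>) y = proj 0 \<odot>\<^bsub>Om2\<^esub> W \<zero>\<^bsub>Om1\<^esub> y"
    by (rule W_smult_left[OF Om1.M.zero_closed assms])
  then show ?thesis
    unfolding proj_hom(2)[symmetric] Om1.smult_l_null[OF Om1.M.zero_closed] Om2.smult_l_null[OF W_closed[OF Om1.M.zero_closed assms]] .
qed

text \<open>Polarisation: expand the square of x + y, which is zero.\<close>

lemma W_swap:
  assumes x: "x \<in> carrier Om1" and y: "y \<in> carrier Om1"
  shows "W y x = proj (- 1) \<odot>\<^bsub>Om2\<^esub> W x y"
proof -
  note c = W_closed[OF x y] W_closed[OF y x]
  have "\<zero>\<^bsub>Om2\<^esub> = W (x \<oplus>\<^bsub>Om1\<^esub> y) (x \<oplus>\<^bsub>Om1\<^esub> y)"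
    by (rule W_self[OF Om1.M.a_closed[OF x y], symmetric])
  also have "\<dots> = W x y \<oplus>\<^bsub>Om2\<^esub> W y x"
    unfolding W_add_left[OF x y Om1.M.a_closed[OF x y]] W_add_right[OF x x y] W_add_right[OF y x y] W_self[OF x] W_self[OF y]
      Om2.M.l_zero[OF c(1)] Om2.M.r_zero[OF c(2)] ..
  finally have "W y x \<oplus>\<^bsub>Om2\<^esub> W x y = \<zero>\<^bsub>Om2\<^esub>" unfolding Om2.M.a_comm[OF c] by (rule sym)
  then have "\<ominus>\<^bsub>Om2\<^esub> W x y = W y x" by (rule Om2.M.minus_equality[OF _ c])
  moreover have "proj (- 1) = \<ominus>\<^bsub>R\<^esub> \<one>\<^bsub>R\<^esub>" unfolding proj_hom(3,7) ..
  ultimately show ?thesis using Om2.smult_minus_1[OF c(1)] by simp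
qed

definition dXdX :: "3 \<Rightarrow> _" where
  "dXdX i = (if i = 0 then W (dX 1) (dX 2) else if i = 1 then W (dX 2) (dX 0) else W (dX 0) (dX 1))"

lemma dXdX_closed: "dXdX i \<in> carrier Om2"
  unfolding dXdX_def by (simp only: W_closed dX_closed split: if_split) simp

text \<open>The map S^3 -> Omega^2 that reads a vector as the coefficients of a 2-form; its kernel
  in high degrees is what has to be found.\<close>

definition psi where "psi = comb Om2 dXdX"

lemma psi_closed: "psi u \<in> carrier Om2"
  unfolding psi_def by (rule comb_closed[OF Om2_module dXdX_closed])

lemma psi_add: "psi (u + v) = psi u \<oplus>\<^bsub>Om2\<^esub> psi v"
  unfolding psi_def by (rule comb_add[OF Om2_module dXdX_closed])

lemma psi_smult: "psi (s *s u) = proj s \<odot>\<^bsub>Om2\<^esub> psi u"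
  unfolding psi_def by (rule comb_smult[OF Om2_module dXdX_closed])

lemma psi_I: "(\<And>i. u $ i \<in> I) \<Longrightarrow> psi u = \<zero>\<^bsub>Om2\<^esub>" for u :: "'k poly3 ^ 3"
  unfolding psi_def by (rule comb_I[OF Om2_module dXdX_closed])

lemma psi_zero: "psi 0 = \<zero>\<^bsub>Om2\<^esub>"
  unfolding psi_def by (rule comb_zero[OF Om2_module dXdX_closed])

lemma psi_uminus: "inv\<^bsub>add_monoid Om2\<^esub> psi u = psi (- u)"
  unfolding psi_def by (rule comb_uminus[OF Om2_module dXdX_closed])

lemma psi_axis: "psi (axis i 1) = dXdX i"
  unfolding psi_def by (rule comb_axis[OF Om2_module dXdX_closed])

end

section \<open>Linearity modulo a submodule, in congruence form\<close>

context lifted_maps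
begin

lemma lin_mod_add_cong:
  assumes "lin_mod M L" "x \<in> carrier M" "y \<in> carrier M" "L x - a \<in> Z" "L y - b \<in> Z"
  shows "L (x \<oplus>\<^bsub>M\<^esub> y) - (a + b) \<in> Z"
proof -
  have "L (x \<oplus>\<^bsub>M\<^esub> y) - (a + b) = (L (x \<oplus>\<^bsub>M\<^esub> y) - (L x + L y)) + ((L x - a) + (L y - b))" by simp
  then show ?thesis using Z_add[OF lin_mod_add[OF assms(1-3)] Z_add[OF assms(4,5)]] by (simp only:)
qed

lemma lin_mod_smult_cong:
  assumes "lin_mod M L" "x \<in> carrier M" "L x - a \<in> Z"
  shows "L (proj s \<odot>\<^bsub>M\<^esub> x) - s *s a \<in> Z"
  using Z_trans[OF lin_mod_smult[OF assms(1,2)] Z_smult[OF assms(3), of s, unfolded vector_ssub_ldistrib]] .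

lemma lin_mod_minus_cong:
  assumes "Module.module R M" "lin_mod M L" "x \<in> carrier M" "y \<in> carrier M" "L x - a \<in> Z" "L y - a \<in> Z"
  shows "L (x \<ominus>\<^bsub>M\<^esub> y) \<in> Z"
proof -
  have "L (x \<ominus>\<^bsub>M\<^esub> y) = (L (x \<ominus>\<^bsub>M\<^esub> y) - (L x - L y)) + ((L x - a) - (L y - a))" by simp
  then show ?thesis using Z_add[OF lin_mod_minus[OF assms(1-4)] Z_diff[OF assms(5,6)]] by (simp only:)
qed

end

section \<open>The exterior product as a cross product, and the kernel of \<open>psi\<close>\<close>

context differential_ideals
begin

lemma cross_axis:
  "cross (axis 0 1) (axis 1 1) = axis 2 (1::'a::comm_ring_1)"
  "cross (axis 1 1) (axis 2 1) = axis 0 (1::'a)"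
  "cross (axis 2 1) (axis 0 1) = axis 1 (1::'a)"
  by (simp_all add: vec3_eq_iff cross_def axis_def)

lemma cross_swap: "cross v u = (- 1) *s cross u v" for u v :: "'a::comm_ring_1 ^ 3"
  by (simp add: vec3_eq_iff cross_def)

lemma dXdX_simps: "dXdX 0 = W (dX 1) (dX 2)" "dXdX 1 = W (dX 2) (dX 0)" "dXdX 2 = W (dX 0) (dX 1)"
  unfolding dXdX_def by (simp_all only: three_distinct if_True if_False simp_thms)

text \<open>Three of the nine products hold by the cyclic choice of \<open>dXdX\<close>, three more
  follow by antisymmetry, and the squares are zero.\<close>

lemma W_dX: "W (dX i) (dX j) = psi (cross (axis i 1) (axis j 1))"
proof -
  have 1: "W (dX 0) (dX 1) = psi (cross (axis 0 1) (axis 1 1))"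
    "W (dX 1) (dX 2) = psi (cross (axis 1 1) (axis 2 1))"
    "W (dX 2) (dX 0) = psi (cross (axis 2 1) (axis 0 1))"
    unfolding cross_axis psi_axis dXdX_simps by (rule refl)+
  have 2: "W (dX j) (dX i) = psi (cross (axis j 1) (axis i 1))"
    if "W (dX i) (dX j) = psi (cross (axis i 1) (axis j 1))" for i j
    unfolding W_swap[OF dX_closed[of i] dX_closed[of j]] cross_swap[of "axis j 1"] psi_smult that ..
  have 3: "W (dX i) (dX i) = psi (cross (axis i 1) (axis i 1))" for i
    unfolding W_self[OF dX_closed] cross_linear(7) psi_zero ..
  have "\<forall>i j. W (dX i) (dX j) = psi (cross (axis i 1) (axis j 1))"
    unfolding all_3_0 by (intro conjI 1 2[OF 1(1)] 2[OF 1(2)] 2[OF 1(3)] 3)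
  then show ?thesis by blast
qed

lemma W_omega: "W (omega u) (omega v) = psi (cross u v)"
proof (induction u rule: vec3_induct)
  case (axis i)
  show ?case
  proof (induction v rule: vec3_induct)
    case (axis j)
    show ?case unfolding omega_axis W_dX ..
  next
    case (add u v)
    show ?case unfolding omega_add W_add_right[OF omega_closed omega_closed omega_closed] add cross_linear(2) psi_add ..
  next
    case (smult s u)
    show ?case unfolding omega_smult W_smult_right[OF omega_closed omega_closed] smult cross_linear(4) psi_smult ..
  qed
next
  case (add u w)
  show ?case unfolding omega_add W_add_left[OF omega_closed omega_closed omega_closed] add cross_linear(1) psi_add ..
next
  case (smult s u)
  show ?case unfolding omega_smult W_smult_left[OF omega_closed omega_closed] smult cross_linear(3) psi_smult ..
qed

text \<open>An element of \<open>I\<close> has zero differential over the factor ring, so its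
  products are zero. These are the relations that the primitives from local exactness
  supply.\<close>

lemma psi_cross_grad: "f \<in> I \<Longrightarrow> psi (cross (grad f) v) = \<zero>\<^bsub>Om2\<^esub>"
proof -
  assume "f \<in> I"
  then have "omega (grad f) = \<zero>\<^bsub>Om1\<^esub>" unfolding D_chain_rule[symmetric] by (rule D_I)
  then show ?thesis unfolding W_omega[symmetric] by (simp only: W_zero_left[OF omega_closed])
qed

text \<open>Changing a lifted 1-form by \<open>Z1\<close> changes a cross product by
  \<open>Z2\<close>. Bilinearity modulo \<open>Z2\<close> is therefore inherited from linearity
  modulo \<open>Z1\<close>, and the alternating rule holds because a vector has zero cross product
  with itself.\<close>

lemma Om2_lift:
  assumes \<tau>: "L1.lin_mod Om1 \<tau>"
  obtains T where "L2.lin_mod Om2 T"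
    "\<And>x y. x \<in> carrier Om1 \<Longrightarrow> y \<in> carrier Om1 \<Longrightarrow> T (W x y) - cross (\<tau> x) (\<tau> y) \<in> Z2"
proof -
  let ?e = "\<lambda>x y. cross (\<tau> x) (\<tau> y)"
  obtain L where L: "L2.lin_mod F2 L" and L_gen: "\<And>p. p \<in> C2 \<Longrightarrow> L (free_gen R p) - ?e (fst p) (snd p) \<in> Z2"
    by (rule L2.free_module_lift[of C2 "\<lambda>p. ?e (fst p) (snd p)"], rule that, assumption, blast)
  have Lg: "L (free_gen R (x, y)) - ?e x y \<in> Z2" if "x \<in> carrier Om1" "y \<in> carrier Om1" for x y
    using L_gen[OF SigmaI[OF that]] unfolding fst_conv snd_conv .
  note minus = L2.lin_mod_minus_cong[OF F2_module L]
  note add = L2.lin_mod_add_cong[OF L]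
  note smult = L2.lin_mod_smult_cong[OF L]
  have R1: "L (free_gen R (x \<oplus>\<^bsub>Om1\<^esub> y, z) \<ominus>\<^bsub>F2\<^esub> (free_gen R (x, z) \<oplus>\<^bsub>F2\<^esub> free_gen R (y, z))) \<in> Z2" if "x \<in> carrier Om1" "y \<in> carrier Om1" "z \<in> carrier Om1" for x y z
  proof -
    note xy = Om1.M.a_closed[OF that(1,2)]
    have "?e (x \<oplus>\<^bsub>Om1\<^esub> y) z - (?e x z + ?e y z) \<in> Z2"
      using cross_Z1(1)[OF L1.lin_mod_add[OF \<tau> that(1,2)], of "\<tau> z"] unfolding cross_linear .
    note A = L2.Z_trans[OF Lg[OF xy that(3)] this]
    note B = add[OF gen2_closed[OF that(1,3)] gen2_closed[OF that(2,3)] Lg[OF that(1,3)] Lg[OF that(2,3)]]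
    show ?thesis
      by (rule minus[OF gen2_closed[OF xy that(3)] F2.M.a_closed[OF gen2_closed[OF that(1,3)] gen2_closed[OF that(2,3)]] A B])
  qed
  have R2: "L (free_gen R (x, y \<oplus>\<^bsub>Om1\<^esub> z) \<ominus>\<^bsub>F2\<^esub> (free_gen R (x, y) \<oplus>\<^bsub>F2\<^esub> free_gen R (x, z))) \<in> Z2" if "x \<in> carrier Om1" "y \<in> carrier Om1" "z \<in> carrier Om1" for x y z
  proof -
    note yz = Om1.M.a_closed[OF that(2,3)]
    have "?e x (y \<oplus>\<^bsub>Om1\<^esub> z) - (?e x y + ?e x z) \<in> Z2"
      using cross_Z1(2)[OF L1.lin_mod_add[OF \<tau> that(2,3)], of "\<tau> x"] unfolding cross_linear .
    note A = L2.Z_trans[OF Lg[OF that(1) yz] this]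
    note B = add[OF gen2_closed[OF that(1,2)] gen2_closed[OF that(1,3)] Lg[OF that(1,2)] Lg[OF that(1,3)]]
    show ?thesis
      by (rule minus[OF gen2_closed[OF that(1) yz] F2.M.a_closed[OF gen2_closed[OF that(1,2)] gen2_closed[OF that(1,3)]] A B])
  qed
  have R3: "L (free_gen R (a \<odot>\<^bsub>Om1\<^esub> x, y) \<ominus>\<^bsub>F2\<^esub> a \<odot>\<^bsub>F2\<^esub> free_gen R (x, y)) \<in> Z2" if "a \<in> carrier R" "x \<in> carrier Om1" "y \<in> carrier Om1" for a x y
  proof -
    have "\<exists>s. a = proj s" using that(1) unfolding proj_hom(1) by blast
    then obtain s where s: "a = proj s" ..
    note ax = Om1.smult_closed[OF proj_hom(6)[of s] that(2)]
    have "?e (proj s \<odot>\<^bsub>Om1\<^esub> x) y - s *s ?e x y \<in> Z2"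
      using cross_Z1(1)[OF L1.lin_mod_smult[OF \<tau> that(2), of s], of "\<tau> y"] unfolding cross_linear .
    note A = L2.Z_trans[OF Lg[OF ax that(3)] this]
    note B = smult[OF gen2_closed[OF that(2,3)] Lg[OF that(2,3)], of s]
    show ?thesis unfolding s
      by (rule minus[OF gen2_closed[OF ax that(3)] F2.smult_closed[OF proj_hom(6) gen2_closed[OF that(2,3)]] A B])
  qed
  have R4: "L (free_gen R (x, a \<odot>\<^bsub>Om1\<^esub> y) \<ominus>\<^bsub>F2\<^esub> a \<odot>\<^bsub>F2\<^esub> free_gen R (x, y)) \<in> Z2" if "a \<in> carrier R" "x \<in> carrier Om1" "y \<in> carrier Om1" for a x y
  proof -
    have "\<exists>s. a = proj s" using that(1) unfolding proj_hom(1) by blast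
    then obtain s where s: "a = proj s" ..
    note ay = Om1.smult_closed[OF proj_hom(6)[of s] that(3)]
    have "?e x (proj s \<odot>\<^bsub>Om1\<^esub> y) - s *s ?e x y \<in> Z2"
      using cross_Z1(2)[OF L1.lin_mod_smult[OF \<tau> that(3), of s], of "\<tau> x"] unfolding cross_linear .
    note A = L2.Z_trans[OF Lg[OF that(2) ay] this]
    note B = smult[OF gen2_closed[OF that(2,3)] Lg[OF that(2,3)], of s]
    show ?thesis unfolding s
      by (rule minus[OF gen2_closed[OF that(2) ay] F2.smult_closed[OF proj_hom(6) gen2_closed[OF that(2,3)]] A B])
  qed
  have R5: "L (free_gen R (x, x)) \<in> Z2" if "x \<in> carrier Om1" for x
  proof -
    show ?thesis using Lg[OF that that] unfolding cross_linear(7) diff_zero .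
  qed
  have "ext_square_rels R Om1 \<subseteq> {r. L r \<in> Z2}"
    unfolding ext_square_rels_def Let_def
    by (intro Un_least subsetI CollectI; elim CollectE exE conjE; hypsubst;
        (rule R1 | rule R2 | rule R3 | rule R4 | rule R5); assumption)
  then have rels: "L r \<in> Z2" if "r \<in> ext_square_rels R Om1" for r
    using that by (rule subsetD[THEN CollectD])
  obtain T where T: "L2.lin_mod Om2 T" "\<And>x. x \<in> carrier F2 \<Longrightarrow> T (Q2.coset x) - L x \<in> Z2"
    by (rule L2.quotient_lift[OF F2_module L ext_square_rels_closed rels, folded ext_square_null_def, folded ext_square_def],
        assumption, rule that, assumption, blast)
  have "T (W x y) - ?e x y \<in> Z2" if "x \<in> carrier Om1" "y \<in> carrier Om1" for x y
    unfolding W_coset by (rule L2.Z_trans[OF T(2)[OF gen2_closed[OF that]] Lg[OF that]])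
  with T(1) show thesis by (rule that)
qed

text \<open>The lift from Omega^2 back to S^3 sends each \<open>dXdX i\<close> to a unit vector
  modulo \<open>Z2\<close>, hence inverts \<open>psi\<close> modulo \<open>Z2\<close>. This half of
  the description of the kernel holds in all degrees.\<close>

lemma psi_kernel:
  assumes "psi u = \<zero>\<^bsub>Om2\<^esub>"
  shows "u \<in> Z2"
proof -
  obtain \<tau> where \<tau>: "L1.lin_mod Om1 \<tau>" "\<And>s. \<tau> (D s) - grad s \<in> Z1"
    using Om1_lift by blast
  note \<tau>X = omega_lift[OF \<tau>]
  obtain T where T: "L2.lin_mod Om2 T"
    "\<And>x y. x \<in> carrier Om1 \<Longrightarrow> y \<in> carrier Om1 \<Longrightarrow> T (W x y) - cross (\<tau> x) (\<tau> y) \<in> Z2"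
    using Om2_lift[OF \<tau>(1)] by blast
  have TX: "T (W (dX i) (dX j)) - cross (axis i 1) (axis j 1) \<in> Z2" for i j
  proof -
    have 1: "cross (\<tau> (dX i)) (\<tau> (dX j)) - cross (axis i 1) (\<tau> (dX j)) \<in> Z2"
      using cross_Z1(1)[OF \<tau>X[of i], of "\<tau> (dX j)"] unfolding cross_linear .
    have 2: "cross (axis i 1) (\<tau> (dX j)) - cross (axis i 1) (axis j 1) \<in> Z2"
      using cross_Z1(2)[OF \<tau>X[of j], of "axis i 1"] unfolding cross_linear .
    show ?thesis
      by (rule L2.Z_trans[OF L2.Z_trans[OF T(2)[OF dX_closed dX_closed] 1] 2])
  qed
  have dXdX: "\<forall>i. T (dXdX i) - axis i 1 \<in> Z2"
    unfolding all_3_0 dXdX_simps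
    by (intro conjI TX[of 1 2, unfolded cross_axis] TX[of 2 0, unfolded cross_axis] TX[of 0 1, unfolded cross_axis])
  have s: "u $ i *s T (dXdX i) - u $ i *s axis i 1 \<in> Z2" for i
    using L2.Z_smult[OF spec[OF dXdX, of i], of "u $ i"] unfolding vector_ssub_ldistrib .
  have 1: "T (psi u) - (u $ 0 *s T (dXdX 0) + u $ 1 *s T (dXdX 1) + u $ 2 *s T (dXdX 2)) \<in> Z2"
    unfolding psi_def by (rule L2.lin_mod_comb[OF Om2_module T(1) dXdX_closed])
  have 0: "T (psi u) \<in> Z2" unfolding assms by (rule L2.lin_mod_zero[OF Om2_module T(1)])
  have split: "x + y + z = t - (t - (x' + y' + z')) - ((x' - x) + (y' - y) + (z' - z))" for t x y z x' y' z' :: "'k poly3 ^ 3"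
    by simp
  have "u $ 0 *s axis 0 1 + u $ 1 *s axis 1 1 + u $ 2 *s axis 2 1 \<in> Z2"
    by (subst split) (rule L2.Z_diff[OF L2.Z_diff[OF 0 1] L2.Z_add[OF L2.Z_add[OF s s] s]])
  then show ?thesis unfolding vec3_expand[symmetric] .
qed

section \<open>Graded components of the differentials\<close>

definition ring_grading :: "nat \<Rightarrow> 'k poly3 set set" where
  "ring_grading n = {proj f | f. homogeneous n f}"

abbreviation grading1 where "grading1 \<equiv> kaehler_grading KK R scalar ring_grading"
abbreviation grading2 where "grading2 \<equiv> ext_square_grading R Om1 grading1"

text \<open>A generator f dg with deg f + deg g = n has as coefficients f times a derivative of g.
  In degree 0 these vanish, which \<open>form_shift 1 n\<close> records without subtraction.\<close>

lemma grading1_subset: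
  assumes "x \<in> grading1 n"
  shows "\<exists>u :: 'k poly3 ^ 3. x = omega u \<and> (\<forall>i. form_shift 1 n (u $ i))"
proof -
  let ?S = "{a \<odot>\<^bsub>Om1\<^esub> kaehler_d KK R scalar b |a b i j. a \<in> ring_grading i \<and> b \<in> ring_grading j \<and> i + j = n}"
  have gen: "\<exists>u :: 'k poly3 ^ 3. x = omega u \<and> (\<forall>i. form_shift 1 n (u $ i))" if S: "x \<in> ?S" for x
  proof -
    obtain f g i j where x: "x = proj f \<odot>\<^bsub>Om1\<^esub> D g" and fg: "homogeneous i f" "homogeneous j g" "i + j = n"
      using S unfolding ring_grading_def D_def by blast
    have "form_shift 1 n ((f *s grad g) $ k)" for k
    proof -
      have "\<forall>k. form_shift (0 + Suc 0) (i + j) (f * grad g $ k)"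
        using fg(1,2) unfolding grad_def all_3_0 vec3_nth homogeneous_form_shift
        by (intro conjI form_shift_mult form_shift_pderiv3)
      then show ?thesis using fg(3) by simp
    qed
    then show ?thesis unfolding x D_chain_rule omega_smult[symmetric] by blast
  qed
  have "x \<in> generate (add_monoid Om1) ?S" using assms unfolding kaehler_grading_def .
  then show ?thesis
  proof induction
    case one
    show ?case by (intro exI[of _ 0]) (simp add: omega_zero)
  next
    case (incl h) then show ?case by (rule gen)
  next
    case (inv h)
    then obtain u :: "'k poly3 ^ 3" where u: "h = omega u" "\<forall>i. form_shift 1 n (u $ i)" using gen by blast
    then show ?case unfolding u(1) omega_uminus
      by (intro exI[of _ "- u"]) (simp add: form_shift_uminus)
  next
    case (eng h1 h2)
    then obtain u v :: "'k poly3 ^ 3" where u: "h1 = omega u" "\<forall>i. form_shift 1 n (u $ i)" and v: "h2 = omega v" "\<forall>i. form_shift 1 n (v $ i)"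
      by blast
    then show ?case
      by (intro exI[of _ "u + v"]) (simp add: omega_add form_shift_add)
  qed
qed

lemma grading1_dX: "homogeneous n f \<Longrightarrow> proj f \<odot>\<^bsub>Om1\<^esub> dX i \<in> grading1 (n + 1)"
  unfolding kaehler_grading_def dX_def D_def ring_grading_def
  by (rule generate.incl) (use homogeneous_Var(1)[of i] in blast)

text \<open>Products of two \<open>dX i\<close> have degree 2, and the bound on n keeps n - 2 from
  being truncated. This identifies the component as the image of a space of vectors of forms, on
  which dimensions can be counted.\<close>

lemma grading2_eq:
  assumes n: "2 \<le> n"
  shows "grading2 n = psi ` {u. \<forall>i. homogeneous (n - 2) (u $ i)}"
proof
  let ?S = "{W x y |x y i j. x \<in> grading1 i \<and> y \<in> grading1 j \<and> i + j = n}"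
  have hom: "homogeneous (n - 2) f \<longleftrightarrow> form_shift (1 + 1) n f" for f :: "'k poly3"
    using form_shift_homogeneous[OF n, of f] by (simp add: numeral_2_eq_2)
  let ?H = "{u :: 'k poly3 ^ 3. \<forall>i. homogeneous (n - 2) (u $ i)}"
  have gen: "h \<in> psi ` ?H" if S: "h \<in> ?S" for h
  proof -
    obtain x y i j where h: "h = W x y" "x \<in> grading1 i" "y \<in> grading1 j" "i + j = n" using S by blast
    obtain u v :: "'k poly3 ^ 3" where u: "x = omega u" "\<And>k. form_shift 1 i (u $ k)" and v: "y = omega v" "\<And>k. form_shift 1 j (v $ k)"
      using grading1_subset[OF h(2)] grading1_subset[OF h(3)] by blast
    have "\<forall>k. form_shift (1 + 1) (i + j) (cross u v $ k)"
    proof -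
      have "form_shift (1 + 1) (i + j) (u $ k * v $ l)" for k l
        by (rule form_shift_mult[OF u(2) v(2)])
      then show ?thesis by (simp only: all_3_0 cross_def vec3_nth form_shift_diff simp_thms)
    qed
    then have "cross u v \<in> ?H" unfolding hom h(4) by blast
    then show ?thesis unfolding h(1) u(1) v(1) W_omega by (rule imageI)
  qed
  show "grading2 n \<subseteq> psi ` ?H"
  proof
    fix h assume "h \<in> grading2 n"
    then have "h \<in> generate (add_monoid Om2) ?S" unfolding ext_square_grading_def .
    then show "h \<in> psi ` ?H"
    proof induction
      case one
      have "psi 0 \<in> psi ` ?H" by (rule imageI) (simp add: homogeneous_zero)
      then show ?case by (simp add: psi_zero)
    next
      case (incl h) then show ?case by (rule gen)
    next
      case (inv h)
      then obtain u where u: "h = psi u" "u \<in> ?H" using gen by blast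
      then have "- u \<in> ?H" by (simp add: homogeneous_uminus)
      then show ?case unfolding u(1) psi_uminus by (rule imageI)
    next
      case (eng h1 h2)
      then obtain u v where u: "h1 = psi u" "u \<in> ?H" and v: "h2 = psi v" "v \<in> ?H" by blast
      then have "u + v \<in> ?H" by (simp add: homogeneous_add)
      then have "psi (u + v) \<in> psi ` ?H" by (rule imageI)
      then show ?case by (simp add: u(1) v(1) psi_add)
    qed
  qed
  show "psi ` ?H \<subseteq> grading2 n"
  proof
    fix h assume "h \<in> psi ` ?H"
    then obtain u :: "'k poly3 ^ 3" where h: "h = psi u" and u: "\<And>i. homogeneous (n - 2) (u $ i)" by blast
    have X: "dX j \<in> grading1 1" for j
      using grading1_dX[OF homogeneous_one, of j] unfolding proj_hom(3)[symmetric] Om1.smult_one[OF dX_closed] by simp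
    have "proj (u $ i) \<odot>\<^bsub>Om2\<^esub> W (dX j) (dX k) \<in> grading2 n" for i j k
    proof -
      \<comment> \<open>The coefficient is attached to the first factor, which then has degree n -
        1, while the second factor has degree 1.\<close>
      have "proj (u $ i) \<odot>\<^bsub>Om1\<^esub> dX j \<in> grading1 (n - 2 + 1)" by (rule grading1_dX[OF u])
      moreover have "n - 2 + 1 + 1 = n" using n by simp
      ultimately have "W (proj (u $ i) \<odot>\<^bsub>Om1\<^esub> dX j) (dX k) \<in> ?S" using X[of k] by blast
      then show ?thesis
        unfolding ext_square_grading_def W_smult_left[OF dX_closed dX_closed] by (rule generate.incl)
    qed
    then have "proj (u $ i) \<odot>\<^bsub>Om2\<^esub> dXdX i \<in> grading2 n" for i
      unfolding dXdX_def by (simp only: split: if_split) simp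
    then show "h \<in> grading2 n"
      unfolding h psi_def comb_def ext_square_grading_def
      using generate.eng[of _ "add_monoid Om2" ?S] by simp
  qed
qed

end

subsection \<open>Dimension counts\<close>

text \<open>\<open>\<psi>\<close> and \<open>\<Phi>\<close> are linear on \<open>H\<close> with the
  same kernel; one maps onto V and the other onto the functions on B. Comparing the two directly
  avoids a quotient of \<open>H\<close>.\<close>

lemma dim_eq_card:
  fixes V :: "('k::field, 'v, 'm) module_scheme" and \<psi> :: "'w::ab_group_add \<Rightarrow> 'v"
    and sc :: "'k \<Rightarrow> 'w \<Rightarrow> 'w" and \<Phi> :: "'w \<Rightarrow> 'i \<Rightarrow> 'k"
  assumes V: "vectorspace class_ring V" and fin: "finite B" and carrier: "carrier V = \<psi> ` H"
    and H_add: "\<And>u v. u \<in> H \<Longrightarrow> v \<in> H \<Longrightarrow> u + v \<in> H" and H_diff: "\<And>u v. u \<in> H \<Longrightarrow> v \<in> H \<Longrightarrow> u - v \<in> H"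
    and H_sc: "\<And>a u. u \<in> H \<Longrightarrow> sc a u \<in> H"
    and \<psi>_add: "\<And>u v. u \<in> H \<Longrightarrow> v \<in> H \<Longrightarrow> \<psi> (u + v) = \<psi> u \<oplus>\<^bsub>V\<^esub> \<psi> v"
    and \<psi>_sc: "\<And>a u. u \<in> H \<Longrightarrow> \<psi> (sc a u) = a \<odot>\<^bsub>V\<^esub> \<psi> u"
    and \<Phi>_add: "\<And>u v i. u \<in> H \<Longrightarrow> v \<in> H \<Longrightarrow> \<Phi> (u + v) i = \<Phi> u i + \<Phi> v i"
    and \<Phi>_sc: "\<And>a u i. u \<in> H \<Longrightarrow> \<Phi> (sc a u) i = a * \<Phi> u i"
    and ker: "\<And>u. u \<in> H \<Longrightarrow> \<psi> u = \<zero>\<^bsub>V\<^esub> \<longleftrightarrow> (\<forall>i\<in>B. \<Phi> u i = 0)"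
    and surj: "\<And>t. \<exists>u\<in>H. \<forall>i\<in>B. \<Phi> u i = t i"
  shows "vectorspace.fin_dim class_ring V \<and> vectorspace.dim class_ring V = card B"
proof -
  interpret V: vectorspace class_ring V by (rule V)
  have \<psi>_closed: "\<psi> u \<in> carrier V" if "u \<in> H" for u using that carrier by blast
  have \<Phi>_diff: "\<Phi> (u - v) i = \<Phi> u i - \<Phi> v i" if "u \<in> H" "v \<in> H" for u v i
    using \<Phi>_add[OF H_diff[OF that] that(2), of i] by simp
  have eqI: "\<psi> u = \<psi> v \<longleftrightarrow> (\<forall>i\<in>B. \<Phi> u i = \<Phi> v i)" if "u \<in> H" "v \<in> H" for u v
  proof -
    have "\<psi> u = \<psi> (u - v) \<oplus>\<^bsub>V\<^esub> \<psi> v" using \<psi>_add[OF H_diff[OF that] that(2)] by simp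
    then have "\<psi> u = \<psi> v \<longleftrightarrow> \<psi> (u - v) = \<zero>\<^bsub>V\<^esub>"
      using V.M.add.l_cancel_one[OF \<psi>_closed[OF that(2)] \<psi>_closed[OF H_diff[OF that]]]
        V.M.add.r_cancel_one[OF \<psi>_closed[OF that(2)] \<psi>_closed[OF H_diff[OF that]]] by metis
    then show ?thesis using ker[OF H_diff[OF that]] \<Phi>_diff[OF that] by simp
  qed
  \<comment> \<open>Preimages of the unit vectors under \<open>\<Phi>\<close>; their images under
    \<open>\<psi>\<close> will be the basis.\<close>
  obtain e where e: "\<And>i. e i \<in> H" "\<And>i j. j \<in> B \<Longrightarrow> \<Phi> (e i) j = (if j = i then 1 else 0)"
  proof -
    have "\<exists>u. u \<in> H \<and> (\<forall>j\<in>B. \<Phi> u j = (if j = i then 1 else 0))" for i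
      using surj[of "\<lambda>j. if j = i then 1 else 0"] by blast
    then show ?thesis using that by metis
  qed
  let ?b = "\<lambda>i. \<psi> (e i)"
  have b: "?b i \<in> carrier V" for i by (rule \<psi>_closed[OF e(1)])
  have inj: "inj_on ?b B"
  proof (rule inj_onI)
    fix i j assume "i \<in> B" "j \<in> B" "\<psi> (e i) = \<psi> (e j)"
    then have "\<Phi> (e i) i = \<Phi> (e j) i" using eqI[OF e(1) e(1)] by blast
    then show "i = j" using e(2)[OF \<open>i \<in> B\<close>] by (simp split: if_splits)
  qed
  \<comment> \<open>\<open>\<Phi>\<close> reads the coefficients off a preimage of a linear
    combination. This gives independence, and also spanning, because elements with equal coordinates
    have equal images.\<close>
  have comb: "\<exists>u\<in>H. \<psi> u = (\<Oplus>\<^bsub>V\<^esub>i\<in>S. c i \<odot>\<^bsub>V\<^esub> ?b i) \<and> (\<forall>j\<in>B. \<Phi> u j = (if j \<in> S then c j else 0))"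
    if "S \<subseteq> B" for S c
    using finite_subset[OF that fin] that
  proof (induction S)
    case empty
    obtain u where "u \<in> H" "\<forall>j\<in>B. \<Phi> u j = 0" using surj[of "\<lambda>_. 0"] by blast
    then show ?case using ker[of u] by auto
  next
    case (insert i S)
    then obtain u where u: "u \<in> H" "\<psi> u = (\<Oplus>\<^bsub>V\<^esub>i\<in>S. c i \<odot>\<^bsub>V\<^esub> ?b i)"
      "\<forall>j\<in>B. \<Phi> u j = (if j \<in> S then c j else 0)" by auto
    have cb: "c i \<odot>\<^bsub>V\<^esub> ?b i \<in> carrier V" for i by (rule V.smult_closed[OF _ b]) simp
    have "(\<Oplus>\<^bsub>V\<^esub>i\<in>insert i S. c i \<odot>\<^bsub>V\<^esub> ?b i) = c i \<odot>\<^bsub>V\<^esub> ?b i \<oplus>\<^bsub>V\<^esub> \<psi> u"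
      unfolding u(2) using insert.hyps cb by (intro V.M.finsum_insert) auto
    also have "\<dots> = \<psi> (sc (c i) (e i) + u)"
      by (simp add: \<psi>_add[OF H_sc[OF e(1)] u(1)] \<psi>_sc[OF e(1)])
    finally have "\<psi> (sc (c i) (e i) + u) = (\<Oplus>\<^bsub>V\<^esub>i\<in>insert i S. c i \<odot>\<^bsub>V\<^esub> ?b i)" ..
    moreover have "\<Phi> (sc (c i) (e i) + u) j = (if j \<in> insert i S then c j else 0)" if "j \<in> B" for j
      using insert.hyps that u(3) by (auto simp: \<Phi>_add[OF H_sc[OF e(1)] u(1)] \<Phi>_sc[OF e(1)] e(2))
    ultimately show ?case using H_add[OF H_sc[OF e(1)] u(1)] by blast
  qed
  let ?A = "?b ` B"
  have A: "finite ?A" "?A \<subseteq> carrier V" using fin b by auto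
  have lincomb: "V.lincomb a ?A = (\<Oplus>\<^bsub>V\<^esub>i\<in>B. a (?b i) \<odot>\<^bsub>V\<^esub> ?b i)" for a
    unfolding V.lincomb_def by (rule V.M.finsum_reindex[OF _ inj]) (use b V.smult_closed in auto)
  have "V.lin_indpt ?A"
  proof (rule V.finite_lin_indpt2[OF A])
    fix a assume 0: "V.lincomb a ?A = \<zero>\<^bsub>V\<^esub>"
    obtain u where u: "u \<in> H" "\<psi> u = (\<Oplus>\<^bsub>V\<^esub>i\<in>B. a (?b i) \<odot>\<^bsub>V\<^esub> ?b i)" "\<forall>j\<in>B. \<Phi> u j = a (?b j)"
      using comb[OF order_refl, of "\<lambda>i. a (?b i)"] by auto
    then have "\<forall>j\<in>B. \<Phi> u j = 0" using 0 ker[OF u(1)] unfolding lincomb by simp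
    then show "\<forall>v\<in>?A. a v = \<zero>\<^bsub>class_ring\<^esub>" using u(3) by simp
  qed
  moreover have "V.gen_set ?A"
  proof
    show "V.span ?A \<subseteq> carrier V" by (rule V.span_is_subset2[OF A(2)])
    show "carrier V \<subseteq> V.span ?A"
    proof
      fix v assume "v \<in> carrier V"
      then obtain w where w: "v = \<psi> w" "w \<in> H" using carrier by blast
      obtain u where u: "u \<in> H" "\<psi> u = (\<Oplus>\<^bsub>V\<^esub>i\<in>B. \<Phi> w i \<odot>\<^bsub>V\<^esub> ?b i)" "\<forall>j\<in>B. \<Phi> u j = \<Phi> w j"
        using comb[OF order_refl, of "\<Phi> w"] by auto
      have "v = V.lincomb (\<lambda>x. \<Phi> w (inv_into B ?b x)) ?A"
        unfolding lincomb w(1) using eqI[OF w(2) u(1)] u(2,3) inj b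
        by (auto intro!: V.M.finsum_cong' V.smult_closed simp: inv_into_f_f[OF inj])
      then show "v \<in> V.span ?A" unfolding V.finite_span[OF A] by auto
    qed
  qed
  ultimately have "V.basis ?A" unfolding V.basis_def using A(2) by blast
  then have "V.dim = card ?A" by (rule V.dim_basis[OF A(1)])
  moreover have "V.fin_dim" unfolding V.fin_dim_def using A \<open>V.gen_set ?A\<close> by blast
  ultimately show ?thesis using card_image[OF inj] by simp
qed

context differential_ideals
begin

text \<open>Scalars act through the ring homomorphism K -> R, so the laws come from Omega^2; closure
  comes from the component being an image under \<open>psi\<close>.\<close>

lemma component_vectorspace:
  assumes n: "2 \<le> n"
  shows "vectorspace KK (component_space scalar Om2 (grading2 n))"
proof -
  let ?V = "component_space scalar Om2 (grading2 n)"
  let ?H = "{u :: 'k poly3 ^ 3. \<forall>i. homogeneous (n - 2) (u $ i)}"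
  have ops: "x \<oplus>\<^bsub>?V\<^esub> y = x \<oplus>\<^bsub>Om2\<^esub> y" "c \<odot>\<^bsub>?V\<^esub> x = scalar c \<odot>\<^bsub>Om2\<^esub> x" "\<zero>\<^bsub>?V\<^esub> = \<zero>\<^bsub>Om2\<^esub>" for x y c
    by (simp_all add: component_space_def)
  have car: "carrier ?V = psi ` ?H" by (simp add: component_space_def grading2_eq[OF n])
  have elim: "\<exists>u\<in>?H. x = psi u" if "x \<in> carrier ?V" for x using that unfolding car by blast
  have mem: "x \<in> carrier Om2" if "x \<in> carrier ?V" for x using elim[OF that] psi_closed by blast
  have psi_mem: "psi u \<in> carrier ?V" if "\<And>i. homogeneous (n - 2) (u $ i)" for u :: "'k poly3 ^ 3"
    unfolding car using that by blast
  have add: "x \<oplus>\<^bsub>Om2\<^esub> y \<in> carrier ?V" if xy: "x \<in> carrier ?V" "y \<in> carrier ?V" for x y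
  proof -
    obtain u v where "u \<in> ?H" "x = psi u" "v \<in> ?H" "y = psi v" using elim[OF xy(1)] elim[OF xy(2)] by blast
    then show ?thesis using psi_mem[of "u + v"] by (simp add: psi_add homogeneous_add)
  qed
  have smult: "scalar c \<odot>\<^bsub>Om2\<^esub> x \<in> carrier ?V" if x: "x \<in> carrier ?V" for x c
  proof -
    obtain u where "u \<in> ?H" "x = psi u" using elim[OF x] by blast
    then show ?thesis using psi_mem[of "Const3 c *s u"] by (simp add: psi_smult homogeneous_Const_mult)
  qed
  have "Module.module KK ?V"
  proof (rule module_criteria, unfold ops)
    show "cring KK" by (rule class_cring.cring_axioms)
    show "\<zero>\<^bsub>Om2\<^esub> \<in> carrier ?V" using psi_mem[of 0] by (simp add: psi_zero homogeneous_zero)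
    show "\<forall>v w. v \<in> carrier ?V \<and> w \<in> carrier ?V \<longrightarrow> v \<oplus>\<^bsub>Om2\<^esub> w \<in> carrier ?V" using add by blast
    show "\<forall>v\<in>carrier ?V. \<exists>w\<in>carrier ?V. v \<oplus>\<^bsub>Om2\<^esub> w = \<zero>\<^bsub>Om2\<^esub>"
    proof
      fix v assume v: "v \<in> carrier ?V"
      then obtain u where u: "u \<in> ?H" "v = psi u" using elim by blast
      have "v \<oplus>\<^bsub>Om2\<^esub> psi (- u) = \<zero>\<^bsub>Om2\<^esub>"
        unfolding u(2) psi_add[symmetric] by (simp add: psi_zero)
      then show "\<exists>w\<in>carrier ?V. v \<oplus>\<^bsub>Om2\<^esub> w = \<zero>\<^bsub>Om2\<^esub>"
        using psi_mem[of "- u"] u(1) by (auto simp: homogeneous_uminus)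
    qed
    show "\<forall>c v. c \<in> carrier KK \<and> v \<in> carrier ?V \<longrightarrow> scalar c \<odot>\<^bsub>Om2\<^esub> v \<in> carrier ?V" using smult by blast
    show "\<forall>v w. v \<in> carrier ?V \<and> w \<in> carrier ?V \<longrightarrow> v \<oplus>\<^bsub>Om2\<^esub> w = w \<oplus>\<^bsub>Om2\<^esub> v"
      using mem Om2.M.a_comm by blast
    show "\<forall>v w x. v \<in> carrier ?V \<and> w \<in> carrier ?V \<and> x \<in> carrier ?V \<longrightarrow> v \<oplus>\<^bsub>Om2\<^esub> w \<oplus>\<^bsub>Om2\<^esub> x = v \<oplus>\<^bsub>Om2\<^esub> (w \<oplus>\<^bsub>Om2\<^esub> x)"
      using mem Om2.M.a_assoc by blast
    show "\<forall>v\<in>carrier ?V. v \<oplus>\<^bsub>Om2\<^esub> \<zero>\<^bsub>Om2\<^esub> = v" using mem Om2.M.r_zero by blast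
    show "\<forall>a b v. a \<in> carrier KK \<and> b \<in> carrier KK \<and> v \<in> carrier ?V \<longrightarrow>
        scalar (a \<otimes>\<^bsub>KK\<^esub> b) \<odot>\<^bsub>Om2\<^esub> v = scalar a \<odot>\<^bsub>Om2\<^esub> (scalar b \<odot>\<^bsub>Om2\<^esub> v)"
    proof (intro allI impI)
      fix a b v assume "a \<in> carrier KK \<and> b \<in> carrier KK \<and> v \<in> carrier ?V"
      then have v: "v \<in> carrier Om2" using mem by blast
      have "scalar (a \<otimes>\<^bsub>KK\<^esub> b) = scalar a \<otimes>\<^bsub>R\<^esub> scalar b" unfolding proj_hom(5) by (simp add: term3_mult)
      then show "scalar (a \<otimes>\<^bsub>KK\<^esub> b) \<odot>\<^bsub>Om2\<^esub> v = scalar a \<odot>\<^bsub>Om2\<^esub> (scalar b \<odot>\<^bsub>Om2\<^esub> v)"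
        by (simp only: Om2.smult_assoc1[OF proj_hom(6) proj_hom(6) v])
    qed
    show "\<forall>v\<in>carrier ?V. scalar \<one>\<^bsub>KK\<^esub> \<odot>\<^bsub>Om2\<^esub> v = v"
    proof
      fix v assume "v \<in> carrier ?V"
      then have v: "v \<in> carrier Om2" using mem by blast
      have "scalar \<one>\<^bsub>KK\<^esub> = \<one>\<^bsub>R\<^esub>" unfolding proj_hom(3) by simp
      then show "scalar \<one>\<^bsub>KK\<^esub> \<odot>\<^bsub>Om2\<^esub> v = v" by (simp only: Om2.smult_one[OF v])
    qed
    show "\<forall>a b v. a \<in> carrier KK \<and> b \<in> carrier KK \<and> v \<in> carrier ?V \<longrightarrow>
        scalar (a \<oplus>\<^bsub>KK\<^esub> b) \<odot>\<^bsub>Om2\<^esub> v = scalar a \<odot>\<^bsub>Om2\<^esub> v \<oplus>\<^bsub>Om2\<^esub> scalar b \<odot>\<^bsub>Om2\<^esub> v"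
    proof (intro allI impI)
      fix a b v assume "a \<in> carrier KK \<and> b \<in> carrier KK \<and> v \<in> carrier ?V"
      then have v: "v \<in> carrier Om2" using mem by blast
      have "scalar (a \<oplus>\<^bsub>KK\<^esub> b) = scalar a \<oplus>\<^bsub>R\<^esub> scalar b" unfolding proj_hom(4) by (simp add: single_add)
      then show "scalar (a \<oplus>\<^bsub>KK\<^esub> b) \<odot>\<^bsub>Om2\<^esub> v = scalar a \<odot>\<^bsub>Om2\<^esub> v \<oplus>\<^bsub>Om2\<^esub> scalar b \<odot>\<^bsub>Om2\<^esub> v"
        by (simp only: Om2.smult_l_distr[OF proj_hom(6) proj_hom(6) v])
    qed
    show "\<forall>a v w. a \<in> carrier KK \<and> v \<in> carrier ?V \<and> w \<in> carrier ?V \<longrightarrow>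
        scalar a \<odot>\<^bsub>Om2\<^esub> (v \<oplus>\<^bsub>Om2\<^esub> w) = scalar a \<odot>\<^bsub>Om2\<^esub> v \<oplus>\<^bsub>Om2\<^esub> scalar a \<odot>\<^bsub>Om2\<^esub> w"
      using Om2.smult_r_distr[OF proj_hom(6) mem mem] by blast
  qed
  then show ?thesis by (rule vectorspace.intro[OF _ class_field])
qed

end

subsection \<open>Jets of forms\<close>

text \<open>Because of the truncated subtraction, the monomial has degree n only for i + j \<le>
  n.\<close>

definition jet_exp :: "nat \<Rightarrow> nat \<Rightarrow> nat \<Rightarrow> mon3" where
  "jet_exp n i j = Poly_Mapping.single 0 (n - i - j) + Poly_Mapping.single 1 i + Poly_Mapping.single 2 j"

lemma expo_jet_exp: "expo (jet_exp n i j) 0 = n - i - j" "expo (jet_exp n i j) 1 = i" "expo (jet_exp n i j) 2 = j"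
  by (simp_all add: jet_exp_def lookup_add lookup_single)

lemma hdeg_jet_exp: "hdeg (jet_exp n i j) = i + j"
  by (simp add: hdeg_def expo_jet_exp)

lemma mdeg_jet_exp: "i + j \<le> n \<Longrightarrow> mdeg (jet_exp n i j) = n"
  by (simp add: mdeg_def sum_3_0 expo_jet_exp)

lemma jet_exp_inject: "jet_exp n i j = jet_exp n i' j' \<longleftrightarrow> i = i' \<and> j = j'"
  by (metis expo_jet_exp(2,3))

definition jet :: "nat \<Rightarrow> 'k::field ^ 3 \<Rightarrow> 'k poly3 \<Rightarrow> nat \<Rightarrow> nat \<Rightarrow> 'k" where
  "jet n v f i j = coeff3 (taylor v f) (jet_exp n i j)"

lemma jet_add: "jet n v (f + g) i j = jet n v f i j + jet n v g i j"
  by (simp add: jet_def taylor_add lookup_add)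

lemma jet_diff: "jet n v (f - g) i j = jet n v f i j - jet n v g i j"
  by (simp add: jet_def taylor_diff lookup_minus)

lemma jet_Const_mult: "jet n v (Const3 c * f) i j = c * jet n v f i j"
proof -
  have "coeff3 (Const3 c * g) m = c * coeff3 g m" for g :: "'a poly3" and m
  proof (induction g rule: poly3_term_induct)
    case (monom n)
    show ?case by (simp add: term3_mult lookup_single when_def)
  qed (simp_all add: distrib_left lookup_add)
  then show ?thesis by (simp add: jet_def taylor_mult)
qed

lemma jet_vanish: "f \<in> vanish_order v k \<Longrightarrow> i + j < k \<Longrightarrow> jet n v f i j = 0"
  by (simp add: jet_def vanish_order_def order_ge_iff hdeg_jet_exp)

lemma jet_cong: "f - g \<in> vanish_order v k \<Longrightarrow> i + j < k \<Longrightarrow> jet n v f i j = jet n v g i j"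
  using jet_vanish[of "f - g" v k i j n] by (simp add: jet_diff)

text \<open>In a form of degree n, a monomial is determined by its exponents of X_1 and X_2, so the
  jets are all the Taylor coefficients.\<close>

lemma vanish_orderI:
  assumes f: "homogeneous n f" and jet: "\<And>i j. i + j < k \<Longrightarrow> jet n v f i j = 0"
  shows "f \<in> vanish_order v k"
  unfolding vanish_order_def order_ge_def mem_Collect_eq
proof (rule ballI, rule ccontr)
  fix m assume m: "m \<in> Poly_Mapping.keys (taylor v f)" and "\<not> k \<le> hdeg m"
  then have k: "expo m 1 + expo m 2 < k" by (simp add: hdeg_def)
  have "(\<Sum>i\<in>UNIV. expo m i) = n" using homogeneous_taylor[OF f, of v] m unfolding homogeneous_def by blast
  then have n: "n - expo m 1 - expo m 2 = expo m 0" by (auto simp: sum_3_0)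
  have "jet_exp n (expo m 1) (expo m 2) = m"
    unfolding jet_exp_def n by (rule mon3_eq[symmetric])
  then show False using jet[OF k] m by (simp add: jet_def in_keys_iff)
qed

text \<open>The form is written down at (1 : 0 : 0) and moved to \<open>v\<close> by the inverse
  shear; the bound on i + j gives all its monomials degree n.\<close>

lemma jet_exists:
  assumes T: "finite T" "\<And>i j. (i, j) \<in> T \<Longrightarrow> i + j \<le> n"
  shows "\<exists>f. homogeneous n f \<and> (\<forall>i j. jet n v f i j = (if (i, j) \<in> T then t i j else 0))"
proof -
  let ?g = "\<Sum>(i, j)\<in>T. term3 (jet_exp n i j) (t i j)"
  have "homogeneous n (term3 (jet_exp n i j) (t i j))" if "(i, j) \<in> T" for i j
    using homogeneous_term[of "jet_exp n i j"] mdeg_jet_exp[OF T(2)[OF that]] by simp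
  then have "homogeneous n ?g" by (intro homogeneous_sum) auto
  moreover have "coeff3 ?g (jet_exp n i j) = (if (i, j) \<in> T then t i j else 0)" for i j
  proof -
    have "coeff3 ?g (jet_exp n i j) = (\<Sum>p\<in>T. if p = (i, j) then t i j else 0)"
      unfolding lookup_sum by (intro sum.cong refl) (auto simp: lookup_single when_def jet_exp_inject split: if_splits)
    then show ?thesis using T(1) by simp
  qed
  ultimately show ?thesis
    by (intro exI[of _ "taylor (- v) ?g"]) (simp add: jet_def taylor_inverse homogeneous_taylor)
qed

definition below :: "nat \<Rightarrow> (nat \<times> nat) set" where "below k = {(i, j). i + j < k}"
text \<open>The index pairs of order k - 1. Written with \<open>Suc\<close>, the set is empty for k
  = 0.\<close>

definition diagonal :: "nat \<Rightarrow> (nat \<times> nat) set" where "diagonal k = {(i, j). Suc (i + j) = k}"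

lemma finite_below [simp]: "finite (below k)"
  by (rule finite_subset[of _ "{..k} \<times> {..k}"]) (auto simp: below_def)

lemma finite_diagonal [simp]: "finite (diagonal k)"
  by (rule finite_subset[of _ "{..k} \<times> {..k}"]) (auto simp: diagonal_def)

lemma card_diagonal: "card (diagonal k) = k"
proof -
  have "diagonal k = (\<lambda>i. (i, k - Suc i)) ` {..<k}" by (auto simp: diagonal_def image_iff)
  moreover have "inj_on (\<lambda>i. (i, k - Suc i)) {..<k}" by (auto intro: inj_onI)
  ultimately show ?thesis by (simp add: card_image)
qed

lemma card_below: "2 * card (below k) = k * (k + 1)"
proof (induction k)
  case 0 show ?case by (simp add: below_def)
next
  case (Suc k)
  have "below (Suc k) = below k \<union> diagonal (Suc k)" "below k \<inter> diagonal (Suc k) = {}"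
    by (auto simp: below_def diagonal_def)
  then have "card (below (Suc k)) = card (below k) + Suc k" by (simp add: card_Un_disjoint card_diagonal)
  then show ?case using Suc by simp
qed

subsection \<open>The Hilbert function in high degrees\<close>

context plane_points
begin

lemma vanish_all_ideal: "ideal (vanish_all k) class_ring"
  by (auto simp: class_ring_ideal_iff vanish_all_def vanish_order_add vanish_order_absorb)

lemma differential_ideals: "differential_ideals (vanish_all (Suc k)) (vanish_all k)"
proof (intro differential_ideals.intro factor_ring.intro differential_ideals_axioms.intro vanish_all_ideal)
  show "vanish_all (Suc k) \<subseteq> vanish_all k" using vanish_order_mono by (fastforce simp: vanish_all_def)
  show "pderiv3 i f \<in> vanish_all k" if "f \<in> vanish_all (Suc k)" for f i
    using that by (auto simp: vanish_all_def intro!: vanish_order_pderiv3)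
qed

text \<open>\<open>Inl\<close>-indices are the jets of order less than \<open>k\<close> of the three components of a 2-form at
  the points, \<open>Inr\<close>-indices the coefficients of order \<open>k - 1\<close> of its differential.\<close>

definition jet_index where
  "jet_index k = (pts \<times> (UNIV :: 3 set) \<times> below k) <+> (pts \<times> diagonal k)"

text \<open>\<open>n\<close> is the degree of the coefficients of \<open>u\<close>, so the
  divergence is a form of degree n - 1.\<close>

definition jet_coord :: "nat \<Rightarrow> 'k poly3 ^ 3 \<Rightarrow> ('k ^ 3) \<times> 3 \<times> nat \<times> nat + ('k ^ 3) \<times> nat \<times> nat \<Rightarrow> 'k" where
  "jet_coord n u x = (case x of Inl (v, c, i, j) \<Rightarrow> jet n v (u $ c) i j
     | Inr (v, i, j) \<Rightarrow> jet (n - 1) v (divg u) i j)"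

lemma finite_jet_index: "finite (jet_index k)"
  unfolding jet_index_def using finite_pts by simp

lemma card_jet_index: "2 * card (jet_index k) = card pts * (3 * (k * (k + 1)) + 2 * k)"
proof -
  have "card (jet_index k) = card pts * (3 * card (below k)) + card pts * k"
    unfolding jet_index_def using finite_pts by (simp add: card_Plus card_cartesian_product card_diagonal)
  then have "2 * card (jet_index k) = card pts * (3 * (2 * card (below k))) + card pts * (2 * k)" by simp
  then show ?thesis unfolding card_below by (simp add: algebra_simps)
qed

lemma homogeneous_divg: "(\<And>i. homogeneous (Suc n) (u $ i)) \<Longrightarrow> homogeneous n (divg u)" for u :: "'k poly3 ^ 3"
  unfolding divg_def by (intro homogeneous_add homogeneous_pderiv3)

lemma interp_degree_mono: "k \<le> l \<Longrightarrow> interp_degree k \<le> interp_degree l"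
  unfolding interp_degree_def by (intro add_mono mult_mono) auto

text \<open>Once the coefficients of \<open>u\<close> vanish to order k, the divergence vanishes to
  order k - 1 by itself; the \<open>Inr\<close>-coordinates are its remaining terms of order k -
  1.\<close>

lemma jet_coord_zero:
  fixes u :: "'k poly3 ^ 3"
  assumes u: "\<And>i. homogeneous (Suc n) (u $ i)" and zero: "\<forall>x\<in>jet_index k. jet_coord (Suc n) u x = 0"
  shows "u $ c \<in> vanish_all k" "divg u \<in> vanish_all k"
proof -
  have uc: "u $ c \<in> vanish_order v k" if v: "v \<in> pts" for v c
  proof (rule vanish_orderI[OF u])
    fix i j :: nat assume "i + j < k"
    then have "Inl (v, c, i, j) \<in> jet_index k" using v by (auto simp: jet_index_def below_def)
    then show "jet (Suc n) v (u $ c) i j = 0" using zero by (fastforce simp: jet_coord_def)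
  qed
  then show "u $ c \<in> vanish_all k" by (simp add: vanish_all_def)
  have "divg u \<in> vanish_order v k" if v: "v \<in> pts" for v
  proof (rule vanish_orderI[OF homogeneous_divg[OF u]])
    fix i j :: nat assume ij: "i + j < k"
    then obtain l where l: "k = Suc l" by (cases k) auto
    show "jet n v (divg u) i j = 0"
    proof (cases "Suc (i + j) = k")
      case True
      then have "Inr (v, i, j) \<in> jet_index k" using v by (auto simp: jet_index_def diagonal_def)
      then show ?thesis using zero by (fastforce simp: jet_coord_def)
    next
      case False
      have "divg u \<in> vanish_order v l"
        unfolding divg_def by (intro vanish_order_add vanish_order_pderiv3 uc[OF v, unfolded l])
      then show ?thesis by (rule jet_vanish) (use False ij l in simp)
    qed
  qed
  then show "divg u \<in> vanish_all k" by (simp add: vanish_all_def)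
qed

text \<open>The coefficient jets are interpolated first, which produces some divergence. Its part of
  order k - 1 is then corrected by means of \<open>primitive\<close>, whose solutions vanish to
  order k and so leave the coefficient jets unchanged.\<close>

lemma jet_coord_surj:
  assumes n: "interp_degree (Suc k) \<le> n" and kn: "k \<le> n"
  shows "\<exists>u. (\<forall>i. homogeneous (Suc n) (u $ i)) \<and> (\<forall>x\<in>jet_index k. jet_coord (Suc n) u x = t x)"
proof -
  have "\<exists>f. homogeneous (Suc n) f \<and> (\<forall>v\<in>pts. \<forall>i j. i + j < k \<longrightarrow> jet (Suc n) v f i j = t (Inl (v, c, i, j)))" for c
  proof -
    have "\<exists>f. homogeneous (Suc n) f \<and> (\<forall>i j. jet (Suc n) v f i j = (if (i, j) \<in> below k then t (Inl (v, c, i, j)) else 0))" for v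
      by (rule jet_exists[OF finite_below]) (use kn in \<open>simp add: below_def\<close>)
    then obtain h where h: "\<And>v. homogeneous (Suc n) (h v)"
      "\<And>v i j. jet (Suc n) v (h v) i j = (if (i, j) \<in> below k then t (Inl (v, c, i, j)) else 0)" by metis
    have "interp_degree k \<le> Suc n" using n interp_degree_mono[of k "Suc k"] by simp
    then obtain f where f: "homogeneous (Suc n) f" "\<forall>v\<in>pts. f - h v \<in> vanish_order v k"
      using interpolation[of "Suc n" h k] h(1) by blast
    have "jet (Suc n) v f i j = t (Inl (v, c, i, j))" if "v \<in> pts" "i + j < k" for v i j
      using jet_cong[of f "h v" v k i j "Suc n"] f(2) that h(2)[of v i j] by (simp add: below_def)
    then show ?thesis using f(1) by blast
  qed
  then obtain F where F: "\<And>c. homogeneous (Suc n) (F c)"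
    "\<And>c v i j. v \<in> pts \<Longrightarrow> i + j < k \<Longrightarrow> jet (Suc n) v (F c) i j = t (Inl (v, c, i, j))" by metis
  define u where "u = vec3 (F 0) (F 1) (F 2)"
  have uF: "\<forall>c. u $ c = F c" by (simp add: u_def all_3_0)
  have "\<exists>f g. homogeneous (Suc n) f \<and> homogeneous (Suc n) g \<and> (\<forall>v\<in>pts. f \<in> vanish_order v k \<and> g \<in> vanish_order v k \<and>
      (\<forall>i j. Suc (i + j) = k \<longrightarrow> jet n v (pderiv3 1 f + pderiv3 2 g) i j = t (Inr (v, i, j)) - jet n v (divg u) i j))"
  proof (cases k)
    case 0
    then show ?thesis by (intro exI[of _ 0]) (simp add: homogeneous_zero)
  next
    case (Suc l)
    have "\<exists>f. homogeneous n f \<and> (\<forall>i j. jet n v f i j = (if (i, j) \<in> diagonal k then t (Inr (v, i, j)) - jet n v (divg u) i j else 0))" for v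
      by (rule jet_exists[OF finite_diagonal]) (use kn in \<open>simp add: diagonal_def\<close>)
    then obtain h where h: "\<And>v. homogeneous n (h v)"
      "\<And>v i j. jet n v (h v) i j = (if (i, j) \<in> diagonal k then t (Inr (v, i, j)) - jet n v (divg u) i j else 0)" by metis
    \<comment> \<open>Only jets of order l = k - 1 are prescribed as nonzero, so
      \<open>primitive\<close> applies at order l.\<close>
    have hv: "h v \<in> vanish_order v l" for v
      by (rule vanish_orderI[OF h(1)]) (auto simp: h(2) diagonal_def Suc)
    have "interp_degree (Suc (Suc l)) \<le> Suc n" using n unfolding Suc by simp
    then obtain f g where fg: "homogeneous (Suc n) f" "homogeneous (Suc n) g"
      "\<forall>v\<in>pts. f \<in> vanish_order v (Suc l) \<and> g \<in> vanish_order v (Suc l) \<and> pderiv3 1 f + pderiv3 2 g - h v \<in> vanish_order v (Suc l)"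
      using primitive[of n h l] h(1) hv by blast
    have "jet n v (pderiv3 1 f + pderiv3 2 g) i j = t (Inr (v, i, j)) - jet n v (divg u) i j"
      if "v \<in> pts" "Suc (i + j) = k" for v i j
      using jet_cong[of "pderiv3 1 f + pderiv3 2 g" "h v" v "Suc l" i j n] fg(3) that h(2)[of v i j] by (simp add: diagonal_def Suc)
    then show ?thesis using fg unfolding Suc by blast
  qed
  then obtain f g where fg: "homogeneous (Suc n) f" "homogeneous (Suc n) g"
    "\<And>v. v \<in> pts \<Longrightarrow> f \<in> vanish_order v k" "\<And>v. v \<in> pts \<Longrightarrow> g \<in> vanish_order v k"
    "\<And>v i j. v \<in> pts \<Longrightarrow> Suc (i + j) = k \<Longrightarrow> jet n v (pderiv3 1 f + pderiv3 2 g) i j = t (Inr (v, i, j)) - jet n v (divg u) i j"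
    by blast
  define w where "w = u + vec3 0 f g"
  have "\<forall>c. homogeneous (Suc n) (w $ c)"
    using uF F(1) fg(1,2) unfolding w_def all_3_0 by (simp add: homogeneous_add)
  moreover have "jet_coord (Suc n) w x = t x" if x: "x \<in> jet_index k" for x
  proof (cases x)
    case (Inl y)
    obtain v c i j where y: "y = (v, c, i, j)" by (cases y) auto
    have v: "v \<in> pts" "i + j < k" using x unfolding Inl y by (auto simp: jet_index_def below_def)
    have "\<forall>c. jet (Suc n) v (w $ c) i j = jet (Suc n) v (u $ c) i j"
      using jet_vanish[OF fg(3)[OF v(1)] v(2)] jet_vanish[OF fg(4)[OF v(1)] v(2)] unfolding w_def all_3_0 by (simp add: jet_add)
    then show ?thesis unfolding Inl y jet_coord_def using F(2)[OF v, of c] uF by simp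
  next
    case (Inr y)
    obtain v i j where y: "y = (v, i, j)" by (cases y) auto
    have v: "v \<in> pts" "Suc (i + j) = k" using x unfolding Inr y by (auto simp: jet_index_def diagonal_def)
    have "divg w = divg u + (pderiv3 1 f + pderiv3 2 g)"
      unfolding w_def divg_def by (simp add: pderiv3_add algebra_simps)
    then show ?thesis unfolding Inr y jet_coord_def using fg(5)[OF v] by (simp add: jet_add)
  qed
  ultimately show ?thesis by blast
qed

lemma dim_Om2:
  assumes n: "interp_degree (Suc (Suc k)) \<le> n" and kn: "k \<le> n"
  defines "I \<equiv> vanish_all (Suc k)"
  defines "Om1 \<equiv> kaehler class_ring (class_ring Quot I) (\<lambda>c. I +>\<^bsub>class_ring\<^esub> Const3 c)"
  defines "V \<equiv> component_space (\<lambda>c. I +>\<^bsub>class_ring\<^esub> Const3 c) (ext_square (class_ring Quot I) Om1)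
    (ext_square_grading (class_ring Quot I) Om1
      (kaehler_grading class_ring (class_ring Quot I) (\<lambda>c. I +>\<^bsub>class_ring\<^esub> Const3 c)
        (\<lambda>n. {I +>\<^bsub>class_ring\<^esub> f | f. homogeneous n f})) (n + 3))"
  shows "vectorspace.fin_dim class_ring V \<and> vectorspace.dim class_ring V = card (jet_index k)"
proof -
  interpret D: differential_ideals I "vanish_all k" unfolding I_def by (rule differential_ideals)
  have gr: "(\<lambda>n. {I +>\<^bsub>class_ring\<^esub> f | f. homogeneous n f}) = D.ring_grading"
    by (rule ext) (simp only: D.ring_grading_def)
  have n3: "2 \<le> n + 3" "n + 3 - 2 = Suc n" by simp_all
  note V = V_def[unfolded Om1_def gr]
  let ?H = "{u :: 'k poly3 ^ 3. \<forall>i. homogeneous (Suc n) (u $ i)}"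
  show ?thesis
  proof (rule dim_eq_card[where \<psi> = D.psi and H = ?H and sc = "\<lambda>c u. Const3 c *s u" and \<Phi> = "jet_coord (Suc n)"])
    show "vectorspace class_ring V" unfolding V by (rule D.component_vectorspace[OF n3(1)])
    show "finite (jet_index k)" by (rule finite_jet_index)
    show "carrier V = D.psi ` ?H" unfolding V component_space_def using D.grading2_eq[OF n3(1)] unfolding n3(2) by simp
    show "u + v \<in> ?H" if "u \<in> ?H" "v \<in> ?H" for u v using that by (simp add: homogeneous_add)
    show "u - v \<in> ?H" if "u \<in> ?H" "v \<in> ?H" for u v using that by (simp add: homogeneous_diff)
    show "Const3 a *s u \<in> ?H" if "u \<in> ?H" for a u using that by (simp add: homogeneous_Const_mult)
    show "D.psi (u + v) = D.psi u \<oplus>\<^bsub>V\<^esub> D.psi v" for u v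
      unfolding V component_space_def D.psi_add by simp
    show "D.psi (Const3 a *s u) = a \<odot>\<^bsub>V\<^esub> D.psi u" for a u
      unfolding V component_space_def D.psi_smult by simp
    have dv: "divg (u + v) = divg u + divg v" "divg (Const3 a *s u) = Const3 a * divg u" for u v :: "'k poly3 ^ 3" and a
      by (simp_all add: divg_def pderiv3_add pderiv3_mult algebra_simps)
    show "jet_coord (Suc n) (u + v) x = jet_coord (Suc n) u x + jet_coord (Suc n) v x" for u v x
      by (auto simp: jet_coord_def jet_add dv split: sum.split)
    show "jet_coord (Suc n) (Const3 a *s u) x = a * jet_coord (Suc n) u x" for a u x
      by (auto simp: jet_coord_def jet_Const_mult dv split: sum.split)
    show "\<exists>u\<in>?H. \<forall>x\<in>jet_index k. jet_coord (Suc n) u x = t x" for t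
      using jet_coord_surj[of k n t] n kn interp_degree_mono[of "Suc k" "Suc (Suc k)"] by auto
    fix u assume "u \<in> ?H"
    then have u: "\<And>i. homogeneous (Suc n) (u $ i)" by blast
    have zero: "\<zero>\<^bsub>V\<^esub> = \<zero>\<^bsub>D.Om2\<^esub>" unfolding V component_space_def by simp
    show "D.psi u = \<zero>\<^bsub>V\<^esub> \<longleftrightarrow> (\<forall>x\<in>jet_index k. jet_coord (Suc n) u x = 0)"
    proof
      assume "D.psi u = \<zero>\<^bsub>V\<^esub>"
      then have "u \<in> D.Z2" unfolding zero by (rule D.psi_kernel)
      then have "u $ c \<in> vanish_all k" "divg u \<in> vanish_all k" for c
        unfolding D.Z2_def by blast+
      then have "u $ c \<in> vanish_order v k" "divg u \<in> vanish_order v k" if "v \<in> pts" for v c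
        using that by (auto simp: vanish_all_def)
      then show "\<forall>x\<in>jet_index k. jet_coord (Suc n) u x = 0"
        by (auto simp: jet_index_def jet_coord_def below_def diagonal_def intro!: jet_vanish[where k = k])
    next
      assume "\<forall>x\<in>jet_index k. jet_coord (Suc n) u x = 0"
      note van = jet_coord_zero[OF u this]
      have "interp_degree (Suc (Suc k)) \<le> Suc (Suc n)" using n by simp
      then obtain f g h where fgh: "f \<in> I" "g \<in> I" "h \<in> I"
        "u $ 0 - pderiv3 1 f - pderiv3 2 g \<in> I" "u $ 1 + pderiv3 0 f - pderiv3 2 h \<in> I" "u $ 2 + pderiv3 0 g + pderiv3 1 h \<in> I"
        using divergence_exact[OF u van] unfolding I_def by blast
      define w where "w = vec3 (u $ 0 - pderiv3 1 f - pderiv3 2 g) (u $ 1 + pderiv3 0 f - pderiv3 2 h) (u $ 2 + pderiv3 0 g + pderiv3 1 h)"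
      \<comment> \<open>As forms, this is w + df dX_2 - dg dX_1 + dh dX_0 (exterior products). The
        coefficients of w and the functions f, g, h lie in \<open>I\<close>, so \<open>psi\<close>
        kills every summand.\<close>
      have "u = w + (cross (grad f) (axis 2 1) + (cross (grad g) (- axis 1 1) + cross (grad h) (axis 0 1)))"
        by (simp add: w_def vec3_eq_iff cross_def grad_def axis_def)
      moreover have "D.psi w = \<zero>\<^bsub>D.Om2\<^esub>"
      proof (rule D.psi_I)
        have "\<forall>i. w $ i \<in> I" using fgh(4-6) by (simp add: w_def all_3_0)
        then show "w $ i \<in> I" for i by blast
      qed
      ultimately have "D.psi u = \<zero>\<^bsub>D.Om2\<^esub>"
        by (simp only: D.psi_add D.psi_cross_grad[OF fgh(1)] D.psi_cross_grad[OF fgh(2)] D.psi_cross_grad[OF fgh(3)]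
            D.Om2.M.l_zero[OF D.Om2.M.zero_closed])
      then show "D.psi u = \<zero>\<^bsub>V\<^esub>" unfolding zero .
    qed
  qed
qed

end

section \<open>From projective points to normalised vectors, and the final count\<close>

lemma normalized_points:
  fixes \<X> :: "('k::field_char_0 ^ 3) set set"
  assumes X: "\<X> \<subseteq> proj_plane" "finite \<X>" "\<forall>P\<in>\<X>. \<forall>v\<in>P. v $ 0 \<noteq> 0"
  obtains pts where "plane_points pts" "\<X> = line_of ` pts" "card pts = card \<X>"
proof -
  have "\<exists>v. v $ 0 = 1 \<and> P = line_of v" if P: "P \<in> \<X>" for P
  proof -
    obtain w :: "'k ^ 3" where w: "P = {c *s w | c. c \<noteq> 0}" using X(1) P unfolding proj_plane_def by blast
    have "w \<in> P" unfolding w by (auto intro!: exI[of _ 1])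
    then have w0: "w $ 0 \<noteq> 0" using X(3) P by blast
    let ?v = "inverse (w $ 0) *s w"
    have "line_of ?v = P"
    proof (intro subset_antisym subsetI)
      fix x assume "x \<in> line_of ?v"
      then obtain c where "c \<noteq> 0" "x = (c * inverse (w $ 0)) *s w"
        unfolding line_of_def vector_smult_assoc by blast
      then show "x \<in> P" unfolding w using w0 by (intro CollectI exI[of _ "c * inverse (w $ 0)"]) simp
    next
      fix x assume "x \<in> P"
      then obtain c where "c \<noteq> 0" "x = c *s w" unfolding w by blast
      then show "x \<in> line_of ?v"
        unfolding line_of_def vector_smult_assoc using w0 by (intro CollectI exI[of _ "c * w $ 0"]) (simp add: mult.assoc)
    qed
    then show ?thesis using w0 by (intro exI[of _ ?v]) simp
  qed
  then obtain p where p: "\<And>P. P \<in> \<X> \<Longrightarrow> p P $ 0 = 1 \<and> P = line_of (p P)" by metis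
  \<comment> \<open>A point is recovered from its normalised vector as \<open>line_of\<close>, so
    distinct points get distinct vectors.\<close>
  have "inj_on p \<X>" using p by (metis inj_onI)
  show thesis
  proof (rule that[of "p ` \<X>"])
    show "plane_points (p ` \<X>)" by unfold_locales (use X(2) p in auto)
    show "\<X> = line_of ` p ` \<X>" using p by (force simp: image_image)
    show "card (p ` \<X>) = card \<X>" by (rule card_image) fact
  qed
qed

theorem corollary8p7:
  fixes \<X> :: "('k::field_char_0 ^ 3) set set" and s \<nu> :: nat
  assumes "\<X> \<subseteq> proj_plane" and "finite \<X>" and "card \<X> = s"
    and "\<forall>P\<in>\<X>. \<forall>v\<in>P. v $ 0 \<noteq> 0"
    and "\<nu> \<ge> 1"
  shows "is_hilbert_polynomial class_ring (fat_scalar \<X> \<nu>)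
           (fat_Omega2 \<X> \<nu>) (fat_Omega2_grading \<X> \<nu>)
           [:1 / 2 * (3 * of_nat \<nu> ^ 2 - of_nat \<nu> - 2) * of_nat s:]"
proof -
  obtain pts where pts: "plane_points pts" "\<X> = line_of ` pts" "card pts = card \<X>"
    using normalized_points[OF assms(1,2,4)] by blast
  interpret plane_points pts by (rule pts(1))
  obtain k where k: "\<nu> = Suc k" using assms(5) by (cases \<nu>) auto
  have I: "fat_ideal \<X> \<nu> = vanish_all (Suc k)"
    unfolding fat_ideal_def vanish_all_def pts(2) k
    unfolding image_image by (rule INF_cong[OF refl]) (rule vanishing_ideal_power[OF normalized])
  have scalar: "fat_scalar \<X> \<nu> = (\<lambda>c. vanish_all (Suc k) +>\<^bsub>class_ring\<^esub> Const3 c)"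
    by (rule ext) (simp only: fat_scalar_def I)
  have grading: "fat_grading \<X> \<nu> = (\<lambda>n. {vanish_all (Suc k) +>\<^bsub>class_ring\<^esub> f | f. homogeneous n f})"
    by (rule ext) (simp only: fat_grading_def I)
  have card: "2 * card (jet_index k) = s * (3 * (k * (k + 1)) + 2 * k)"
    using card_jet_index[of k] pts(3) assms(3) by simp
  have "(2 :: rat) * of_nat (card (jet_index k)) = of_nat s * (3 * (of_nat k * (of_nat k + 1)) + 2 * of_nat k)"
    using arg_cong[OF card, of "of_nat :: nat \<Rightarrow> rat"] by (simp add: algebra_simps)
  \<comment> \<open>Both sides are 3 k^2 + 5 k: this is twice the number of jet coordinates per
    point.\<close>
  moreover have "3 * of_nat \<nu> ^ 2 - of_nat \<nu> - 2 = (3 * (of_nat k * (of_nat k + 1)) + 2 * of_nat k :: rat)"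
    unfolding k by (simp add: power2_eq_square algebra_simps)
  ultimately have dim: "of_nat (card (jet_index k)) = (1 / 2 * (3 * of_nat \<nu> ^ 2 - of_nat \<nu> - 2) * of_nat s :: rat)"
    by (simp add: mult.commute)
  show ?thesis
    unfolding is_hilbert_polynomial_def eventually_sequentially
  proof (intro exI allI impI)
    \<comment> \<open>The 3 consists of the degree 2 of the generators and 1 more, which lets the
      coefficients have degree \<open>Suc (n - 3)\<close>.\<close>
    fix n assume n: "interp_degree (Suc (Suc k)) + k + 3 \<le> n"
    let ?n = "n - 3"
    have n': "interp_degree (Suc (Suc k)) \<le> ?n" "k \<le> ?n" "?n + 3 = n" using n by simp_all
    from dim_Om2[OF n'(1,2), folded scalar grading, folded I, unfolded n'(3)]
    show "vectorspace.fin_dim class_ring (component_space (fat_scalar \<X> \<nu>) (fat_Omega2 \<X> \<nu>) (fat_Omega2_grading \<X> \<nu> n)) \<and>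
      of_nat (vectorspace.dim class_ring (component_space (fat_scalar \<X> \<nu>) (fat_Omega2 \<X> \<nu>) (fat_Omega2_grading \<X> \<nu> n)))
      = poly [:1 / 2 * (3 * of_nat \<nu> ^ 2 - of_nat \<nu> - 2) * of_nat s :: rat:] (of_nat n)"
      unfolding fat_Omega2_def fat_Omega1_def fat_Omega2_grading_def fat_Omega1_grading_def fat_ring_def
      using dim by simp
  qed
qed



end
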